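(* Let $f:(\mathbb{C}^3,0)\to(\mathbb{C},0)$ be an isolated and nondegenerate (in the Kouchnirenko sense) singularity. (1) If $\Gamma^{2}(f)=\emptyset$ or $\Gamma^{2}(f)=E_f$, then there exists exactly one segment $I\in\mathcal{J}\cap\Gamma^{1}(f)$, and $${\pounds}_0(f)=m(I)-1.$$ (2) If $\Gamma^2(f)\setminus E_f\neq\emptyset$, then $${\pounds}_0(f)\leq\max_{S\in\Gamma^{2}(f)\setminus E_f} m(S)-1.$$
   Context: Notation: $\mathbb{R}_+=[0,\infty)$. Let $f$ be holomorphic near $0\in\mathbb{C}^n$ (here $n=3$) with Taylor expansion $\sum_{\nu\in\mathbb{N}^n}a_\nu z^\nu$. The Newton diagram is $\Gamma_+(f)=\operatorname{conv}\bigcup\{\nu+\mathbb{R}^n_+: a_\nu\neq 0\}$. For $u\in\mathbb{R}^n_+\setminus\{0\}$ put $l(u,\Gamma_+(f))=\inf\{\langle u,v\rangle: v\in\Gamma_+(f)\}$ and $\Delta(u,\Gamma_+(f))=\{v\in\Gamma_+(f):\langle u,v\rangle=l(u,\Gamma_+(f))\}$; the faces of $\Gamma_+(f)$ are the sets $\Delta(u,\Gamma_+(f))$. $\Gamma(f)$ is the family of compact faces and $\Gamma^k(f)$ the set of compact $k$-dimensional faces. For $S\in\Gamma(f)$, $f_S=\sum_{\nu\in S}a_\nu z^\nu$; $f$ is nondegenerate on $S$ if the system $(f_S)'_{z_1}=\dots=(f_S)'_{z_n}=0$ has no solution in $(\mathbb{C}\setminus\{0\})^n$; $f$ is nondegenerate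 (in the Kouchnirenko sense) if it is nondegenerate on every $S\in\Gamma(f)$. A singularity is a nonzero holomorphic $f$ near the origin with $f(0)=0$, $\nabla f(0)=0$, where $\nabla f=(f'_{z_1},\dots,f'_{z_n})$; it is isolated if moreover $\nabla f(z)\ne0$ for all $z\neq0$ near $0$. A face $S\in\Gamma^{n-1}(f)$ is exceptional with respect to the axis $OX_i$ if one of its vertices is at distance $1$ from the axis $OX_i$ and the other vertices of $S$ are the vertices of an $(n-2)$-dimensional face which lies in one of the coordinate hyperplanes containing the axis $OX_i$. $S$ is exceptional if it is exceptional with respect to some axis; $E_f$ is the set of exceptional faces of $f$. For $S\in\Gamma^{n-1}(f)$, let $x_1(S),\dots,x_n(S)$ be the (nonzero) coordinates of the points of intersection of the hyperplane spanned by $S$ with the coordinate axes, i.e. $x_i(S)=l(u,\Gamma_+(f))/u_i$ if $S=\Delta(u,\Gamma_+(f))$; $m(S)=\max_i x_i(S)$. Let $\overline{AB}$ denote the segment joining $A,B$. For $k\in\{2,3,\dots\}$ put $I_1^k=\overline{(0,1,1)(k,0,0)}$, $I_2^k=\overline{(1,0,1)(0,k,0)}$, $I_3^k=\overline{(1,1,0)(0,0,k)}$ in $\mathbb{R}^3$, $\mathcal{J}=\{I_j^k: j=1,2,3,\ k=2,3,\dots\}$, and $m(I_j^k)=k$. The Łojasiewicz exponent of an isolated singularity $f$ is ${\pounds}_0(f)=\inf\{\alpha\in\mathbb{R}_+:\exists C>0\ \exists r>0\ \forall \|z\|<r,\ \|\nabla f(z)\|\ge C\|z\|^\alpha\}$.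 *)

theory Defs
  imports "HOL-Analysis.Analysis"
begin

section \<open>Holomorphic functions near the origin\<close>

definition monomial :: "complex ^ 'n::finite \<Rightarrow> nat ^ 'n \<Rightarrow> complex" where
  "monomial z \<nu> = (\<Prod>i\<in>UNIV. (z $ i) ^ (\<nu> $ i))"

text \<open>
  Multivariate analogue of \<^const>\<open>has_fps_expansion\<close>: the series converges
  unconditionally (for complex terms: absolutely) to \<open>f\<close> on a neighbourhood of 0.
  The coefficients are then uniquely determined by the germ of \<open>f\<close>.
  Only the germ of the total function \<open>f\<close> at 0 matters throughout.
\<close>
definition has_taylor_expansion ::
    "(complex ^ 'n::finite \<Rightarrow> complex) \<Rightarrow> (nat ^ 'n \<Rightarrow> complex) \<Rightarrow> bool" where
  "has_taylor_expansion f a \<longleftrightarrow>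
     (\<exists>r>0. \<forall>z. norm z < r \<longrightarrow> ((\<lambda>\<nu>. a \<nu> * monomial z \<nu>) has_sum f z) UNIV)"

definition holomorphic_near_0 :: "(complex ^ 'n::finite \<Rightarrow> complex) \<Rightarrow> bool" where
  "holomorphic_near_0 f \<longleftrightarrow> (\<exists>a. has_taylor_expansion f a)"

definition partial_deriv ::
    "'n \<Rightarrow> (complex ^ 'n::finite \<Rightarrow> complex) \<Rightarrow> complex ^ 'n \<Rightarrow> complex" where
  "partial_deriv i f z = deriv (\<lambda>t. f (\<chi> j. if j = i then t else z $ j)) (z $ i)"

definition gradient ::
    "(complex ^ 'n::finite \<Rightarrow> complex) \<Rightarrow> complex ^ 'n \<Rightarrow> complex ^ 'n" where
  "gradient f z = (\<chi> i. partial_deriv i f z)"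

definition is_singularity :: "(complex ^ 'n::finite \<Rightarrow> complex) \<Rightarrow> bool" where
  "is_singularity f \<longleftrightarrow>
     holomorphic_near_0 f \<and> \<not> (\<forall>\<^sub>F z in nhds 0. f z = 0) \<and> f 0 = 0 \<and> gradient f 0 = 0"

definition isolated_singularity :: "(complex ^ 'n::finite \<Rightarrow> complex) \<Rightarrow> bool" where
  "isolated_singularity f \<longleftrightarrow> is_singularity f \<and> (\<forall>\<^sub>F z in at 0. gradient f z \<noteq> 0)"

text \<open>
  For an isolated singularity the set of admissible exponents is nonempty, so the real
  infimum is the intended one.  The convention \<open>0 powr 0 = 0\<close> is harmless: the exponent
  0 is not admissible for a singularity, the gradient being continuous and vanishing at 0.
\<close>
definition lojasiewicz_exponent :: "(complex ^ 'n::finite \<Rightarrow> complex) \<Rightarrow> real" where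
  "lojasiewicz_exponent f =
     Inf {\<alpha>. 0 \<le> \<alpha> \<and>
             (\<exists>C>0. \<exists>r>0. \<forall>z. norm z < r \<longrightarrow> norm (gradient f z) \<ge> C * norm z powr \<alpha>)}"

section \<open>The Newton diagram\<close>

text \<open>Everything here depends only on the family \<open>a\<close> of Taylor coefficients of \<open>f\<close>.\<close>

definition nonneg_orthant :: "(real ^ 'n::finite) set" where
  "nonneg_orthant = {w. \<forall>i. 0 \<le> w $ i}"

definition exponent_point :: "nat ^ 'n::finite \<Rightarrow> real ^ 'n" where
  "exponent_point \<nu> = (\<chi> i. real (\<nu> $ i))"

definition newton_diagram :: "(nat ^ 'n::finite \<Rightarrow> complex) \<Rightarrow> (real ^ 'n) set" where
  "newton_diagram a =
     convex hull (\<Union>\<nu>\<in>{\<nu>. a \<nu> \<noteq> 0}. (\<lambda>w. exponent_point \<nu> + w) ` nonneg_orthant)"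

definition support_value :: "real ^ 'n::finite \<Rightarrow> (real ^ 'n) set \<Rightarrow> real" where
  "support_value u G = Inf {u \<bullet> v | v. v \<in> G}"

definition face_in_direction :: "real ^ 'n::finite \<Rightarrow> (real ^ 'n) set \<Rightarrow> (real ^ 'n) set" where
  "face_in_direction u G = {v \<in> G. u \<bullet> v = support_value u G}"

definition compact_faces :: "(nat ^ 'n::finite \<Rightarrow> complex) \<Rightarrow> (real ^ 'n) set set" where
  "compact_faces a =
     {S. (\<exists>u\<in>nonneg_orthant - {0}. S = face_in_direction u (newton_diagram a)) \<and> compact S}"

definition compact_faces_dim ::
    "int \<Rightarrow> (nat ^ 'n::finite \<Rightarrow> complex) \<Rightarrow> (real ^ 'n) set set" where
  "compact_faces_dim k a = {S \<in> compact_faces a. aff_dim S = k}"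

text \<open>The index set of this sum is finite when \<open>S\<close> is compact.\<close>
definition face_part ::
    "(nat ^ 'n::finite \<Rightarrow> complex) \<Rightarrow> (real ^ 'n) set \<Rightarrow> complex ^ 'n \<Rightarrow> complex" where
  "face_part a S z = (\<Sum>\<nu>\<in>{\<nu>. exponent_point \<nu> \<in> S}. a \<nu> * monomial z \<nu>)"

definition nondegenerate_on ::
    "(nat ^ 'n::finite \<Rightarrow> complex) \<Rightarrow> (real ^ 'n) set \<Rightarrow> bool" where
  "nondegenerate_on a S \<longleftrightarrow> \<not> (\<exists>z. (\<forall>i. z $ i \<noteq> 0) \<and> gradient (face_part a S) z = 0)"

definition kouchnirenko_nondegenerate :: "(nat ^ 'n::finite \<Rightarrow> complex) \<Rightarrow> bool" where
  "kouchnirenko_nondegenerate a \<longleftrightarrow> (\<forall>S\<in>compact_faces a. nondegenerate_on a S)"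

section \<open>Exceptional faces\<close>

definition coord_axis :: "'n::finite \<Rightarrow> (real ^ 'n) set" where
  "coord_axis i = range (\<lambda>t. t *\<^sub>R axis i 1)"

definition polytope_vertices :: "(real ^ 'n::finite) set \<Rightarrow> (real ^ 'n) set" where
  "polytope_vertices S = {v. v extreme_point_of S}"

text \<open>The coordinate hyperplanes containing the \<open>i\<close>-th axis are \<open>v $ j = 0\<close> with \<open>j \<noteq> i\<close>.\<close>
definition exceptional_wrt ::
    "(nat ^ 'n::finite \<Rightarrow> complex) \<Rightarrow> 'n \<Rightarrow> (real ^ 'n) set \<Rightarrow> bool" where
  "exceptional_wrt a i S \<longleftrightarrow>
     S \<in> compact_faces_dim (int CARD('n) - 1) a \<and>
     (\<exists>w\<in>polytope_vertices S. infdist w (coord_axis i) = 1 \<and>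
        (\<exists>T\<in>compact_faces_dim (int CARD('n) - 2) a.
           polytope_vertices S - {w} = polytope_vertices T \<and>
           (\<exists>j. j \<noteq> i \<and> T \<subseteq> {v. v $ j = 0})))"

definition exceptional_faces :: "(nat ^ 'n::finite \<Rightarrow> complex) \<Rightarrow> (real ^ 'n) set set" where
  "exceptional_faces a = {S. \<exists>i. exceptional_wrt a i S}"

text \<open>
  The intersection point is unique when \<open>S\<close> is a compact face of dimension \<open>n - 1\<close>:
  then all entries of the normal vector \<open>u\<close> of \<open>S\<close> are positive.
\<close>
definition axis_intercept :: "'n::finite \<Rightarrow> (real ^ 'n) set \<Rightarrow> real" where
  "axis_intercept i S = (THE t. t *\<^sub>R axis i 1 \<in> affine hull S)"

definition max_intercept :: "(real ^ 'n::finite) set \<Rightarrow> real" where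
  "max_intercept S = Max (range (\<lambda>i. axis_intercept i S))"

section \<open>The segments $I_j^k$\<close>

text \<open>
  The segment joins the point with \<open>j\<close>-th coordinate 0 and the other two coordinates 1
  to the point \<open>k\<close> on the \<open>j\<close>-th axis.  The type \<open>3\<close> has exactly the elements 1, 2, 3.
\<close>
definition special_segment :: "3 \<Rightarrow> nat \<Rightarrow> (real ^ 3) set" where
  "special_segment j k =
     closed_segment (\<chi> i. if i = j then 0 else 1) (real k *\<^sub>R axis j 1)"

definition special_segments :: "(real ^ 3) set set" where
  "special_segments = {special_segment j k | j k. 2 \<le> k}"

text \<open>\<open>special_segment\<close> is injective on pairs with \<open>2 \<le> k\<close>, so \<open>k\<close> is determined by the segment.\<close>
definition segment_height :: "(real ^ 3) set \<Rightarrow> nat" where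
  "segment_height I = (THE k. 2 \<le> k \<and> (\<exists>j. I = special_segment j k))"

end

theory Submission
  imports Defs "HOL-Analysis.Analysis" "HOL-Complex_Analysis.Conformal_Mappings"
begin

text \<open>
  Let \<open>\<alpha>\<close> be an exponent that is not admissible. Points violating the bound can be chosen in the
  torus; writing \<open>\<bar>z\<^sub>i\<bar> = exp (- U\<^sub>i)\<close> and splitting off the bounded part of the sequence of vectors
  \<open>U\<close> gives a positive weight vector \<open>u\<close> and a point of the torus such that, for every \<open>j\<close>, the
  leading part of the \<open>j\<close>-th derivative of \<open>f\<close> has weight above \<open>\<alpha> min u\<close> or vanishes at this
  point. By nondegeneracy every exponent has weight above \<open>(\<alpha> + 1) min u\<close>, and a
  monomial that is the only one of least weight in the \<open>j\<close>-th derivative has weight above \<open>\<alpha> min u\<close>.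
  For \<open>\<alpha> = m - 1\<close> with \<open>m\<close> as in the theorem this is contradicted by a monomial of \<open>f\<close> of the form
  \<open>z\<^sub>i\<^sup>q z\<^sub>j\<close> with \<open>q \<le> m - 1\<close>. Were there no such monomial, then supporting planes rotated about
  suitable vertices would meet faces that all have to be exceptional, and these cannot be fitted together.

  Conversely, if \<open>I\<^sub>i\<^sup>k\<close> is an edge, then Brouwer's theorem yields arbitrarily small points \<open>z\<close> with
  \<open>z\<^sub>i = t\<close> at which the other two derivatives vanish, and there the gradient is \<open>O(t\<^bsup>k-1\<^esup>)\<close>.
\<close>

section \<open>Supports in a weight chart\<close>

text \<open>Nondegeneracy controls only the whole initial form: at the limiting torus point some
  partial derivative of it is nonzero, but which one is unknown. For a prescribed derivative,
  nonvanishing is certain only if its leading part is a single monomial; hence the notion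
  \<open>dominates\<close>. If \<open>u $ i\<close> is least, the natural candidate is
  \<open>z_i^q z_j\<close>, whose \<open>j\<close>-th derivative has weight
  \<open>q * u $ i\<close>.

  The obstacle: \<open>u\<close> need not be normal to a two-dimensional face, while the hypotheses
  speak only of such faces. So the plane is rotated about a vertex or an edge until it meets one.
  The number \<open>m\<close> enters through values: a value above
  \<open>m * min 1 (min s t)\<close> means that the largest intercept exceeds \<open>m\<close>. For
  \<open>m = 0\<close> every face qualifies, so both parts of the theorem share the argument. In
  part (2) the absence of edges \<open>I_j^k\<close> is derived: such an edge makes all faces
  exceptional.

  The final conflict: the two orientations give two exceptional faces with a common edge from
  \<open>(q, 1, 0)\<close> to \<open>(r, 0, 1)\<close>. This edge fixes \<open>s - t\<close>, yet
  convexity demands \<open>s < s'\<close> and \<open>t' < t\<close>.\<close>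

lemma first_zero:
  fixes C :: "(real \<times> real) set"
  assumes fin: "finite C" and nonneg: "\<And>g r. (g, r) \<in> C \<Longrightarrow> 0 \<le> g"
    and neg: "(g0, r0) \<in> C" "r0 < 0"
  obtains \<tau> where "0 \<le> \<tau>" "\<And>g r. (g, r) \<in> C \<Longrightarrow> 0 \<le> g + \<tau> * r"
    "\<exists>(g, r)\<in>C. r < 0 \<and> g + \<tau> * r = 0"
proof -
  define N where "N = (\<lambda>(g, r). g / (- r)) ` {x \<in> C. snd x < 0}"
  have finN: "finite N" and neN: "N \<noteq> {}"
    using fin neg by (auto simp: N_def)
  have "Min N \<in> N"
    using finN neN by simp
  then obtain g r where gr: "(g, r) \<in> C" "r < 0" "Min N = g / (- r)"
    by (auto simp: N_def)
  show ?thesis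
  proof
    show "0 \<le> Min N"
      using gr nonneg[of g r] by (simp add: divide_nonneg_neg)
    show "0 \<le> g' + Min N * r'" if "(g', r') \<in> C" for g' r'
    proof (cases "r' < 0")
      case True
      then have "g' / (- r') \<in> N"
        using that by (force simp: N_def)
      then have "Min N \<le> g' / (- r')"
        using finN by simp
      then show ?thesis
        using True by (simp add: field_simps)
    next
      case False
      then show ?thesis
        using nonneg[OF that] \<open>0 \<le> Min N\<close> by simp
    qed
    show "\<exists>(g, r)\<in>C. r < 0 \<and> g + Min N * r = 0"
      using gr by (intro bexI[of _ "(g, r)"]) auto
  qed
qed

text \<open>Supplies the step length in \<open>nudge\<close>; finiteness of \<open>C\<close> turns
  the separate right neighbourhoods of 0 into a common one.\<close>

lemma small_step:
  fixes C :: "(real \<times> real) set"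
  assumes "finite C" "\<And>g r. (g, r) \<in> C \<Longrightarrow> 0 < g"
  obtains \<epsilon> where "0 < \<epsilon>" "\<And>g r. (g, r) \<in> C \<Longrightarrow> 0 < g + \<epsilon> * r"
proof -
  have "\<forall>\<^sub>F \<epsilon> in at_right 0. \<forall>x\<in>C. 0 < fst x + \<epsilon> * snd x"
  proof (rule eventually_ball_finite[OF assms(1)], rule ballI)
    fix x assume "x \<in> C"
    then have "0 < fst x"
      using assms(2)[of "fst x" "snd x"] by simp
    moreover have "((\<lambda>\<epsilon>. fst x + \<epsilon> * snd x) \<longlongrightarrow> fst x + 0 * snd x) (at_right 0)"
      by (intro tendsto_intros)
    ultimately show "\<forall>\<^sub>F \<epsilon> in at_right 0. 0 < fst x + \<epsilon> * snd x"
      by (simp add: order_tendstoD(1))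
  qed
  moreover have "\<forall>\<^sub>F \<epsilon> in at_right (0::real). 0 < \<epsilon>"
    by (simp add: eventually_at_right_less)
  ultimately have "\<forall>\<^sub>F \<epsilon> in at_right (0::real). 0 < \<epsilon> \<and> (\<forall>x\<in>C. 0 < fst x + \<epsilon> * snd x)"
    by eventually_elim auto
  then obtain \<epsilon> where \<epsilon>: "0 < \<epsilon>" "\<forall>x\<in>C. 0 < fst x + \<epsilon> * snd x"
    using eventually_happens'[OF trivial_limit_at_right_real[of 0]] by blast
  show ?thesis
    by (rule that[OF \<epsilon>(1)]) (use \<epsilon>(2) in auto)
qed

text \<open>
  Exponents \<open>(a, b, c)\<close> are weighted by \<open>(1, s, t)\<close>: up to scaling and a permutation of the coordinates,
  every positive weight vector has this form.
\<close>
definition val :: "nat \<Rightarrow> nat \<Rightarrow> nat \<Rightarrow> real \<Rightarrow> real \<Rightarrow> real" where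
  "val a b c s t = real a + real b * s + real c * t"

text \<open>The tight exponents are those of the support on the face with normal
  \<open>(1, s, t)\<close>. A predicate of three numbers is used in place of a set of vectors so
  that coordinates can be permuted by renaming arguments.\<close>

definition tight :: "(nat \<Rightarrow> nat \<Rightarrow> nat \<Rightarrow> bool) \<Rightarrow> nat \<Rightarrow> nat \<Rightarrow> nat \<Rightarrow> real \<Rightarrow> real \<Rightarrow> bool" where
  "tight A a b c s t \<longleftrightarrow>
     A a b c \<and> (\<forall>a' b' c'. A a' b' c' \<longrightarrow> val a b c s t \<le> val a' b' c' s t)"

text \<open>The tight exponents span a plane, that is, \<open>(1, s, t)\<close> is normal to a two-dimensional face.\<close>
definition spans :: "(nat \<Rightarrow> nat \<Rightarrow> nat \<Rightarrow> bool) \<Rightarrow> real \<Rightarrow> real \<Rightarrow> bool" where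
  "spans A s t \<longleftrightarrow> (\<exists>a1 b1 c1 a2 b2 c2 a3 b3 c3.
     tight A a1 b1 c1 s t \<and> tight A a2 b2 c2 s t \<and> tight A a3 b3 c3 s t \<and>
     (real b2 - real b1) * (real c3 - real c1) \<noteq> (real b3 - real b1) * (real c2 - real c1))"

text \<open>A face seen as a pyramid: \<open>(a, b, c)\<close> is the apex, and \<open>P\<close>
  will be a coordinate plane containing the base.\<close>

definition lone :: "(nat \<Rightarrow> nat \<Rightarrow> nat \<Rightarrow> bool) \<Rightarrow> real \<Rightarrow> real \<Rightarrow> nat \<Rightarrow> nat \<Rightarrow> nat \<Rightarrow>
    (nat \<Rightarrow> nat \<Rightarrow> nat \<Rightarrow> bool) \<Rightarrow> bool" where
  "lone A s t a b c P \<longleftrightarrow> tight A a b c s t \<and>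
     (\<forall>a' b' c'. tight A a' b' c' s t \<longrightarrow> a' = a \<and> b' = b \<and> c' = c \<or> P a' b' c')"

text \<open>
  Exceptional faces: the lone exponent has distance 1 from a coordinate axis, and the coordinate plane
  containing all the others (one line for each plane) contains that axis.
\<close>
definition exc :: "(nat \<Rightarrow> nat \<Rightarrow> nat \<Rightarrow> bool) \<Rightarrow> real \<Rightarrow> real \<Rightarrow> bool" where
  "exc A s t \<longleftrightarrow> (\<exists>p. lone A s t p 1 0 (\<lambda>a b c. b = 0) \<or> lone A s t 0 1 p (\<lambda>a b c. b = 0) \<or>
     lone A s t p 0 1 (\<lambda>a b c. c = 0) \<or> lone A s t 0 p 1 (\<lambda>a b c. c = 0) \<or>
     lone A s t 1 p 0 (\<lambda>a b c. a = 0) \<or> lone A s t 1 0 p (\<lambda>a b c. a = 0))"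

lemma tightD: "tight A a b c s t \<Longrightarrow> A a' b' c' \<Longrightarrow> val a b c s t \<le> val a' b' c' s t"
  by (simp add: tight_def)

lemma tight_A: "tight A a b c s t \<Longrightarrow> A a b c"
  by (simp add: tight_def)

lemma tight_eq: "tight A a b c s t \<Longrightarrow> tight A a' b' c' s t \<Longrightarrow> val a b c s t = val a' b' c' s t"
  by (simp add: order.antisym tight_A tightD)

lemma tight_transfer:
  "tight A a b c s t \<Longrightarrow> A a' b' c' \<Longrightarrow> val a' b' c' s t \<le> val a b c s t \<Longrightarrow> tight A a' b' c' s t"
  unfolding tight_def using order.trans by blast

lemma val_move: "val a b c (s + \<tau> * d) (t + \<tau> * e) = val a b c s t + \<tau> * (real b * d + real c * e)"
  by (simp add: val_def algebra_simps)

lemma val_mono: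
  "a' \<le> a \<Longrightarrow> b' \<le> b \<Longrightarrow> c' \<le> c \<Longrightarrow> 0 \<le> s \<Longrightarrow> 0 \<le> t \<Longrightarrow> val a' b' c' s t \<le> val a b c s t"
  unfolding val_def by (intro add_mono mult_right_mono) auto

text \<open>With positive weights a proper divisor is strictly lighter. Hence every tight exponent
  belongs to any finite cover of the support.\<close>

lemma val_mono_eq:
  assumes "a' \<le> a" "b' \<le> b" "c' \<le> c" "0 < s" "0 < t" "val a b c s t \<le> val a' b' c' s t"
  shows "a' = a \<and> b' = b \<and> c' = c"
proof -
  have 1: "real a' \<le> real a" "real b' * s \<le> real b * s" "real c' * t \<le> real c * t"
    using assms by (auto intro!: mult_right_mono)
  then have "real a' = real a" "real b' * s = real b * s" "real c' * t = real c * t"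
    using assms(6) unfolding val_def by linarith+
  then show ?thesis
    using assms by simp
qed

text \<open>The normal cone of a vertex is convex: the defining inequalities at the two ends are
  averaged.\<close>

lemma tight_convex:
  assumes "tight A a b c s t" "tight A a b c s' t'" "0 \<le> x" "x \<le> 1"
  shows "tight A a b c (s + x * (s' - s)) (t + x * (t' - t))"
proof -
  have eq: "val a b c (s + x * (s' - s)) (t + x * (t' - t)) = (1 - x) * val a b c s t + x * val a b c s' t'" for a b c
    by (simp add: val_def algebra_simps)
  show ?thesis
    unfolding tight_def eq
  proof (intro conjI allI impI)
    fix a' b' c' assume "A a' b' c'"
    then have "val a b c s t \<le> val a' b' c' s t" "val a b c s' t' \<le> val a' b' c' s' t'"
      using assms(1,2) by (auto dest: tightD)
    then show "(1 - x) * val a b c s t + x * val a b c s' t' \<le> (1 - x) * val a' b' c' s t + x * val a' b' c' s' t'"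
      using assms(3,4) by (intro add_mono mult_left_mono) auto
  qed (rule tight_A[OF assms(1)])
qed

text \<open>What an isolated singularity imposes on its exponents, seen in a chart. The covers come
  from Dickson's lemma; their last clause makes minimisation over the monomials divisible by the
  second (third) variable a finite problem too. Failure of an \<open>axis\<close> condition would
  make the gradient vanish on a coordinate axis, failure of a \<open>plane\<close> condition would
  make the function divisible by a variable.\<close>

locale support3 =
  fixes A :: "nat \<Rightarrow> nat \<Rightarrow> nat \<Rightarrow> bool"
  assumes cover2: "\<exists>M. finite M \<and> (\<forall>(a, b, c)\<in>M. A a b c) \<and>
      (\<forall>a b c. A a b c \<longrightarrow> (\<exists>(a', b', c')\<in>M. a' \<le> a \<and> b' \<le> b \<and> c' \<le> c \<and> (1 \<le> b \<longrightarrow> 1 \<le> b')))"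
    and cover3: "\<exists>M. finite M \<and> (\<forall>(a, b, c)\<in>M. A a b c) \<and>
      (\<forall>a b c. A a b c \<longrightarrow> (\<exists>(a', b', c')\<in>M. a' \<le> a \<and> b' \<le> b \<and> c' \<le> c \<and> (1 \<le> c \<longrightarrow> 1 \<le> c')))"
    and deg: "A a b c \<Longrightarrow> 2 \<le> a + b + c"
    and axis1: "\<exists>p. A p 0 0 \<or> A p 1 0 \<or> A p 0 1"
    and axis2: "\<exists>p. A 0 p 0 \<or> A 1 p 0 \<or> A 0 p 1"
    and axis3: "\<exists>p. A 0 0 p \<or> A 1 0 p \<or> A 0 1 p"
    and plane2: "\<exists>a c. A a 0 c"
    and plane3: "\<exists>a b. A a b 0"
begin

lemma cover_second:
  obtains M where "finite M" "\<And>a b c. (a, b, c) \<in> M \<Longrightarrow> A a b c"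
    "\<And>a b c. A a b c \<Longrightarrow> \<exists>a' b' c'. (a', b', c') \<in> M \<and> a' \<le> a \<and> b' \<le> b \<and> c' \<le> c \<and> (1 \<le> b \<longrightarrow> 1 \<le> b')"
proof -
  obtain M where M: "finite M" "\<forall>(a, b, c)\<in>M. A a b c"
    "\<forall>a b c. A a b c \<longrightarrow> (\<exists>(a', b', c')\<in>M. a' \<le> a \<and> b' \<le> b \<and> c' \<le> c \<and> (1 \<le> b \<longrightarrow> 1 \<le> b'))"
    using cover2 by blast
  show ?thesis
  proof (rule that[OF M(1)])
    fix a b c
    show "(a, b, c) \<in> M \<Longrightarrow> A a b c"
      using M(2) by auto
    assume "A a b c"
    from M(3)[rule_format, OF this] show "\<exists>a' b' c'. (a', b', c') \<in> M \<and> a' \<le> a \<and> b' \<le> b \<and> c' \<le> c \<and> (1 \<le> b \<longrightarrow> 1 \<le> b')"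
      by auto
  qed
qed

lemma cover:
  obtains M where "finite M" "\<And>a b c. (a, b, c) \<in> M \<Longrightarrow> A a b c"
    "\<And>a b c. A a b c \<Longrightarrow> \<exists>a' b' c'. (a', b', c') \<in> M \<and> a' \<le> a \<and> b' \<le> b \<and> c' \<le> c"
proof -
  obtain M where M: "finite M" "\<And>a b c. (a, b, c) \<in> M \<Longrightarrow> A a b c"
    "\<And>a b c. A a b c \<Longrightarrow> \<exists>a' b' c'. (a', b', c') \<in> M \<and> a' \<le> a \<and> b' \<le> b \<and> c' \<le> c \<and> (1 \<le> b \<longrightarrow> 1 \<le> b')"
    by (rule cover_second) (rule that)
  show ?thesis
  proof (rule that[OF M(1,2)])
    fix a b c assume "A a b c"
    from M(3)[OF this] show "\<exists>a' b' c'. (a', b', c') \<in> M \<and> a' \<le> a \<and> b' \<le> b \<and> c' \<le> c"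
      by blast
  qed
qed

text \<open>When the weights move by \<open>\<tau> * (d, e)\<close>, the gap between
  \<open>(a', b', c')\<close> and \<open>(a, b, c)\<close> changes at the rate
  \<open>(b' - b) * d + (c' - c) * e\<close>. The first quantity to reach zero is either such a gap
  (\<open>tie\<close>, possibly already at \<open>\<tau> = 0\<close>) or a weight
  (\<open>edge\<close>). The hypothesis \<open>neg\<close> ensures that something does reach
  zero.\<close>

lemma slide:
  assumes w: "tight A a b c s t" and pos: "0 < s" "0 < t"
    and neg: "d < 0 \<or> e < 0 \<or> (\<exists>a' b' c'. A a' b' c' \<and> (real b' - real b) * d + (real c' - real c) * e < 0)"
  obtains (tie) \<tau> a' b' c' where "0 \<le> \<tau>" "0 < s + \<tau> * d" "0 < t + \<tau> * e"
      "tight A a b c (s + \<tau> * d) (t + \<tau> * e)" "tight A a' b' c' (s + \<tau> * d) (t + \<tau> * e)"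
      "(real b' - real b) * d + (real c' - real c) * e < 0"
    | (edge) \<tau> where "0 < \<tau>" "0 \<le> s + \<tau> * d" "0 \<le> t + \<tau> * e" "s + \<tau> * d = 0 \<or> t + \<tau> * e = 0"
      "tight A a b c (s + \<tau> * d) (t + \<tau> * e)"
proof -
  obtain M where finM: "finite M" and MA: "\<And>a b c. (a, b, c) \<in> M \<Longrightarrow> A a b c"
    and cov: "\<And>a b c. A a b c \<Longrightarrow> \<exists>a' b' c'. (a', b', c') \<in> M \<and> a' \<le> a \<and> b' \<le> b \<and> c' \<le> c"
    by (rule cover) (rule that)
  define F where "F = (\<lambda>(a', b', c'). (val a' b' c' s t - val a b c s t,
      (real b' - real b) * d + (real c' - real c) * e))"
  \<comment> \<open>The two weights are treated as further gaps, with rates \<open>d\<close> and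
    \<open>e\<close>, so that leaving the positive quadrant is detected by the same minimum.\<close>
  define C where "C = F ` M \<union> {(s, d), (t, e)}"
  have finC: "finite C"
    using finM by (simp add: C_def)
  have inC: "(val a' b' c' s t - val a b c s t, (real b' - real b) * d + (real c' - real c) * e) \<in> C"
    if "(a', b', c') \<in> M" for a' b' c'
    using imageI[OF that, of F] by (simp add: C_def F_def)
  have nonneg: "0 \<le> g" if "(g, r) \<in> C" for g r
    using that pos tightD[OF w MA] by (auto simp: C_def F_def)
  have "\<exists>g r. (g, r) \<in> C \<and> r < 0"
  proof (cases "d < 0 \<or> e < 0")
    case True
    then show ?thesis
      by (auto simp: C_def)
  next
    case False
    then obtain a' b' c' where k: "A a' b' c'" "(real b' - real b) * d + (real c' - real c) * e < 0"
      using neg by auto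
    obtain a2 b2 c2 where k2: "(a2, b2, c2) \<in> M" "b2 \<le> b'" "c2 \<le> c'"
      using cov[OF k(1)] by auto
    \<comment> \<open>Here \<open>d\<close> and \<open>e\<close> are nonnegative, so the smaller
      exponent from the cover has at most the rate of the given one.\<close>
    have "(real b2 - real b) * d \<le> (real b' - real b) * d" "(real c2 - real c) * e \<le> (real c' - real c) * e"
      using False k2 by (auto intro!: mult_right_mono)
    then have "(real b2 - real b) * d + (real c2 - real c) * e < 0"
      using k(2) by linarith
    then show ?thesis
      using inC[OF k2(1)] by blast
  qed
  then obtain g0 r0 where gr0: "(g0, r0) \<in> C" "r0 < 0"
    by blast
  obtain \<tau> where \<tau>: "0 \<le> \<tau>" "\<And>g r. (g, r) \<in> C \<Longrightarrow> 0 \<le> g + \<tau> * r"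
    "\<exists>(g, r)\<in>C. r < 0 \<and> g + \<tau> * r = 0"
    by (rule first_zero[OF finC nonneg gr0]) blast+
  have st: "0 \<le> s + \<tau> * d" "0 \<le> t + \<tau> * e"
    using \<tau>(2) by (auto simp: C_def)
  have gap: "val a' b' c' s t - val a b c s t + \<tau> * ((real b' - real b) * d + (real c' - real c) * e) =
      val a' b' c' (s + \<tau> * d) (t + \<tau> * e) - val a b c (s + \<tau> * d) (t + \<tau> * e)" for a' b' c'
    unfolding val_move by (simp add: algebra_simps)
  have "val a b c (s + \<tau> * d) (t + \<tau> * e) \<le> val a' b' c' (s + \<tau> * d) (t + \<tau> * e)" if "A a' b' c'" for a' b' c'
  proof -
    obtain a2 b2 c2 where k2: "(a2, b2, c2) \<in> M" "a2 \<le> a'" "b2 \<le> b'" "c2 \<le> c'"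
      using cov[OF \<open>A a' b' c'\<close>] by auto
    have "val a b c (s + \<tau> * d) (t + \<tau> * e) \<le> val a2 b2 c2 (s + \<tau> * d) (t + \<tau> * e)"
      using \<tau>(2)[OF inC[OF k2(1)]] gap[of a2 b2 c2] by simp
    also have "\<dots> \<le> val a' b' c' (s + \<tau> * d) (t + \<tau> * e)"
      by (rule val_mono) (use k2 st in auto)
    finally show ?thesis .
  qed
  then have tw: "tight A a b c (s + \<tau> * d) (t + \<tau> * e)"
    using tight_A[OF w] by (simp add: tight_def)
  show ?thesis
  proof (cases "s + \<tau> * d = 0 \<or> t + \<tau> * e = 0")
    case True
    have "\<tau> \<noteq> 0"
      using True pos by (intro notI) simp
    then show ?thesis
      by (intro edge[OF _ st True tw]) (use \<tau>(1) in linarith)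
  next
    case False
    then obtain a' b' c' where k: "(a', b', c') \<in> M" "(real b' - real b) * d + (real c' - real c) * e < 0"
      "val a' b' c' s t - val a b c s t + \<tau> * ((real b' - real b) * d + (real c' - real c) * e) = 0"
      using \<tau>(3) by (auto simp: C_def F_def)
    have "tight A a' b' c' (s + \<tau> * d) (t + \<tau> * e)"
      by (rule tight_transfer[OF tw MA[OF k(1)]]) (use k(3) gap[of a' b' c'] in linarith)
    moreover have "0 < s + \<tau> * d" "0 < t + \<tau> * e"
      using False st by linarith+
    ultimately show ?thesis
      by (intro tie[OF \<tau>(1) _ _ tw _ k(2)])
  qed
qed

text \<open>An infinitesimal rotation: the face shrinks to the subface on which the functional with
  coefficients \<open>d\<close>, \<open>e\<close> is least. Gaps that were positive survive a small
  step, and tight exponents with positive rate become strictly heavier.\<close>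

lemma nudge:
  assumes w: "tight A a b c s t" and pos: "0 < s" "0 < t"
    and ge: "\<And>a' b' c'. tight A a' b' c' s t \<Longrightarrow> 0 \<le> (real b' - real b) * d + (real c' - real c) * e"
  obtains s' t' where "0 < s'" "0 < t'"
    "\<And>a' b' c'. tight A a' b' c' s' t' \<longleftrightarrow>
       tight A a' b' c' s t \<and> (real b' - real b) * d + (real c' - real c) * e = 0"
proof -
  obtain M where finM: "finite M" and MA: "\<And>a b c. (a, b, c) \<in> M \<Longrightarrow> A a b c"
    and cov: "\<And>a b c. A a b c \<Longrightarrow> \<exists>a' b' c'. (a', b', c') \<in> M \<and> a' \<le> a \<and> b' \<le> b \<and> c' \<le> c"
    by (rule cover) (rule that)
  define F where "F = (\<lambda>(a', b', c'). (val a' b' c' s t - val a b c s t,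
      (real b' - real b) * d + (real c' - real c) * e))"
  define C where "C = F ` {(a', b', c') \<in> M. \<not> tight A a' b' c' s t} \<union> {(s, d), (t, e)}"
  have finC: "finite C"
    using finM by (auto simp: C_def intro: finite_subset[of _ M])
  have gpos: "0 < g" if "(g, r) \<in> C" for g r
  proof -
    have "0 < val a' b' c' s t - val a b c s t" if "(a', b', c') \<in> M" "\<not> tight A a' b' c' s t" for a' b' c'
      using that tight_transfer[OF w MA[OF that(1)]] by force
    then show ?thesis
      using that pos by (auto simp: C_def F_def)
  qed
  obtain \<epsilon> where \<epsilon>: "0 < \<epsilon>" "\<And>g r. (g, r) \<in> C \<Longrightarrow> 0 < g + \<epsilon> * r"
    by (rule small_step[OF finC gpos]) (assumption, rule that)
  have st: "0 < s + \<epsilon> * d" "0 < t + \<epsilon> * e"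
    using \<epsilon>(2) by (auto simp: C_def)
  have gap: "val a' b' c' s t - val a b c s t + \<epsilon> * ((real b' - real b) * d + (real c' - real c) * e) =
      val a' b' c' (s + \<epsilon> * d) (t + \<epsilon> * e) - val a b c (s + \<epsilon> * d) (t + \<epsilon> * e)" for a' b' c'
    unfolding val_move by (simp add: algebra_simps)
  have strict: "val a b c (s + \<epsilon> * d) (t + \<epsilon> * e) < val a' b' c' (s + \<epsilon> * d) (t + \<epsilon> * e)"
    if "(a', b', c') \<in> M" "\<not> tight A a' b' c' s t" for a' b' c'
  proof -
    have "(val a' b' c' s t - val a b c s t, (real b' - real b) * d + (real c' - real c) * e) \<in> C"
      using imageI[of "(a', b', c')" "{(a', b', c') \<in> M. \<not> tight A a' b' c' s t}" F] that
      by (simp add: C_def F_def)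
    then show ?thesis
      using \<epsilon>(2)[of "val a' b' c' s t - val a b c s t" "(real b' - real b) * d + (real c' - real c) * e"]
        gap[of a' b' c'] unfolding F_def by simp
  qed
  have loose: "val a b c (s + \<epsilon> * d) (t + \<epsilon> * e) \<le> val a' b' c' (s + \<epsilon> * d) (t + \<epsilon> * e)"
    if "tight A a' b' c' s t" for a' b' c'
  proof -
    have "0 \<le> \<epsilon> * ((real b' - real b) * d + (real c' - real c) * e)"
      using \<epsilon>(1) ge[OF that] by simp
    then show ?thesis
      using gap[of a' b' c'] tight_eq[OF that w] by linarith
  qed
  have tw: "tight A a b c (s + \<epsilon> * d) (t + \<epsilon> * e)"
    unfolding tight_def
  proof (intro conjI allI impI)
    fix a' b' c' assume "A a' b' c'"
    then obtain a2 b2 c2 where k2: "(a2, b2, c2) \<in> M" "a2 \<le> a'" "b2 \<le> b'" "c2 \<le> c'"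
      using cov by blast
    have "val a b c (s + \<epsilon> * d) (t + \<epsilon> * e) \<le> val a2 b2 c2 (s + \<epsilon> * d) (t + \<epsilon> * e)"
      using strict[OF k2(1)] loose by fastforce
    also have "\<dots> \<le> val a' b' c' (s + \<epsilon> * d) (t + \<epsilon> * e)"
      by (rule val_mono) (use k2 st in auto)
    finally show "val a b c (s + \<epsilon> * d) (t + \<epsilon> * e) \<le> val a' b' c' (s + \<epsilon> * d) (t + \<epsilon> * e)" .
  qed (use tight_A[OF w] in auto)
  show ?thesis
  proof (rule that[OF st], rule iffI)
    fix a' b' c' assume k: "tight A a' b' c' (s + \<epsilon> * d) (t + \<epsilon> * e)"
    obtain a2 b2 c2 where k2: "(a2, b2, c2) \<in> M" "a2 \<le> a'" "b2 \<le> b'" "c2 \<le> c'"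
      using cov[OF tight_A[OF k]] by blast
    have "a2 = a' \<and> b2 = b' \<and> c2 = c'"
      by (rule val_mono_eq[OF k2(2-4) st]) (rule tightD[OF k MA[OF k2(1)]])
    then have "(a', b', c') \<in> M"
      using k2(1) by simp
    then have *: "tight A a' b' c' s t"
      using strict tight_eq[OF k tw] by fastforce
    then show "tight A a' b' c' s t \<and> (real b' - real b) * d + (real c' - real c) * e = 0"
      using gap[of a' b' c'] tight_eq[OF * w] tight_eq[OF k tw] \<epsilon>(1) by auto
  next
    fix a' b' c' assume k: "tight A a' b' c' s t \<and> (real b' - real b) * d + (real c' - real c) * e = 0"
    have "val a' b' c' s t = val a b c s t"
      using tight_eq[OF conjunct1[OF k] w] .
    then have "val a' b' c' (s + \<epsilon> * d) (t + \<epsilon> * e) \<le> val a b c (s + \<epsilon> * d) (t + \<epsilon> * e)"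
      using gap[of a' b' c'] k by simp
    then show "tight A a' b' c' (s + \<epsilon> * d) (t + \<epsilon> * e)"
      using tight_transfer[OF tw tight_A[OF conjunct1[OF k]]] by blast
  qed
qed

end

section \<open>The symmetry exchanging the last two coordinates, and the six types of exceptional
  faces\<close>

definition flip :: "(nat \<Rightarrow> nat \<Rightarrow> nat \<Rightarrow> bool) \<Rightarrow> nat \<Rightarrow> nat \<Rightarrow> nat \<Rightarrow> bool" where
  "flip A a b c = A a c b"

lemma flip_flip [simp]: "flip (flip A) = A"
  by (simp add: flip_def fun_eq_iff)

lemma tight_swap: "tight (flip A) a b c s t \<longleftrightarrow> tight A a c b t s"
  unfolding tight_def val_def flip_def by (auto simp: algebra_simps)

lemma spansI:
  assumes "tight A a1 b1 c1 s t" "tight A a2 b2 c2 s t" "tight A a3 b3 c3 s t"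
     "(real b2 - real b1) * (real c3 - real c1) \<noteq> (real b3 - real b1) * (real c2 - real c1)"
  shows "spans A s t"
  using assms unfolding spans_def by blast

lemma spansE:
  assumes "spans A s t"
  obtains a1 b1 c1 a2 b2 c2 a3 b3 c3 where
    "tight A a1 b1 c1 s t" "tight A a2 b2 c2 s t" "tight A a3 b3 c3 s t"
    "(real b2 - real b1) * (real c3 - real c1) \<noteq> (real b3 - real b1) * (real c2 - real c1)"
  using assms unfolding spans_def by (elim exE conjE) (rule that)

lemma spans_swap: "spans (flip A) s t \<longleftrightarrow> spans A t s"
proof -
  have "spans (flip A) s t" if sp: "spans A t s" for A s t
  proof -
    from sp show ?thesis
    proof (rule spansE)
      fix a1 b1 c1 a2 b2 c2 a3 b3 c3
      assume h: "tight A a1 b1 c1 t s" "tight A a2 b2 c2 t s" "tight A a3 b3 c3 t s"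
        and det: "(real b2 - real b1) * (real c3 - real c1) \<noteq> (real b3 - real b1) * (real c2 - real c1)"
      show "spans (flip A) s t"
      proof (rule spansI)
        show "tight (flip A) a1 c1 b1 s t" "tight (flip A) a2 c2 b2 s t"
          "tight (flip A) a3 c3 b3 s t"
          using h by (simp_all only: tight_swap)
        show "(real c2 - real c1) * (real b3 - real b1) \<noteq> (real c3 - real c1) * (real b2 - real b1)"
          using det by (simp add: mult.commute)
      qed
    qed
  qed
  from this[of A t s] this[of "flip A" s t] show ?thesis
    by auto
qed

lemma lone_swap: "lone (flip A) s t a b c P \<longleftrightarrow> lone A t s a c b (\<lambda>a b c. P a c b)"
  unfolding lone_def tight_swap by blast

lemma exc_swap: "exc (flip A) s t \<longleftrightarrow> exc A t s"
  unfolding exc_def lone_swap by (intro iff_exI) argo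

lemma support3_flip: "support3 (flip A)" if "support3 A"
proof -
  interpret support3 A by fact
  have flipM: "\<exists>M. finite M \<and> (\<forall>(a, b, c)\<in>M. flip A a b c) \<and>
      (\<forall>a b c. flip A a b c \<longrightarrow> (\<exists>(a', b', c')\<in>M. a' \<le> a \<and> b' \<le> b \<and> c' \<le> c \<and> P b c b' c'))"
    if M: "\<exists>M. finite M \<and> (\<forall>(a, b, c)\<in>M. A a b c) \<and>
      (\<forall>a b c. A a b c \<longrightarrow> (\<exists>(a', b', c')\<in>M. a' \<le> a \<and> b' \<le> b \<and> c' \<le> c \<and> P c b c' b'))" for P
  proof -
    obtain M where M: "finite M" "\<forall>(a, b, c)\<in>M. A a b c"
      "\<forall>a b c. A a b c \<longrightarrow> (\<exists>(a', b', c')\<in>M. a' \<le> a \<and> b' \<le> b \<and> c' \<le> c \<and> P c b c' b')"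
      using M by blast
    show ?thesis
    proof (intro exI[of _ "(\<lambda>(a, b, c). (a, c, b)) ` M"] conjI allI impI)
      show "finite ((\<lambda>(a, b, c). (a, c, b)) ` M)"
        using M(1) by simp
      show "\<forall>(a, b, c)\<in>(\<lambda>(a, b, c). (a, c, b)) ` M. flip A a b c"
        using M(2) by (auto simp: flip_def)
      fix a b c assume "flip A a b c"
      then have "A a c b"
        by (simp add: flip_def)
      from M(3)[rule_format, OF this] obtain a' b' c' where
        "(a', c', b') \<in> M" "a' \<le> a" "b' \<le> b" "c' \<le> c" "P b c b' c'"
        by auto
      then show "\<exists>(a', b', c')\<in>(\<lambda>(a, b, c). (a, c, b)) ` M. a' \<le> a \<and> b' \<le> b \<and> c' \<le> c \<and> P b c b' c'"
        by (intro bexI[of _ "(a', b', c')"]) (auto intro: rev_image_eqI[of "(a', c', b')"])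
    qed
  qed
  show ?thesis
  proof
    show "2 \<le> a + b + c" if "flip A a b c" for a b c
      using that deg[of a c b] by (simp add: flip_def)
  qed (use flipM[of "\<lambda>b c b' c'. 1 \<le> b \<longrightarrow> 1 \<le> b'"] flipM[of "\<lambda>b c b' c'. 1 \<le> c \<longrightarrow> 1 \<le> c'"]
        cover2 cover3 axis1 axis2 axis3 plane2 plane3 in \<open>auto simp: flip_def\<close>)
qed

definition only2 ::
  "(nat \<Rightarrow> nat \<Rightarrow> nat \<Rightarrow> bool) \<Rightarrow> real \<Rightarrow> real \<Rightarrow> nat \<Rightarrow> nat \<Rightarrow> nat \<Rightarrow> nat \<Rightarrow> nat \<Rightarrow> nat \<Rightarrow> bool" where
  "only2 A s t a b c a' b' c' \<longleftrightarrow>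
     (\<forall>x y z. tight A x y z s t \<longleftrightarrow> x = a \<and> y = b \<and> z = c \<or> x = a' \<and> y = b' \<and> z = c')"

lemma only2_flip: "only2 (flip A) s t a b c a' b' c' \<longleftrightarrow> only2 A t s a c b a' c' b'"
proof
  assume h: "only2 (flip A) s t a b c a' b' c'"
  show "only2 A t s a c b a' c' b'"
    unfolding only2_def
  proof (intro allI)
    fix x y z
    show "tight A x y z t s \<longleftrightarrow> x = a \<and> y = c \<and> z = b \<or> x = a' \<and> y = c' \<and> z = b'"
      using h[unfolded only2_def, rule_format, of x z y] by (auto simp: tight_swap)
  qed
next
  assume h: "only2 A t s a c b a' c' b'"
  show "only2 (flip A) s t a b c a' b' c'"
    unfolding only2_def tight_swap
  proof (intro allI)
    fix x y z
    show "tight A x z y t s \<longleftrightarrow> x = a \<and> y = b \<and> z = c \<or> x = a' \<and> y = b' \<and> z = c'"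
      using h[unfolded only2_def, rule_format, of x z y] by auto
  qed
qed

lemma loneD:
  "lone A s t a b c P \<Longrightarrow> tight A a' b' c' s t \<Longrightarrow> a' = a \<and> b' = b \<and> c' = c \<or> P a' b' c'"
  by (simp add: lone_def)

lemma lone_tight: "lone A s t a b c P \<Longrightarrow> tight A a b c s t"
  by (simp add: lone_def)

lemma exc_cases [consumes 1]:
  assumes "exc A s t"
  obtains p where "lone A s t p 1 0 (\<lambda>a b c. b = 0)"
    | p where "lone A s t 0 1 p (\<lambda>a b c. b = 0)"
    | p where "lone A s t p 0 1 (\<lambda>a b c. c = 0)"
    | p where "lone A s t 0 p 1 (\<lambda>a b c. c = 0)"
    | p where "lone A s t 1 p 0 (\<lambda>a b c. a = 0)"
    | p where "lone A s t 1 0 p (\<lambda>a b c. a = 0)"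
  using assms unfolding exc_def by metis

text \<open>Rotation about an edge: the direction \<open>(d, e)\<close> does not change the
  difference of the two values, so the second end stays tight as long as the first does.\<close>

lemma tight_along:
  assumes "tight A a b c s t" "tight A a' b' c' s t" "tight A a b c (s + \<tau> * d) (t + \<tau> * e)"
    and "(real b' - real b) * d + (real c' - real c) * e = 0"
  shows "tight A a' b' c' (s + \<tau> * d) (t + \<tau> * e)"
proof (rule tight_transfer[OF assms(3) tight_A[OF assms(2)]])
  have "real b' * d + real c' * e = real b * d + real c * e"
    using assms(4) by (simp add: algebra_simps)
  then show "val a' b' c' (s + \<tau> * d) (t + \<tau> * e) \<le> val a b c (s + \<tau> * d) (t + \<tau> * e)"
    using tight_eq[OF assms(1,2)] unfolding val_move by simp
qed

text \<open>
  The common hypotheses of the two indirect arguments. With \<open>m = 0\<close> all faces are exceptional and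
  \<open>vertex_exc\<close> holds without its last premise; otherwise \<open>m\<close> bounds the intercepts of the
  nonexceptional faces. The conditions \<open>no1\<close>, \<open>no2\<close>, \<open>no3\<close> say that no segment \<open>I\<^sub>j\<^sup>k\<close> is an edge.
\<close>
locale bad_support = support3 A for A +
  fixes m :: real
  assumes m_nonneg: "0 \<le> m"
    and pure: "A p 0 0 \<Longrightarrow> m < real p"
    and vertex_exc: "0 < s \<Longrightarrow> 0 < t \<Longrightarrow> spans A s t \<Longrightarrow> tight A a b c s t \<Longrightarrow>
        m * min 1 (min s t) < val a b c s t \<Longrightarrow> exc A s t"
    and no1: "0 < s \<Longrightarrow> 0 < t \<Longrightarrow> \<not> only2 A s t k 0 0 0 1 1"
    and no2: "0 < s \<Longrightarrow> 0 < t \<Longrightarrow> \<not> only2 A s t 0 k 0 1 0 1"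
    and no3: "0 < s \<Longrightarrow> 0 < t \<Longrightarrow> \<not> only2 A s t 0 0 k 1 1 0"

lemma val_flip: "val a c b t s = val a b c s t"
  by (simp add: val_def)

lemma bad_support_flip: "bad_support (flip A) m" if "bad_support A m"
proof -
  interpret bad_support A m by fact
  interpret f: support3 "flip A"
    by (rule support3_flip) (rule support3_axioms)
  show ?thesis
  proof
    show "exc (flip A) s t"
      if "0 < s" "0 < t" "spans (flip A) s t" "tight (flip A) a b c s t"
        "m * min 1 (min s t) < val a b c s t" for s t a b c
      using vertex_exc[of t s a c b] that
      by (simp add: spans_swap exc_swap tight_swap val_flip min.commute)
  qed (use m_nonneg pure no1 no2 no3 in \<open>auto simp: flip_def only2_flip\<close>)
qed

section \<open>Faces containing a pure power of the first variable\<close>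

context bad_support
begin

text \<open>The supporting plane meets the first axis at \<open>p\<close>, which exceeds
  \<open>m\<close> by \<open>pure\<close>; hence the largest intercept exceeds
  \<open>m\<close>.\<close>

lemma exc_pure:
  assumes "0 < s" "0 < t" "spans A s t" "tight A p 0 0 s t"
  shows "exc A s t"
proof (rule vertex_exc[OF assms])
  have "m * min 1 (min s t) \<le> m * 1"
    using m_nonneg by (intro mult_left_mono) auto
  then show "m * min 1 (min s t) < val p 0 0 s t"
    using pure[OF tight_A[OF assms(4)]] by (simp add: val_def)
qed

text \<open>With third weight zero, an exponent near the third axis has value 0, 1 or
  \<open>s\<close>, however large its last entry is. This excludes that a rotation runs into
  \<open>t = 0\<close>.\<close>

lemma axis3_bound:
  assumes "tight A a b c s 0" "2 \<le> a + b"  "0 \<le> s"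
  shows "real a + real b * s \<le> 1 \<or> real a + real b * s \<le> s"
proof -
  obtain n where "A 0 0 n \<or> A 1 0 n \<or> A 0 1 n"
    using axis3 by blast
  then show ?thesis
    using tightD[OF assms(1), of 0 0 n] tightD[OF assms(1), of 1 0 n] tightD[OF assms(1), of 0 1 n]
    by (auto simp: val_def)
qed

text \<open>The direction \<open>(c, - b)\<close> rotates about the segment from
  \<open>(p, 0, 0)\<close> to \<open>(a, b, c)\<close>. Any face met contains the pure power and is
  therefore exceptional; the only possible apex is \<open>(a, b, c)\<close> itself, with base in the
  plane \<open>c = 0\<close>, but exponents there do not get closer. The excluded case
  \<open>a = 0\<close>, \<open>b = 1\<close> is the one where \<open>(a, b, c)\<close> may be an
  apex over the other plane, or where \<open>t = 0\<close> can be reached.\<close>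

lemma no_pure_and_mixed_aux:
  assumes p: "tight A p 0 0 s t" and k: "tight A a b c s t" and bc: "1 \<le> b" "1 \<le> c"
    and pos: "0 < s" "0 < t" and ne: "\<not> (a = 0 \<and> b = 1)"
  shows False
proof -
  have p2: "2 \<le> p"
    using deg[OF tight_A[OF p]] by simp
  have "real c < 0 \<or> - real b < 0 \<or> (\<exists>a' b' c'. A a' b' c' \<and>
      (real b' - real 0) * real c + (real c' - real 0) * (- real b) < 0)"
    using bc by simp
  with p pos show False
  proof (rule slide)
    fix \<tau> a' b' c'
    let ?s = "s + \<tau> * real c" and ?t = "t + \<tau> * (- real b)"
    assume st: "0 \<le> \<tau>" "0 < ?s" "0 < ?t" and p': "tight A p 0 0 ?s ?t" and k': "tight A a' b' c' ?s ?t"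
      and rate: "(real b' - real 0) * real c + (real c' - real 0) * (- real b) < 0"
    have abc: "tight A a b c ?s ?t"
      by (rule tight_along[OF p k p']) simp
    have "spans A ?s ?t"
      by (rule spansI[OF p' abc k']) (use rate in \<open>simp add: algebra_simps\<close>)
    then have "exc A ?s ?t"
      by (rule exc_pure[OF st(2,3) _ p'])
    then show False
    proof (cases rule: exc_cases)
      case (4 r)
      have "a' = a \<and> b' = b \<and> c' = c \<or> c' = 0"
        using loneD[OF 4 abc] loneD[OF 4 k'] bc by auto
      then have "0 \<le> (real b' - real 0) * real c + (real c' - real 0) * (- real b)"
        by (elim disjE) (simp_all add: mult.commute)
      then show False
        using rate by simp
    qed (use loneD[OF _ abc] loneD[OF _ p'] bc ne p2 in force)+
  next
    fix \<tau>
    let ?s = "s + \<tau> * real c" and ?t = "t + \<tau> * (- real b)"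
    assume st: "0 < \<tau>" "0 \<le> ?s" "0 \<le> ?t" "?s = 0 \<or> ?t = 0" and p': "tight A p 0 0 ?s ?t"
    have spos: "0 < ?s"
      using pos st bc by (simp add: add_pos_nonneg)
    then have t0: "?t = 0"
      using st by auto
    have i1: "real p \<le> 1 \<or> real p \<le> ?s"
      using axis3_bound[of p 0 0 ?s] p' spos p2 unfolding t0 by simp
    have "tight A a b c ?s ?t"
      by (rule tight_along[OF p k p']) simp
    then have i2: "real p = real a + real b * ?s"
      using tight_eq[OF p'] unfolding t0 by (force simp: val_def)
    have i3: "1 * ?s \<le> real b * ?s"
      by (rule mult_right_mono) (use bc spos in auto)
    \<comment> \<open>As \<open>p\<close> is at least 2, only the bound by \<open>s\<close> can
      hold; since \<open>b * s\<close> is at least \<open>s\<close>, this leaves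
      \<open>a = 0\<close> and \<open>b = 1\<close>.\<close>
    have aux: "x = 0 \<and> y = 1 * z" if "r \<le> 1 \<or> r \<le> z" "r = x + y" "1 * z \<le> y" "2 \<le> r" "0 \<le> x" for r x y z :: real
      using that by linarith
    have "real a = 0 \<and> real b * ?s = 1 * ?s"
      by (rule aux[OF i1 i2 i3]) (use p2 in auto)
    then show False
      using ne spos by auto
  qed
qed

end

text \<open>The exceptions of \<open>no_pure_and_mixed_aux\<close> and of its mirror image have only
  \<open>(0, 1, 1)\<close> in common. So the face contains a segment \<open>I_1^p\<close>; if it is
  larger, exceptionality puts all remaining exponents on one side of the segment, and
  \<open>nudge\<close> isolates it, against \<open>no1\<close>.\<close>

lemma (in bad_support) no_pure_and_mixed:
  assumes p: "tight A p 0 0 s t" and k: "tight A a b c s t" and bc: "1 \<le> b" "1 \<le> c"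
    and pos: "0 < s" "0 < t"
  shows False
proof -
  interpret f: bad_support "flip A" m
    by (rule bad_support_flip) (rule bad_support_axioms)
  have all: "a = 0 \<and> b = 1 \<and> c = 1" if "tight A a b c s t" "1 \<le> b" "1 \<le> c" for a b c
  proof -
    have "a = 0 \<and> b = 1"
      by (rule ccontr) (use no_pure_and_mixed_aux[OF p that pos] in blast)
    moreover have "a = 0 \<and> c = 1"
      by (rule ccontr) (use f.no_pure_and_mixed_aux[of p t s a c b] p that pos in \<open>simp add: tight_swap\<close>)
    ultimately show ?thesis
      by simp
  qed
  have p2: "2 \<le> p"
    using deg[OF tight_A[OF p]] by simp
  have yz: "tight A 0 1 1 s t"
    using all[OF k bc] k by simp
  have peq: "a = p" if "tight A a 0 0 s t" for a
    using tight_eq[OF that p] by (simp add: val_def)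
  show False
  proof (cases "\<exists>a b c. tight A a b c s t \<and> b \<noteq> c")
    case False
    then have "x = p \<and> y = 0 \<and> z = 0 \<or> x = 0 \<and> y = 1 \<and> z = 1" if "tight A x y z s t" for x y z
      using that all[OF that] peq by (cases "y = 0") force+
    then have "only2 A s t p 0 0 0 1 1"
      using p yz unfolding only2_def by blast
    then show False
      using no1 pos by blast
  next
    case True
    then obtain a b c where k': "tight A a b c s t" "b \<noteq> c"
      by blast
    have "spans A s t"
      by (rule spansI[OF p yz k'(1)]) (use k'(2) in auto)
    then have ex: "exc A s t"
      by (rule exc_pure[OF pos _ p])
    \<comment> \<open>The functional is \<open>b - c\<close> or its negative. It vanishes exactly on
      those tight exponents that are ends of the segment.\<close>
    have fin: False if d: "d = 1 \<or> d = - (1 :: real)" and ge: "\<And>a b c. tight A a b c s t \<Longrightarrow> 0 \<le> (real b - real 0) * d + (real c - real 0) * (- d)" for d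
    proof -
      from p pos ge show False
      proof (rule nudge)
        fix s' t' :: real
        assume pos': "0 < s'" "0 < t'" and tt: "\<And>a' b' c'. tight A a' b' c' s' t' =
          (tight A a' b' c' s t \<and> (real b' - real 0) * d + (real c' - real 0) * - d = 0)"
        have "x = p \<and> y = 0 \<and> z = 0 \<or> x = 0 \<and> y = 1 \<and> z = 1" if "tight A x y z s' t'" for x y z
        proof -
          have t: "tight A x y z s t" "y = z"
            using that d unfolding tt by auto
          then show ?thesis
            using all[OF t(1)] peq by (cases "y = 0") force+
        qed
        moreover have "tight A p 0 0 s' t'" "tight A 0 1 1 s' t'"
          using p yz unfolding tt by auto
        ultimately have "only2 A s' t' p 0 0 0 1 1"
          unfolding only2_def by blast
        then show False
          using no1 pos' by blast
      qed
    qed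
    from ex show False
    proof (cases rule: exc_cases)
      case (2 r)
      have "b = c \<or> b = 0" if "tight A a b c s t" for a b c
        using loneD[OF 2 that] loneD[OF 2 yz] by auto
      then show False
        by (intro fin[of "- 1"]) force+
    next
      case (4 r)
      have "b = c \<or> c = 0" if "tight A a b c s t" for a b c
        using loneD[OF 4 that] loneD[OF 4 yz] by auto
      then show False
        by (intro fin[of 1]) force+
    qed (use loneD[OF _ yz] loneD[OF _ p] p2 in force)+
  qed
qed

context bad_support
begin

text \<open>Lowering \<open>t\<close> rotates about an edge in the plane \<open>c = 0\<close>. The
  next face contains the pure power, so it is exceptional, and its apex is the exponent sought: an
  apex \<open>(0, q, 1)\<close> is ruled out by \<open>no_pure_and_mixed\<close>, the others by the
  two known points.\<close>

lemma boundary_monomial_aux: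
  assumes p: "tight A p 0 0 s t" and k: "tight A a b 0 s t" and b: "1 \<le> b"
    and pos: "0 < s" "0 < t"
  shows "\<exists>q s t. 0 < s \<and> 0 < t \<and> (tight A q 1 0 s t \<or> tight A q 0 1 s t)"
proof -
  have p2: "2 \<le> p"
    using deg[OF tight_A[OF p]] by simp
  have ab: "2 \<le> a + b"
    using deg[OF tight_A[OF k]] by simp
  have "(0::real) < 0 \<or> - (1::real) < 0 \<or> (\<exists>a' b' c'. A a' b' c' \<and>
      (real b' - real 0) * 0 + (real c' - real 0) * (- 1) < 0)"
    by simp
  with p pos show ?thesis
  proof (rule slide)
    fix \<tau> a' b' c'
    let ?s = "s + \<tau> * 0" and ?t = "t + \<tau> * (- 1)"
    assume st: "0 \<le> \<tau>" "0 < ?s" "0 < ?t" and p': "tight A p 0 0 ?s ?t" and k': "tight A a' b' c' ?s ?t"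
      and rate: "(real b' - real 0) * 0 + (real c' - real 0) * (- 1) < 0"
    have abc: "tight A a b 0 ?s ?t"
      by (rule tight_along[OF p k p']) simp
    have "spans A ?s ?t"
      by (rule spansI[OF p' abc k']) (use rate b in simp)
    then have "exc A ?s ?t"
      by (rule exc_pure[OF st(2,3) _ p'])
    then show ?thesis
    proof (cases rule: exc_cases)
      case (1 q)
      then show ?thesis
        using st lone_tight by blast
    next
      case (3 q)
      then show ?thesis
        using st lone_tight by blast
    next
      case (2 q)
      then show ?thesis
        using loneD[OF 2 abc] ab b by auto
    next
      case (4 q)
      have "1 \<le> q"
        using deg[OF tight_A[OF lone_tight[OF 4]]] by simp
      then show ?thesis
        using no_pure_and_mixed[OF p' lone_tight[OF 4]] st by simp
    next
      case (5 q)
      then show ?thesis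
        using loneD[OF 5 p'] p2 by auto
    next
      case (6 q)
      then show ?thesis
        using loneD[OF 6 p'] p2 by auto
    qed
  next
    fix \<tau>
    let ?s = "s + \<tau> * 0" and ?t = "t + \<tau> * (- 1)"
    assume st: "0 < \<tau>" "0 \<le> ?s" "0 \<le> ?t" "?s = 0 \<or> ?t = 0" and p': "tight A p 0 0 ?s ?t"
    have t0: "?t = 0"
      using st pos by auto
    have "real p \<le> 1 \<or> real p \<le> s"
      using axis3_bound[of p 0 0 ?s] p' pos p2 unfolding t0 by simp
    moreover have "tight A a b 0 ?s ?t"
      by (rule tight_along[OF p k p']) simp
    then have "real p = real a + real b * s"
      using tight_eq[OF p'] unfolding t0 by (force simp: val_def)
    moreover have "1 * s \<le> real b * s"
      by (rule mult_right_mono) (use b pos in auto)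
    ultimately have "real a = 0" "real b * s = 1 * s"
      using p2 by linarith+
    then have "a = 0" "b = 1"
      using pos by auto
    then show ?thesis
      using ab by simp
  qed
qed

lemma boundary_monomial_no_pure:
  assumes "\<And>p. \<not> A p 0 0" "A q0 1 0"
  shows "\<exists>q s t. 0 < s \<and> 0 < t \<and> tight A q 1 0 s t"
proof -
  define q where "q = (LEAST q. A q 1 0)"
  have q: "A q 1 0" "\<And>a. A a 1 0 \<Longrightarrow> q \<le> a"
    unfolding q_def using assms(2) by (auto intro: LeastI Least_le)
  have q1: "1 \<le> q"
    using deg[OF q(1)] by simp
  \<comment> \<open>With these weights \<open>(q, 1, 0)\<close> has value \<open>2 * q\<close>, and
    so much is reached by any exponent with \<open>c\<close> positive or with \<open>b\<close> at
    least 2; exponents with \<open>b = 1\<close>, \<open>c = 0\<close> are handled by minimality of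
    \<open>q\<close>.\<close>
  have "tight A q 1 0 (real q) (2 * real q)"
    unfolding tight_def
  proof (intro conjI allI impI q(1))
    fix a b c assume k: "A a b c"
    have "q + q \<le> a + b * q + c * (2 * q)"
    proof (cases "c = 0")
      case True
      then have "b \<noteq> 0"
        using assms(1)[of a] k by (intro notI) simp
      show ?thesis
      proof (cases "b = 1")
        case True
        then show ?thesis
          using \<open>c = 0\<close> q(2) k by simp
      next
        case False
        then have "2 * q \<le> b * q"
          using \<open>b \<noteq> 0\<close> by (intro mult_le_mono1) simp
        then show ?thesis
          by linarith
      qed
    next
      case False
      then have "1 * (2 * q) \<le> c * (2 * q)"
        by (intro mult_le_mono1) simp
      then show ?thesis
        by linarith
    qed
    then have "real (q + q) \<le> real (a + b * q + c * (2 * q))"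
      using of_nat_mono by blast
    then show "val q 1 0 (real q) (2 * real q) \<le> val a b c (real q) (2 * real q)"
      by (simp add: val_def)
  qed
  then show ?thesis
    using q1 by (intro exI[of _ q] exI[of _ "real q"] exI[of _ "2 * real q"]) simp
qed

end

text \<open>The starting point of the indirect arguments: a tight exponent at distance 1 from the
  first axis. If pure powers exist, the least one is tight at \<open>(p, p)\<close>; lowering both
  weights equally meets a second exponent, which lies in a coordinate plane by
  \<open>no_pure_and_mixed\<close>.\<close>

lemma (in bad_support) boundary_monomial:
  "\<exists>q s t. 0 < s \<and> 0 < t \<and> (tight A q 1 0 s t \<or> tight A q 0 1 s t)"
proof -
  interpret f: bad_support "flip A" m
    by (rule bad_support_flip) (rule bad_support_axioms)
  show ?thesis
  proof (cases "\<exists>p. A p 0 0")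
    case False
    then obtain q where "A q 1 0 \<or> A q 0 1"
      using axis1 by blast
    then show ?thesis
    proof
      assume "A q 1 0"
      then show ?thesis
        using boundary_monomial_no_pure[of q] False by blast
    next
      assume "A q 0 1"
      then obtain q' s t where "0 < s" "0 < t" "tight (flip A) q' 1 0 s t"
        using f.boundary_monomial_no_pure[of q] False by (auto simp: flip_def)
      then show ?thesis
        unfolding tight_swap by blast
    qed
  next
    case True
    define p where "p = (LEAST p. A p 0 0)"
    have p: "A p 0 0" "\<And>a. A a 0 0 \<Longrightarrow> p \<le> a"
      unfolding p_def using True by (auto intro: LeastI Least_le)
    have p2: "2 \<le> p"
      using deg[OF p(1)] by simp
    have "tight A p 0 0 (real p) (real p)"
      unfolding tight_def
    proof (intro conjI allI impI p(1))
      fix a b c assume k: "A a b c"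
      have "p \<le> a + b * p + c * p"
      proof (cases "b = 0 \<and> c = 0")
        case True
        then show ?thesis
          using p(2) k by auto
      next
        case False
        then have "1 * p \<le> (b + c) * p"
          by (intro mult_le_mono1) auto
        then show ?thesis
          by (simp add: algebra_simps)
      qed
      then have "real p \<le> real (a + b * p + c * p)"
        using of_nat_mono by blast
      then show "val p 0 0 (real p) (real p) \<le> val a b c (real p) (real p)"
        by (simp add: val_def)
    qed
    moreover have "0 < real p"
      using p2 by simp
    moreover have "- (1::real) < 0 \<or> - (1::real) < 0 \<or> (\<exists>a' b' c'. A a' b' c' \<and>
        (real b' - real 0) * (- 1) + (real c' - real 0) * (- 1) < 0)"
      by simp
    ultimately show ?thesis
    proof (rule slide[OF _ _ \<open>0 < real p\<close>])
      fix \<tau> a' b' c'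
      let ?s = "real p + \<tau> * (- 1)"
      assume st: "0 \<le> \<tau>" "0 < ?s" "0 < ?s" and p': "tight A p 0 0 ?s ?s" and k': "tight A a' b' c' ?s ?s"
        and rate: "(real b' - real 0) * (- 1) + (real c' - real 0) * (- 1) < 0"
      consider "b' = 0" "1 \<le> c'" | "c' = 0" "1 \<le> b'"
        using no_pure_and_mixed[OF p' k' _ _ st(2,3)] rate by force
      then show ?thesis
      proof cases
        case 1
        then show ?thesis
          using f.boundary_monomial_aux[of p ?s ?s a' c'] p' k' st unfolding tight_swap by blast
      next
        case 2
        then show ?thesis
          using boundary_monomial_aux[OF p' _ 2(2) st(2,3)] k' by blast
      qed
    next
      fix \<tau>
      let ?s = "real p + \<tau> * (- 1)"
      assume st: "0 < \<tau>" "0 \<le> ?s" "0 \<le> ?s" "?s = 0 \<or> ?s = 0" and p': "tight A p 0 0 ?s ?s"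
      then have s0: "?s = 0"
        by simp
      \<comment> \<open>With both weights zero only the first entry counts, and near the second axis
        it is at most 1.\<close>
      obtain n where "A 0 n 0 \<or> A 1 n 0 \<or> A 0 n 1"
        using axis2 by blast
      then have "real p \<le> 1"
        using tightD[OF p', of 0 n 0] tightD[OF p', of 1 n 0] tightD[OF p', of 0 n 1]
        unfolding s0 by (auto simp: val_def)
      then show ?thesis
        using p2 by simp
    qed
  qed
qed

text \<open>
  The conclusion of every indirect argument about a monomial \<open>(q, 1, 0)\<close>; it is incompatible with its
  mirror image.
\<close>
definition corner :: "(nat \<Rightarrow> nat \<Rightarrow> nat \<Rightarrow> bool) \<Rightarrow> bool" where
  "corner A \<longleftrightarrow> (\<exists>q a b r s t. 0 < s \<and> 0 < t \<and> 2 \<le> b \<and> tight A q 1 0 s t \<and> tight A a b 0 s t \<and>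
     lone A s t r 0 1 (\<lambda>a b c. c = 0))"

lemma corner_flip:
  "corner (flip A) \<longleftrightarrow> (\<exists>q a b r s t. 0 < s \<and> 0 < t \<and> 2 \<le> b \<and> tight A q 0 1 s t \<and> tight A a 0 b s t \<and>
     lone A s t r 1 0 (\<lambda>a b c. b = 0))"
  unfolding corner_def lone_swap tight_swap by blast

text \<open>Tightness of exponents on a common line parallel to the first axis identifies their
  first entries, so the faces share the edge from \<open>(q, 1, 0)\<close> to
  \<open>(r, 0, 1)\<close>. A base point of either face lies strictly above the plane of the other;
  this gives \<open>t' < t\<close> and \<open>s < s'\<close>, whereas the common edge makes
  \<open>t - s\<close> the same for both.\<close>

lemma not_both_corners:
  assumes "corner A" "corner (flip A)"
  shows False
proof -
  obtain q a b r s t where 1: "0 < s" "0 < t" "2 \<le> b" "tight A q 1 0 s t" "tight A a b 0 s t"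
    and l1: "lone A s t r 0 1 (\<lambda>a b c. c = 0)"
    using assms(1) unfolding corner_def by blast
  obtain r' c d q' s' t' where 2: "0 < s'" "0 < t'" "2 \<le> d" "tight A r' 0 1 s' t'" "tight A c 0 d s' t'"
    and l2: "lone A s' t' q' 1 0 (\<lambda>a b c. b = 0)"
    using assms(2) unfolding corner_flip by blast
  note r = lone_tight[OF l1] and q' = lone_tight[OF l2]
  have qq: "q' = q"
    using tightD[OF 1(4) tight_A[OF q']] tightD[OF q' tight_A[OF 1(4)]] by (simp add: val_def)
  have rr: "r' = r"
    using tightD[OF r tight_A[OF 2(4)]] tightD[OF 2(4) tight_A[OF r]] by (simp add: val_def)
  have "\<not> tight A c 0 d s t"
    using loneD[OF l1, of c 0 d] 2(3) by auto
  then have "val r 0 1 s t < val c 0 d s t"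
    using tight_transfer[OF r tight_A[OF 2(5)]] by force
  moreover have "val r 0 1 s' t' = val c 0 d s' t'"
    using tight_eq[OF 2(4,5)] rr by simp
  ultimately have "(real d - 1) * (t' - t) < 0"
    by (simp add: val_def algebra_simps)
  then have t: "t' < t"
    using 2(3) by (simp add: mult_less_0_iff)
  have "\<not> tight A a b 0 s' t'"
    using loneD[OF l2, of a b 0] 1(3) by auto
  then have "val q 1 0 s' t' < val a b 0 s' t'"
    using tight_transfer[OF q' tight_A[OF 1(5)]] qq by force
  moreover have "val q 1 0 s t = val a b 0 s t"
    using tight_eq[OF 1(4,5)] by simp
  ultimately have "(real b - 1) * (s - s') < 0"
    by (simp add: val_def algebra_simps)
  then have s: "s < s'"
    using 1(3) by (simp add: mult_less_0_iff)
  have "val q 1 0 s t = val r 0 1 s t" "val q 1 0 s' t' = val r 0 1 s' t'"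
    using tight_eq[OF 1(4) r] tight_eq[OF q' 2(4)] qq rr by simp_all
  then show False
    using s t by (simp add: val_def)
qed

section \<open>Rotations about the exponent (q, 1, 0)\<close>

context bad_support
begin

text \<open>Disposes of the \<open>edge\<close> outcome of every rotation about
  \<open>(q, 1, 0)\<close> that could end with \<open>t = 0\<close>: the value \<open>q + s\<close>
  violates both bounds of \<open>axis3_bound\<close>.\<close>

lemma linear_second_positive:
  assumes "tight A q 1 0 s 0" "2 \<le> q" "0 \<le> s"
  shows False
  using axis3_bound[OF assms(1)] assms by simp

text \<open>Rotation about the segment from \<open>(q, 1, 0)\<close> to \<open>(a, b, c)\<close> in
  the direction \<open>(c, - (b - 1))\<close>. An exceptional face through both points has apex
  \<open>(a, b, c) = (0, r, 1)\<close> and base in \<open>c = 0\<close>; the newly met exponent is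
  then a pure power, which \<open>no_pure_and_mixed\<close> forbids. The second weight only grows,
  so \<open>ex\<close> is required merely for \<open>s \<le> s'\<close>; in
  \<open>corner_of_undominated\<close> nothing more is available.\<close>

lemma no_tight_interior:
  assumes w: "tight A q 1 0 s t" and k: "tight A a b c s t" and q: "2 \<le> q" and bc: "1 \<le> b" "1 \<le> c"
    and pos: "0 < s" "0 < t"
    and ex: "\<And>s' t'. s \<le> s' \<Longrightarrow> 0 < t' \<Longrightarrow> tight A q 1 0 s' t' \<Longrightarrow> spans A s' t' \<Longrightarrow> exc A s' t'"
  shows False
proof -
  \<comment> \<open>For \<open>b = 1\<close> no weight decreases; an exponent free of the second
    variable guarantees that the rotation ends nevertheless.\<close>
  obtain a0 c0 where "A a0 0 c0"
    using plane2 by blast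
  moreover have "(real 0 - real 1) * real c + (real c0 - real 0) * (- (real b - 1)) < 0"
  proof -
    have "0 \<le> real c0 * (real b - 1)"
      using bc by simp
    then show ?thesis
      using bc by (simp add: algebra_simps)
  qed
  ultimately have "real c < 0 \<or> - (real b - 1) < 0 \<or> (\<exists>a' b' c'. A a' b' c' \<and>
      (real b' - real 1) * real c + (real c' - real 0) * (- (real b - 1)) < 0)"
    by blast
  with w pos show False
  proof (rule slide)
    fix \<tau> a' b' c'
    let ?s = "s + \<tau> * real c" and ?t = "t + \<tau> * (- (real b - 1))"
    assume st: "0 \<le> \<tau>" "0 < ?s" "0 < ?t" and w': "tight A q 1 0 ?s ?t" and k': "tight A a' b' c' ?s ?t"
      and rate: "(real b' - real 1) * real c + (real c' - real 0) * (- (real b - 1)) < 0"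
    have abc: "tight A a b c ?s ?t"
      by (rule tight_along[OF w k w']) (simp add: algebra_simps)
    have "spans A ?s ?t"
      by (rule spansI[OF w' abc k']) (use rate in \<open>simp add: algebra_simps\<close>)
    moreover have "s \<le> ?s"
      using st(1) by simp
    ultimately have "exc A ?s ?t"
      using ex[OF _ st(3) w'] by blast
    then show False
    proof (cases rule: exc_cases)
      case (4 r)
      have abc4: "a = 0" "b = r" "c = 1"
        using loneD[OF 4 abc] bc by auto
      have "a' = a \<and> b' = b \<and> c' = c \<or> c' = 0"
        using loneD[OF 4 k'] abc4 by auto
      moreover have "\<not> (a' = a \<and> b' = b \<and> c' = c)"
        using rate by (auto simp: algebra_simps)
      ultimately have c'0: "c' = 0"
        by blast
      have "(real b' - 1) * real c < 0"
        using rate c'0 by simp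
      then have "b' = 0"
        using bc by (simp add: mult_less_0_iff)
      then show False
        using no_pure_and_mixed[of a' ?s ?t a b c] k' abc c'0 bc st by simp
    next
      case 1
      then show False
        using loneD[OF 1 abc] bc by simp
    next
      case 2
      then show False
        using loneD[OF 2 w'] q by simp
    next
      case 3
      then show False
        using loneD[OF 3 abc] bc by simp
    next
      case 5
      then show False
        using loneD[OF 5 w'] q by simp
    next
      case 6
      then show False
        using loneD[OF 6 w'] q by simp
    qed
  next
    fix \<tau>
    let ?s = "s + \<tau> * real c" and ?t = "t + \<tau> * (- (real b - 1))"
    assume st: "0 < \<tau>" "0 \<le> ?s" "0 \<le> ?t" "?s = 0 \<or> ?t = 0" and w': "tight A q 1 0 ?s ?t"
    have "0 < ?s"
      using pos st bc by (simp add: add_pos_nonneg)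
    then have t0: "?t = 0"
      using st by auto
    show False
      using w' q st(2) unfolding t0 by (rule linear_second_positive)
  qed
qed

text \<open>Lowering \<open>t\<close> rotates about an edge in the plane \<open>c = 0\<close>. Since
  this edge has a point with \<open>b\<close> at least 2, the exceptional face met has its apex off
  this plane, either \<open>(r, 0, 1)\<close> as desired or \<open>(0, r, 1)\<close> with
  \<open>r\<close> positive, which \<open>no_tight_interior\<close> excludes.\<close>

lemma corner_from_edge:
  assumes w: "tight A q 1 0 s t" and k: "tight A a b 0 s t" and q: "2 \<le> q" and b: "2 \<le> b"
    and pos: "0 < s" "0 < t"
    and ex: "\<And>s' t'. s \<le> s' \<Longrightarrow> 0 < t' \<Longrightarrow> tight A q 1 0 s' t' \<Longrightarrow> spans A s' t' \<Longrightarrow> exc A s' t'"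
  shows "corner A" "\<exists>r s t. 0 < s \<and> 0 < t \<and> tight A r 0 1 s t"
proof -
  have "corner A \<and> (\<exists>r s t. 0 < s \<and> 0 < t \<and> tight A r 0 1 s t)"
  proof -
  have "(0::real) < 0 \<or> - (1::real) < 0 \<or> (\<exists>a' b' c'. A a' b' c' \<and>
      (real b' - real 1) * 0 + (real c' - real 0) * (- 1) < 0)"
    by simp
  with w pos show ?thesis
  proof (rule slide)
    fix \<tau> a' b' c'
    let ?s = "s + \<tau> * 0" and ?t = "t + \<tau> * (- 1)"
    assume st: "0 \<le> \<tau>" "0 < ?s" "0 < ?t" and w': "tight A q 1 0 ?s ?t" and k': "tight A a' b' c' ?s ?t"
      and rate: "(real b' - real 1) * 0 + (real c' - real 0) * (- 1) < 0"
    have ab: "tight A a b 0 ?s ?t"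
      by (rule tight_along[OF w k w']) simp
    have "spans A ?s ?t"
      by (rule spansI[OF w' ab k']) (use rate b in simp)
    moreover have "s \<le> ?s"
      by simp
    ultimately have "exc A ?s ?t"
      using ex[OF _ st(3) w'] by blast
    then show ?thesis
    proof (cases rule: exc_cases)
      case (3 r)
      then show ?thesis
        unfolding corner_def by (intro conjI exI) (rule st b w' ab 3 lone_tight[OF 3])+
    next
      case (4 r)
      have "1 \<le> r"
        using deg[OF tight_A[OF lone_tight[OF 4]]] by simp
      have False
        by (rule no_tight_interior[OF w' lone_tight[OF 4] q \<open>1 \<le> r\<close> order.refl st(2,3)]) (simp add: ex)
      then show ?thesis ..
    next
      case 1
      then show ?thesis
        using loneD[OF 1 ab] b by simp
    next
      case 2
      then show ?thesis
        using loneD[OF 2 w'] q by simp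
    next
      case 5
      then show ?thesis
        using loneD[OF 5 w'] q by simp
    next
      case 6
      then show ?thesis
        using loneD[OF 6 w'] q by simp
    qed
  next
    fix \<tau>
    let ?s = "s + \<tau> * 0" and ?t = "t + \<tau> * (- 1)"
    assume st: "0 < \<tau>" "0 \<le> ?s" "0 \<le> ?t" "?s = 0 \<or> ?t = 0" and w': "tight A q 1 0 ?s ?t"
    have t0: "?t = 0"
      using st pos by auto
    have False
      using w' q st(2) unfolding t0 by (rule linear_second_positive)
    then show ?thesis ..
  qed
  qed
  then show "corner A" "\<exists>r s t. 0 < s \<and> 0 < t \<and> tight A r 0 1 s t"
    by blast+
qed

text \<open>If \<open>q + 1\<close> exceeds \<open>m\<close>, every face through
  \<open>(q, 1, 0)\<close> is exceptional, because \<open>q + s'\<close> is at least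
  \<open>(q + 1) * min 1 (min s' t')\<close>. Lowering \<open>s\<close> either meets an exponent
  with \<open>b\<close> at least 2, to which \<open>corner_from_edge\<close> applies, or reaches
  \<open>s = 0\<close>, which is refuted.\<close>

lemma corner_of_steep:
  assumes w: "tight A q 1 0 s t" and q: "2 \<le> q" and qm: "m < real q + 1" and pos: "0 < s" "0 < t"
  shows "corner A \<and> (\<exists>r s t. 0 < s \<and> 0 < t \<and> tight A r 0 1 s t)"
proof -
  have ex: "exc A s' t'" if "0 < s'" "0 < t'" "tight A q 1 0 s' t'" "spans A s' t'" for s' t'
  proof (rule vertex_exc[OF that(1,2,4,3)])
    have mu: "0 < min 1 (min s' t')" "min 1 (min s' t') \<le> 1" "min 1 (min s' t') \<le> s'"
      using that by auto
    have "m * min 1 (min s' t') < (real q + 1) * min 1 (min s' t')"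
      using mu qm by simp
    also have "\<dots> = real q * min 1 (min s' t') + min 1 (min s' t')"
      by (simp add: algebra_simps)
    also have "\<dots> \<le> real q * 1 + s'"
      using mu by (intro add_mono mult_left_mono) auto
    finally show "m * min 1 (min s' t') < val q 1 0 s' t'"
      by (simp add: val_def)
  qed
  have tie: "corner A \<and> (\<exists>r s t. 0 < s \<and> 0 < t \<and> tight A r 0 1 s t)"
    if "0 < s'" "0 < t'" "tight A q 1 0 s' t'" "tight A a b c s' t'" "2 \<le> b" for s' t' a b c
  proof -
    have ex': "exc A s'' t''" if "s' \<le> s''" "0 < t''" "tight A q 1 0 s'' t''" "spans A s'' t''" for s'' t''
      using ex[of s'' t''] that \<open>0 < s'\<close> by simp
    have "c = 0"
      using no_tight_interior[OF that(3,4) q _ _ that(1,2) ex'] that(5) by force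
    then show ?thesis
      using corner_from_edge[OF that(3) _ q that(5,1,2) ex'] that(4) by blast
  qed
  have "- (1::real) < 0 \<or> (0::real) < 0 \<or> (\<exists>a' b' c'. A a' b' c' \<and>
      (real b' - real 1) * (- 1) + (real c' - real 0) * 0 < 0)"
    by simp
  with w pos show ?thesis
  proof (rule slide)
    fix \<tau> a' b' c'
    let ?s = "s + \<tau> * (- 1)" and ?t = "t + \<tau> * 0"
    assume st: "0 \<le> \<tau>" "0 < ?s" "0 < ?t" and w': "tight A q 1 0 ?s ?t" and k': "tight A a' b' c' ?s ?t"
      and rate: "(real b' - real 1) * (- 1) + (real c' - real 0) * 0 < 0"
    show ?thesis
      by (rule tie[OF st(2,3) w' k']) (use rate in simp)
  next
    fix \<tau>
    let ?s = "s + \<tau> * (- 1)" and ?t = "t + \<tau> * 0"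
    assume st: "0 < \<tau>" "0 \<le> ?s" "0 \<le> ?t" "?s = 0 \<or> ?t = 0" and w': "tight A q 1 0 ?s ?t"
    have "?s = 0"
      using st pos by auto
    then have w0: "tight A q 1 0 0 t"
      using w' by simp
    \<comment> \<open>At \<open>s = 0\<close> the value of \<open>(q, 1, 0)\<close> is
      \<open>q\<close>, at least 2, so the exponent near the second axis must involve the third
      variable. For small \<open>s\<close> it keeps \<open>t\<close> from falling much below
      \<open>q\<close>.\<close>
    obtain n0 where "A 0 n0 0 \<or> A 1 n0 0 \<or> A 0 n0 1"
      using axis2 by blast
    then have n0: "A 0 n0 1"
      using tightD[OF w0, of 0 n0 0] tightD[OF w0, of 1 n0 0] q by (auto simp: val_def)
    define n where "n = Suc n0"
    \<comment> \<open>Chosen so that \<open>n * \<epsilon>\<close> is at most 1/2: then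
      \<open>(0, n0, 1)\<close> forces \<open>t\<close> to be nearly \<open>q\<close> as long as
      \<open>(q, 1, 0)\<close> is tight. Convexity of the normal cone makes \<open>(q, 1, 0)\<close>
      tight at second weight \<open>\<epsilon>\<close>.\<close>
    define \<epsilon> where "\<epsilon> = min s (1 / (2 * real n + 1))"
    have \<epsilon>: "0 < \<epsilon>" "\<epsilon> \<le> s" "\<epsilon> * (2 * real n + 1) \<le> 1"
    proof -
      have "\<epsilon> \<le> 1 / (2 * real n + 1)"
        by (simp add: \<epsilon>_def)
      then have "\<epsilon> * (2 * real n + 1) \<le> 1 / (2 * real n + 1) * (2 * real n + 1)"
        by (intro mult_right_mono) auto
      also have "\<dots> = 1"
        by (simp add: field_simps)
      finally show "\<epsilon> * (2 * real n + 1) \<le> 1" .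
    qed (use pos in \<open>simp_all add: \<epsilon>_def\<close>)
    have "tight A q 1 0 (0 + \<epsilon> / s * (s - 0)) (t + \<epsilon> / s * (t - t))"
      by (rule tight_convex[OF w0 w]) (use \<epsilon> pos in auto)
    then have w\<epsilon>: "tight A q 1 0 \<epsilon> t"
      using pos by simp
    have "(0::real) < 0 \<or> - (1::real) < 0 \<or> (\<exists>a' b' c'. A a' b' c' \<and>
        (real b' - real 1) * 0 + (real c' - real 0) * (- 1) < 0)"
      by simp
    with w\<epsilon> \<epsilon>(1) pos(2) show ?thesis
    proof (rule slide)
      fix \<tau> a' b' c'
      let ?s = "\<epsilon> + \<tau> * 0" and ?t = "t + \<tau> * (- 1)"
      assume st: "0 \<le> \<tau>" "0 < ?s" "0 < ?t" and w': "tight A q 1 0 ?s ?t" and k': "tight A a' b' c' ?s ?t"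
        and rate: "(real b' - real 1) * 0 + (real c' - real 0) * (- 1) < 0"
      have c': "1 \<le> c'"
        using rate by simp
      have ex': "exc A s'' t''" if "?s \<le> s''" "0 < t''" "tight A q 1 0 s'' t''" "spans A s'' t''" for s'' t''
        using ex[of s'' t''] that st(2) by simp
      have "\<not> 1 \<le> b'"
        using no_tight_interior[OF w' k' q _ c' st(2,3) ex'] by blast
      then have b': "b' = 0"
        by simp
      have eq: "real q + \<epsilon> = real a' + real c' * ?t"
        using tight_eq[OF w' k'] b' by (simp add: val_def)
      have "real q + \<epsilon> \<le> real n0 * \<epsilon> + ?t"
        using tightD[OF w' n0] by (simp add: val_def)
      moreover have "real n0 * \<epsilon> \<le> real n * \<epsilon> - \<epsilon>"
        by (simp add: n_def algebra_simps)
      ultimately have tge: "real q + 2 * \<epsilon> \<le> real n * \<epsilon> + ?t"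
        by linarith
      have n\<epsilon>: "2 * (real n * \<epsilon>) + \<epsilon> \<le> 1"
        using \<epsilon>(3) by (simp add: algebra_simps)
      have "a' + c' \<ge> 2"
        using deg[OF tight_A[OF k']] b' by simp
      \<comment> \<open>A tie in the plane \<open>b = 0\<close> is impossible for \<open>t\<close>
        near \<open>q\<close>: with \<open>c' = 1\<close> the first entry adds at least 1, with
        \<open>c'\<close> at least 2 the value is about \<open>2 * q\<close> or more.\<close>
      then consider "c' = 1" "1 \<le> a'" | "2 \<le> c'"
        using c' by linarith
      then have False
      proof cases
        case 1
        then show False
          using eq tge n\<epsilon> \<epsilon>(1) by simp
      next
        case 2
        then have "2 * ?t \<le> real c' * ?t"
          using st(3) by (intro mult_right_mono) auto
        moreover have "2 \<le> real q" "0 \<le> real a'"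
          using q by simp_all
        moreover have False
          if "2 * T \<le> y" "2 \<le> Q" "0 \<le> x" "Q + \<epsilon> = x + y" "Q + 2 * \<epsilon> \<le> z + T" "2 * z + \<epsilon> \<le> 1" for T y Q x z :: real
          using that \<epsilon>(1) by linarith
        ultimately show False
          using eq tge n\<epsilon> by blast
      qed
      then show ?thesis ..
    next
      fix \<tau>
      let ?s = "\<epsilon> + \<tau> * 0" and ?t = "t + \<tau> * (- 1)"
      assume st: "0 < \<tau>" "0 \<le> ?s" "0 \<le> ?t" "?s = 0 \<or> ?t = 0" and w': "tight A q 1 0 ?s ?t"
      have t0: "?t = 0"
        using st \<epsilon> by auto
      have False
        using w' q st(2) unfolding t0 by (rule linear_second_positive)
      then show ?thesis ..
    qed
  qed
qed

end

section \<open>Deformation of the weights towards a prescribed vector\<close>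

lemma continuous_on_Min_image:
  fixes f :: "'i \<Rightarrow> 'a::topological_space \<Rightarrow> real"
  assumes "finite I" "I \<noteq> {}" "\<And>i. i \<in> I \<Longrightarrow> continuous_on S (f i)"
  shows "continuous_on S (\<lambda>x. Min ((\<lambda>i. f i x) ` I))"
  using assms
proof (induction I rule: finite_ne_induct)
  case (insert i I)
  have "continuous_on S (\<lambda>x. min (f i x) (Min ((\<lambda>i. f i x) ` I)))"
    by (intro continuous_on_min insert) (use insert.prems in auto)
  then show ?case
    using insert.hyps by (simp add: Min_insert)
qed simp

context bad_support
begin

text \<open>Adding the same amount to both weights raises \<open>(q, 1, 0)\<close> by that amount
  and every exponent that is not a pure power by at least as much. Only pure powers can stop this,
  and these exceed \<open>m\<close>.\<close>

lemma raise_boundary_point: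
  assumes w: "tight A q 1 0 s t" and pos: "0 < s" "0 < t"
  obtains s' t' where "0 < s'" "0 < t'" "tight A q 1 0 s' t'" "m < real q + s'"
proof -
  have up: "tight A q 1 0 (s + x) (t + x)" if x: "0 \<le> x" and p: "\<And>p. A p 0 0 \<Longrightarrow> real q + s + x \<le> real p" for x
    unfolding tight_def
  proof (intro conjI allI impI)
    fix a b c assume k: "A a b c"
    show "val q 1 0 (s + x) (t + x) \<le> val a b c (s + x) (t + x)"
    proof (cases "b = 0 \<and> c = 0")
      case True
      then show ?thesis
        using p[of a] k by (simp add: val_def)
    next
      case False
      then have "1 * x \<le> real (b + c) * x"
        using x by (intro mult_right_mono) auto
      then show ?thesis
        using tightD[OF w k] by (simp add: val_def algebra_simps)
    qed
  qed (rule tight_A[OF w])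
  show ?thesis
  proof (cases "\<exists>p. A p 0 0")
    case False
    show ?thesis
      by (rule that[OF _ _ up[of "m + 1"]]) (use False pos m_nonneg in auto)
  next
    case True
    define p where "p = (LEAST p. A p 0 0)"
    have p: "A p 0 0" "\<And>a. A a 0 0 \<Longrightarrow> p \<le> a"
      unfolding p_def using True by (auto intro: LeastI Least_le)
    have "real q + s \<le> real p"
      using tightD[OF w p(1)] by (simp add: val_def)
    then show ?thesis
      by (intro that[OF _ _ up[of "real p - (real q + s)"]]) (use p pure[OF p(1)] pos in auto)
  qed
qed

text \<open>The weights are moved from a point where \<open>(q, 1, 0)\<close> is tight to
  \<open>(u, v)\<close>, where a competitor divisible by the second variable is at most as heavy.
  Somewhere in between the two are equally heavy. Exponents with \<open>b = 0\<close> might become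
  lighter on the way, and the path is bent to prevent this; the resulting tie is then fed to
  \<open>corner_from_edge\<close>.\<close>

lemma corner_of_undominated:
  assumes w0: "tight A q 1 0 s0 t0" and q: "2 \<le> q" and pos0: "0 < s0" "0 < t0"
    and pos: "0 < u" "0 < v" and big: "\<And>a b c. A a b c \<Longrightarrow> m < val a b c u v"
    and bad: "A a1 b1 c1" "1 \<le> b1" "\<not> (a1 = q \<and> b1 = 1 \<and> c1 = 0)" "val a1 b1 c1 u v \<le> val q 1 0 u v"
  shows "corner A \<and> (\<exists>r s t. 0 < s \<and> 0 < t \<and> tight A r 0 1 s t)"
proof -
  obtain s1 t1 where w: "tight A q 1 0 s1 t1" and pos1: "0 < s1" "0 < t1" and qs1: "m < real q + s1"
    by (rule raise_boundary_point[OF w0 pos0])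
  obtain M where finM: "finite M" and MA: "\<And>a b c. (a, b, c) \<in> M \<Longrightarrow> A a b c"
    and cov: "\<And>a b c. A a b c \<Longrightarrow> \<exists>a' b' c'. (a', b', c') \<in> M \<and> a' \<le> a \<and> b' \<le> b \<and> c' \<le> c \<and> (1 \<le> b \<longrightarrow> 1 \<le> b')"
    by (rule cover_second) (rule that)
  define M0 where "M0 = {(a, b, c) \<in> M. b = 0}"
  define M2 where "M2 = {(a, b, c) \<in> M. 1 \<le> b \<and> \<not> (a = q \<and> b = 1 \<and> c = 0)}"
  have fin: "finite M0" "finite M2"
    using finM by (auto simp: M0_def M2_def intro: finite_subset[of _ M])
  have M0ne: "M0 \<noteq> {}"
  proof -
    obtain a c where "A a 0 c"
      using plane2 by blast
    from cov[OF this] show ?thesis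
      by (auto simp: M0_def)
  qed
  obtain a2 b2 c2 where k2: "(a2, b2, c2) \<in> M2" "val a2 b2 c2 u v \<le> val q 1 0 u v"
  proof -
    obtain a2 b2 c2 where k: "(a2, b2, c2) \<in> M" "a2 \<le> a1" "b2 \<le> b1" "c2 \<le> c1" "1 \<le> b2"
      using cov[OF bad(1)] bad(2) by blast
    have le: "val a2 b2 c2 u v \<le> val a1 b1 c1 u v"
      by (rule val_mono) (use k pos in auto)
    have "\<not> (a2 = q \<and> b2 = 1 \<and> c2 = 0)"
    proof
      assume "a2 = q \<and> b2 = 1 \<and> c2 = 0"
      then show False
        using val_mono_eq[OF k(2-4) pos] bad(3,4) by auto
    qed
    then show ?thesis
      using that[of a2 b2 c2] k le bad(4) by (auto simp: M2_def)
  qed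
  \<comment> \<open>The least value of the exponents free of the second variable; it depends on the
    third weight only.\<close>
  define \<phi> where "\<phi> y = Min ((\<lambda>(a, b, c). real a + real c * y) ` M0)" for y
  have \<phi>_le: "\<phi> y \<le> real a + real c * y" if "(a, 0, c) \<in> M" for y a c
    unfolding \<phi>_def using fin that by (intro Min_le) (force simp: M0_def)+
  have \<phi>_eq: "\<exists>a c. (a, 0, c) \<in> M \<and> \<phi> y = real a + real c * y" for y
  proof -
    have "\<phi> y \<in> (\<lambda>(a, b, c). real a + real c * y) ` M0"
      unfolding \<phi>_def using fin M0ne by (intro Min_in) auto
    then show ?thesis
      by (auto simp: M0_def)
  qed
  define v2 where "v2 x = s1 + x * (u - s1)" for x
  define v3 where "v3 x = t1 + x * (v - t1)" for x
  \<comment> \<open>The linear path, with the second weight lowered just enough that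
    \<open>(q, 1, 0)\<close> is never heavier than an exponent with \<open>b = 0\<close>.\<close>
  define P where "P x = min (v2 x) (\<phi> (v3 x) - real q)" for x
  define g where "g x = Min ((\<lambda>(a, b, c). val a b c (P x) (v3 x) - val q 1 0 (P x) (v3 x)) ` M2)" for x
  have cont\<phi>: "continuous_on {0..1} (\<lambda>x. \<phi> (v3 x))"
    unfolding \<phi>_def case_prod_unfold v3_def using fin M0ne
    by (intro continuous_on_Min_image continuous_intros) auto
  have contP: "continuous_on {0..1} P"
    unfolding P_def[abs_def] v2_def using cont\<phi> by (intro continuous_intros)
  have contg: "continuous_on {0..1} g"
    unfolding g_def[abs_def] case_prod_unfold val_def v3_def using fin k2(1) contP
    by (intro continuous_on_Min_image continuous_intros) auto
  have g_le: "g x \<le> val a b c (P x) (v3 x) - val q 1 0 (P x) (v3 x)" if "(a, b, c) \<in> M2" for x a b c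
    unfolding g_def using fin that by (intro Min_le) force+
  have g_eq: "\<exists>a b c. (a, b, c) \<in> M2 \<and> g x = val a b c (P x) (v3 x) - val q 1 0 (P x) (v3 x)" for x
  proof -
    have "g x \<in> (\<lambda>(a, b, c). val a b c (P x) (v3 x) - val q 1 0 (P x) (v3 x)) ` M2"
      unfolding g_def using fin k2 by (intro Min_in) auto
    then show ?thesis
      by auto
  qed
  have "0 \<le> g 0"
  proof -
    obtain a c where ac: "(a, 0, c) \<in> M" "\<phi> t1 = real a + real c * t1"
      using \<phi>_eq by blast
    have "real q + s1 \<le> \<phi> t1"
      using tightD[OF w MA[OF ac(1)]] ac(2) by (simp add: val_def)
    then have "P 0 = s1" "v3 0 = t1"
      by (simp_all add: P_def v2_def v3_def)
    then show ?thesis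
      using g_eq[of 0] tightD[OF w MA] by (force simp: M2_def)
  qed
  moreover have "g 1 \<le> 0"
  proof -
    have "P 1 \<le> u" "v3 1 = v"
      by (simp_all add: P_def v2_def v3_def)
    moreover have "1 \<le> b2"
      using k2(1) by (simp add: M2_def)
    \<comment> \<open>Bending the path downwards cannot hurt at its end: lowering the second weight
      favours the competitor, as \<open>b2\<close> is positive.\<close>
    ultimately have "(real b2 - 1) * P 1 \<le> (real b2 - 1) * u"
      by (intro mult_left_mono) auto
    then show ?thesis
      using g_le[OF k2(1), of 1] k2(2) \<open>v3 1 = v\<close> by (simp add: val_def algebra_simps)
  qed
  ultimately obtain x where x: "0 \<le> x" "x \<le> 1" "g x = 0"
    using IVT2'[of g 1 0 0] contg by auto
  have conv: "0 < s + x * (s' - s)" if "0 < s" "0 < s'" for s s' :: real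
  proof -
    have "0 < (1 - x) * s + x * s'"
    proof (cases "x = 0")
      case False
      then show ?thesis
        using x that by (intro add_nonneg_pos mult_nonneg_nonneg mult_pos_pos) auto
    qed (use that in simp)
    then show ?thesis
      by (simp add: algebra_simps)
  qed
  define s t where "s = P x" and "t = v3 x"
  have tpos: "0 < t" and v2pos: "0 < v2 x"
    using conv[OF pos1(2) pos(2)] conv[OF pos1(1) pos(1)] by (simp_all add: t_def v2_def v3_def)
  have M2_le: "real q + s \<le> real a + real b * s + real c * t" if "(a, b, c) \<in> M" "1 \<le> b" for a b c
  proof (cases "a = q \<and> b = 1 \<and> c = 0")
    case False
    then show ?thesis
      using g_le[of a b c x] that x(3) by (simp add: M2_def val_def s_def t_def)
  qed simp
  have M0_le: "real q + s \<le> real a + real c * t" if "(a, 0, c) \<in> M" for a c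
  proof -
    have "real q + s \<le> \<phi> t"
      by (simp add: s_def t_def P_def)
    then show ?thesis
      using \<phi>_le[OF that, of t] by linarith
  qed
  \<comment> \<open>For \<open>s \<le> 0\<close> the exponent near the second axis gives
    \<open>q \<le> t\<close>. But then \<open>s\<close> comes from \<open>\<phi>\<close>, whose
    value is at most \<open>q\<close>; the three possibilities for the third entry of its minimiser
    contradict tightness at the start, the degree bound, and \<open>q \<le> t\<close>,
    respectively.\<close>
  have spos: "0 < s"
  proof (rule ccontr)
    assume "\<not> 0 < s"
    then have s0: "s \<le> 0"
      by simp
    obtain i n j where ax: "A i n j" "i + j \<le> 1"
    proof -
      obtain n where "A 0 n 0 \<or> A 1 n 0 \<or> A 0 n 1"
        using axis2 by blast
      then show ?thesis
        using that[of 0 n 0] that[of 1 n 0] that[of 0 n 1] by auto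
    qed
    have "1 \<le> n"
      using deg[OF ax(1)] ax(2) by simp
    then obtain a b c where k: "(a, b, c) \<in> M" "a + c \<le> 1" "1 \<le> b"
      using cov[OF ax(1)] ax(2) by force
    have "(real b - 1) * s \<le> 0"
      using s0 k by (intro mult_nonneg_nonpos) auto
    then have qt: "real q \<le> real a + real c * t"
      using M2_le[OF k(1,3)] by (simp add: algebra_simps)
    have "c = 1 \<and> a = 0"
    proof (cases "c = 0")
      case True
      then show ?thesis
        using qt k(2) q by simp
    qed (use k(2) in simp)
    then have qt: "real q \<le> t"
      using qt by simp
    obtain a c where ac: "(a, 0, c) \<in> M" "\<phi> t = real a + real c * t"
      using \<phi>_eq by blast
    have le: "real a + real c * t \<le> real q"
      using s0 v2pos ac(2) by (auto simp: s_def t_def P_def min_def split: if_splits)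
    consider "c = 0" | "c = 1" | "2 \<le> c"
      by linarith
    then show False
    proof cases
      case 1
      then show False
        using tightD[OF w MA[OF ac(1)]] le pos1 by (simp add: val_def)
    next
      case 2
      then show False
        using deg[OF MA[OF ac(1)]] le qt by simp
    next
      case 3
      then have "2 * t \<le> real c * t"
        using tpos by (intro mult_right_mono) auto
      then show False
        using le qt q by linarith
    qed
  qed
  have ws: "tight A q 1 0 s t"
    unfolding tight_def
  proof (intro conjI allI impI tight_A[OF w])
    fix a b c assume "A a b c"
    then obtain a' b' c' where k: "(a', b', c') \<in> M" "a' \<le> a" "b' \<le> b" "c' \<le> c"
      using cov by blast
    have "val q 1 0 s t \<le> val a' b' c' s t"
      using M2_le[OF k(1)] M0_le[of a' c'] k(1) by (cases "b' = 0") (auto simp: val_def)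
    also have "\<dots> \<le> val a b c s t"
      by (rule val_mono) (use k spos tpos in auto)
    finally show "val q 1 0 s t \<le> val a b c s t" .
  qed
  have conv': "m < r + x * (r' - r)" if "m < r" "m < r'" for r r' :: real
    using conv[of "r - m" "r' - m"] that by simp
  \<comment> \<open>Both terms of the minimum defining \<open>P\<close>, with \<open>q\<close>
    added, are minima of affine functions of the path parameter that exceed \<open>m\<close> at both
    ends.\<close>
  have qs: "m < real q + s"
  proof -
    have "m < real q + v2 x"
      using conv'[OF qs1, of "real q + u"] big[OF tight_A[OF w]] by (simp add: v2_def val_def)
    moreover have "m < \<phi> t"
    proof -
      obtain a c where ac: "(a, 0, c) \<in> M" "\<phi> t = real a + real c * t"
        using \<phi>_eq by blast
      have "m < real a + real c * t1"
        using tightD[OF w MA[OF ac(1)]] qs1 by (simp add: val_def)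
      moreover have "m < real a + real c * v"
        using big[OF MA[OF ac(1)]] by (simp add: val_def)
      ultimately have "m < (real a + real c * t1) + x * ((real a + real c * v) - (real a + real c * t1))"
        by (rule conv')
      also have "\<dots> = real a + real c * t"
        by (simp add: t_def v3_def algebra_simps)
      finally show ?thesis
        using ac by simp
    qed
    ultimately show ?thesis
      by (simp add: s_def t_def P_def min_def)
  qed
  have ex: "exc A s' t'" if "s \<le> s'" "0 < t'" "tight A q 1 0 s' t'" "spans A s' t'" for s' t'
  proof (rule vertex_exc[OF _ that(2,4,3)])
    show "0 < s'"
      using that spos by simp
    have "m * min 1 (min s' t') \<le> m * 1"
      using m_nonneg by (intro mult_left_mono) auto
    then show "m * min 1 (min s' t') < val q 1 0 s' t'"
      using qs that by (simp add: val_def)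
  qed
  obtain a b c where k: "(a, b, c) \<in> M2" "val a b c s t = val q 1 0 s t"
    using g_eq[of x] x(3) by (auto simp: s_def t_def)
  have kt: "tight A a b c s t"
    by (rule tight_transfer[OF ws MA]) (use k in \<open>auto simp: M2_def\<close>)
  have b: "1 \<le> b"
    using k by (simp add: M2_def)
  have c: "c = 0"
    using no_tight_interior[OF ws kt q b _ spos tpos ex] by force
  \<comment> \<open>With \<open>b = 1\<close> and \<open>c = 0\<close> equality of values would give
    \<open>a = q\<close>, the excluded exponent.\<close>
  have "b \<noteq> 1"
    using k c by (auto simp: M2_def val_def)
  then have "2 \<le> b"
    using b by simp
  then show ?thesis
    using corner_from_edge[OF ws _ q _ spos tpos ex] kt c by blast
qed

text \<open>The second weight \<open>e - 1\<close> gives \<open>(1, 1, 0)\<close>,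
  \<open>(0, 1, 1)\<close> and an exponent of least degree \<open>e\<close> among those with
  \<open>b = 0\<close> the common value \<open>e\<close>, which exceeds \<open>m\<close>. The face
  they span is exceptional, which turns the third exponent into \<open>(e, 0, 0)\<close> or
  \<open>(0, 0, e)\<close>; a segment \<open>I_1^e\<close> or \<open>I_3^e\<close> can then be split
  off as an edge.\<close>

lemma not_two_mixed_quadratics:
  assumes xy: "A 1 1 0" and yz: "A 0 1 1" and big: "\<And>a c. A a 0 c \<Longrightarrow> m < real a + real c"
  shows False
proof -
  define e where "e = (LEAST n. \<exists>a c. A a 0 c \<and> n = a + c)"
  have ex: "\<exists>n a c. A a 0 c \<and> n = a + c"
    using plane2 by blast
  obtain a0 c0 where e: "A a0 0 c0" "e = a0 + c0"
    using LeastI_ex[OF ex] unfolding e_def by blast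
  have e_le: "e \<le> a + c" if "A a 0 c" for a c
    unfolding e_def by (rule Least_le) (use that in blast)
  have e2: "2 \<le> e"
    using deg[OF e(1)] e(2) by simp
  define s where "s = real e - 1"
  have s: "1 \<le> s"
    using e2 by (simp add: s_def)
  have txy: "tight A 1 1 0 s 1"
    unfolding tight_def
  proof (intro conjI allI impI xy)
    fix a b c assume k: "A a b c"
    consider "b = 0" | "b = 1" | "2 \<le> b"
      by linarith
    then show "val 1 1 0 s 1 \<le> val a b c s 1"
    proof cases
      case 1
      then show ?thesis
        using e_le[of a c] k by (simp add: val_def s_def)
    next
      case 2
      then show ?thesis
        using deg[OF k] by (simp add: val_def)
    next
      case 3
      then have "2 * s \<le> real b * s"
        using s by (intro mult_right_mono) auto
      moreover have "0 \<le> real a" "0 \<le> real c"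
        by simp_all
      moreover have "val 1 1 0 s 1 = 1 + s" "val a b c s 1 = real a + real b * s + real c"
        by (simp_all add: val_def)
      ultimately show ?thesis
        using s by linarith
    qed
  qed
  have tyz: "tight A 0 1 1 s 1"
    by (rule tight_transfer[OF txy yz]) (simp add: val_def)
  have te: "tight A a0 0 c0 s 1"
    by (rule tight_transfer[OF txy e(1)]) (use e(2) in \<open>simp add: val_def s_def\<close>)
  have "exc A s 1"
  proof (rule vertex_exc[OF _ _ _ txy])
    show "spans A s 1"
      by (rule spansI[OF txy tyz te]) simp
    have "m * min 1 (min s 1) \<le> m * 1"
      using m_nonneg by (intro mult_left_mono) auto
    then show "m * min 1 (min s 1) < val 1 1 0 s 1"
      using big[OF e(1)] e(2) by (simp add: val_def s_def)
  qed (use s in auto)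
  then show False
  proof (cases rule: exc_cases)
    case (4 p)
    have c0: "c = 0 \<or> a = 0 \<and> b = 1 \<and> c = 1" if "tight A a b c s 1" for a b c
      using loneD[OF 4 that] loneD[OF 4 tyz] by auto
    have a0: "a0 = e" "c0 = 0"
      using c0[OF te] e(2) by auto
    \<comment> \<open>The functional \<open>b - c\<close> vanishes at \<open>(0, 1, 1)\<close> and
      \<open>(e, 0, 0)\<close> and is nonnegative on the base, where \<open>c = 0\<close>.\<close>
    have "0 \<le> (real b - real 1) * 1 + (real c - real 1) * (- 1)" if "tight A a b c s 1" for a b c
      using c0[OF that] by auto
    with tyz _ _ show False
    proof (rule nudge)
      fix s' t' :: real
      assume pos: "0 < s'" "0 < t'" and tt: "\<And>a' b' c'. tight A a' b' c' s' t' =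
          (tight A a' b' c' s 1 \<and> (real b' - real 1) * 1 + (real c' - real 1) * - 1 = 0)"
      have "x = e \<and> y = 0 \<and> z = 0 \<or> x = 0 \<and> y = 1 \<and> z = 1" if "tight A x y z s' t'" for x y z
      proof -
        have h: "tight A x y z s 1" "y = z"
          using that unfolding tt by auto
        then show ?thesis
          using c0[OF h(1)] tight_eq[OF h(1) te] a0 by (auto simp: val_def)
      qed
      then have "only2 A s' t' e 0 0 0 1 1"
        unfolding only2_def using te tyz a0 by (auto simp: tt)
      then show False
        using no1 pos by blast
    qed (use s in auto)
  next
    case (5 p)
    have a0: "a = 0 \<or> a = 1 \<and> b = 1 \<and> c = 0" if "tight A a b c s 1" for a b c
      using loneD[OF 5 that] loneD[OF 5 txy] by auto
    have c0: "c0 = e" "a0 = 0"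
      using a0[OF te] e(2) by auto
    \<comment> \<open>The functional \<open>b * e + c\<close> takes the same value \<open>e\<close>
      at \<open>(1, 1, 0)\<close> and \<open>(0, 0, e)\<close>; all other tight exponents exceed
      it.\<close>
    have rate: "b = 0 \<and> c = e \<or> a = 1 \<and> b = 1 \<and> c = 0 \<or> 0 < (real b - real 1) * real e + (real c - real 0) * 1"
      if h: "tight A a b c s 1" for a b c
    proof (cases "a = 0")
      case True
      have eq: "real b * s + real c = real e"
        using tight_eq[OF h te] c0 True by (simp add: val_def)
      show ?thesis
      proof (cases "b = 0")
        case True
        then show ?thesis
          using eq by simp
      next
        case False
        then have nn: "0 \<le> (real b - 1) * real e"
          by simp
        have "c \<noteq> 0 \<or> 2 \<le> b"
          using deg[OF tight_A[OF h]] \<open>a = 0\<close> by auto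
        then have "0 < (real b - 1) * real e \<or> 0 < real c"
          using e2 by auto
        moreover have "0 \<le> real c"
          by simp
        ultimately have "0 < (real b - 1) * real e + real c"
          using nn by linarith
        then show ?thesis
          by simp
      qed
    qed (use a0[OF h] in auto)
    have "0 \<le> (real b - real 1) * real e + (real c - real 0) * 1" if "tight A a b c s 1" for a b c
      using rate[OF that] by auto
    with txy _ _ show False
    proof (rule nudge)
      fix s' t' :: real
      assume pos: "0 < s'" "0 < t'" and tt: "\<And>a' b' c'. tight A a' b' c' s' t' =
          (tight A a' b' c' s 1 \<and> (real b' - real 1) * real e + (real c' - real 0) * 1 = 0)"
      have "x = 0 \<and> y = 0 \<and> z = e \<or> x = 1 \<and> y = 1 \<and> z = 0" if "tight A x y z s' t'" for x y z
      proof -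
        have h: "tight A x y z s 1" "(real y - real 1) * real e + (real z - real 0) * 1 = 0"
          using that unfolding tt by auto
        then show ?thesis
          using rate[OF h(1)] a0[OF h(1)] by auto
      qed
      then have "only2 A s' t' 0 0 e 1 1 0"
        unfolding only2_def using te txy c0 by (auto simp: tt)
      then show False
        using no3 pos by blast
    qed (use s in auto)
  next
    case 1
    then show False
      using loneD[OF 1 tyz] by simp
  next
    case 2
    then show False
      using loneD[OF 2 txy] by simp
  next
    case 3
    then show False
      using loneD[OF 3 tyz] by simp
  next
    case 6
    then show False
      using loneD[OF 6 txy] by simp
  qed
qed

text \<open>For \<open>q\<close> at least 2 the two ways of failing, \<open>q + 1 > m\<close> and a
  competitor in the second derivative, are covered by \<open>corner_of_steep\<close> and
  \<open>corner_of_undominated\<close>. For \<open>q = 1\<close> the only conceivable competitor is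
  \<open>(0, 1, 1)\<close> with \<open>v = 1\<close>, excluded by
  \<open>not_two_mixed_quadratics\<close>.\<close>

lemma dominated_or_corner:
  assumes w: "tight A q 1 0 s t" and pos: "0 < s" "0 < t" and m2: "2 \<le> m"
    and uv: "1 \<le> u" "1 \<le> v" and big: "\<And>a b c. A a b c \<Longrightarrow> m < val a b c u v"
  shows "real q + 1 \<le> m \<and>
      (\<forall>a b c. A a b c \<and> 1 \<le> b \<and> \<not> (a = q \<and> b = 1 \<and> c = 0) \<longrightarrow> val q 1 0 u v < val a b c u v)
    \<or> corner A \<and> (\<exists>r s t. 0 < s \<and> 0 < t \<and> tight A r 0 1 s t)"
proof (cases "2 \<le> q")
  case True
  show ?thesis
  proof (cases "m < real q + 1")
    case True
    then show ?thesis
      using corner_of_steep[OF w \<open>2 \<le> q\<close> _ pos] by blast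
  next
    case False
    have "corner A \<and> (\<exists>r s t. 0 < s \<and> 0 < t \<and> tight A r 0 1 s t)"
      if "A a b c" "1 \<le> b" "\<not> (a = q \<and> b = 1 \<and> c = 0)" "\<not> val q 1 0 u v < val a b c u v" for a b c
      by (rule corner_of_undominated[OF w \<open>2 \<le> q\<close> pos _ _ big that(1-3)]) (use uv that(4) in auto)
    then show ?thesis
      using False by (meson not_less)
  qed
next
  case False
  then have q1: "q = 1"
    using deg[OF tight_A[OF w]] by simp
  have u1: "1 < u"
    using big[OF tight_A[OF w]] q1 m2 by (simp add: val_def)
  have "val q 1 0 u v < val a b c u v" if k: "A a b c" "1 \<le> b" "\<not> (a = q \<and> b = 1 \<and> c = 0)" for a b c
  proof (rule ccontr)
    assume "\<not> val q 1 0 u v < val a b c u v"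
    then have le: "real a + real b * u + real c * v \<le> 1 + u"
      using q1 by (simp add: val_def)
    have cv: "real c \<le> real c * v"
      using mult_left_mono[OF uv(2), of "real c"] by simp
    have "b = 1"
    proof (rule ccontr)
      assume "b \<noteq> 1"
      then have "2 * u \<le> real b * u"
        using k(2) uv by (intro mult_right_mono) auto
      then show False
        using le u1 cv by linarith
    qed
    then have ac: "real a + real c * v \<le> 1"
      using le by simp
    then have "a + c \<le> 1"
      using cv by linarith
    moreover have "1 \<le> a + c"
      using deg[OF k(1)] \<open>b = 1\<close> by simp
    ultimately have c1: "c = 1" "a = 0"
      using k(3) q1 \<open>b = 1\<close> by auto
    have v1: "v = 1"
      using ac c1 uv by simp
    show False
    proof (rule not_two_mixed_quadratics)
      show "A 1 1 0" "A 0 1 1"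
        using tight_A[OF w] k(1) q1 c1 \<open>b = 1\<close> by simp_all
      show "m < real a + real c" if "A a 0 c" for a c
        using big[OF that] v1 by (simp add: val_def)
    qed
  qed
  then show ?thesis
    using q1 m2 by auto
qed

end

text \<open>A corner comes with a tight exponent near the first axis in the other coordinate plane.
  So failure in one orientation triggers the mirrored argument, and both corners would
  exist.\<close>

lemma (in bad_support) dominating_monomial:
  assumes m2: "2 \<le> m" and uv: "1 \<le> u" "1 \<le> v" and big: "\<And>a b c. A a b c \<Longrightarrow> m < val a b c u v"
  shows "\<exists>q. real q + 1 \<le> m \<and>
     (A q 1 0 \<and> (\<forall>a b c. A a b c \<and> 1 \<le> b \<and> \<not> (a = q \<and> b = 1 \<and> c = 0) \<longrightarrow> val q 1 0 u v < val a b c u v) \<or>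
      A q 0 1 \<and> (\<forall>a b c. A a b c \<and> 1 \<le> c \<and> \<not> (a = q \<and> b = 0 \<and> c = 1) \<longrightarrow> val q 0 1 u v < val a b c u v))"
    (is "\<exists>q. real q + 1 \<le> m \<and> (?P2 q \<or> ?P3 q)")
proof (rule ccontr)
  assume no: "\<not> ?thesis"
  interpret f: bad_support "flip A" m
    by (rule bad_support_flip) (rule bad_support_axioms)
  have step2: "corner A \<and> (\<exists>r s t. 0 < s \<and> 0 < t \<and> tight A r 0 1 s t)"
    if h: "tight A q 1 0 s t" "0 < s" "0 < t" for q s t
    using dominated_or_corner[OF h m2 uv big] no tight_A[OF h(1)] by blast
  have step3: "corner (flip A) \<and> (\<exists>r s t. 0 < s \<and> 0 < t \<and> tight A r 1 0 s t)"
    if h: "tight A q 0 1 s t" "0 < s" "0 < t" for q s t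
  proof -
    have h': "tight (flip A) q 1 0 t s"
      using h by (simp add: tight_swap)
    have big': "m < val a b c v u" if "flip A a b c" for a b c
      using big[of a c b] that by (simp add: flip_def val_flip)
    from f.dominated_or_corner[OF h' h(3,2) m2 uv(2,1) big'] show ?thesis
    proof
      assume d: "real q + 1 \<le> m \<and> (\<forall>a b c. flip A a b c \<and> 1 \<le> b \<and> \<not> (a = q \<and> b = 1 \<and> c = 0) \<longrightarrow>
          val q 1 0 v u < val a b c v u)"
      have P3: "?P3 q"
      proof (intro conjI allI impI tight_A[OF h(1)])
        fix a b c assume "A a b c \<and> 1 \<le> c \<and> \<not> (a = q \<and> b = 0 \<and> c = 1)"
        then have "val q 1 0 v u < val a c b v u"
          using d unfolding flip_def by blast
        then show "val q 0 1 u v < val a b c u v"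
          by (simp only: val_flip[of q 1 0 v u] val_flip[of a c b v u])
      qed
      have "\<exists>q. real q + 1 \<le> m \<and> (?P2 q \<or> ?P3 q)"
        by (rule exI[of _ q]) (rule conjI[OF conjunct1[OF d] disjI2[OF P3]])
      then show ?thesis
        using no by (rule notE[rotated])
    qed (auto simp: tight_swap)
  qed
  have "corner A \<and> corner (flip A)"
    using boundary_monomial step2 step3 by blast
  then show False
    using not_both_corners by blast
qed

text \<open>For \<open>m = 0\<close> the hypothesis \<open>m < q + 1\<close> of
  \<open>corner_of_steep\<close> always holds. Without the two quadratic monomials every tight
  \<open>(q, 1, 0)\<close> or \<open>(q, 0, 1)\<close> has \<open>q\<close> at least 2, and again
  both corners would exist.\<close>

lemma (in bad_support) mixed_quadratic:
  assumes "m = 0"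
  shows "A 1 1 0 \<or> A 1 0 1"
proof (rule ccontr)
  assume no: "\<not> ?thesis"
  interpret f: bad_support "flip A" m
    by (rule bad_support_flip) (rule bad_support_axioms)
  have step2: "corner A \<and> (\<exists>r s t. 0 < s \<and> 0 < t \<and> tight A r 0 1 s t)"
    if h: "tight A q 1 0 s t" "0 < s" "0 < t" for q s t
  proof (rule corner_of_steep[OF h(1) _ _ h(2,3)])
    have "q \<noteq> 1"
      using tight_A[OF h(1)] no by auto
    then show "2 \<le> q"
      using deg[OF tight_A[OF h(1)]] by simp
  qed (use assms in simp)
  have step3: "corner (flip A) \<and> (\<exists>r s t. 0 < s \<and> 0 < t \<and> tight A r 1 0 s t)"
    if h: "tight A q 0 1 s t" "0 < s" "0 < t" for q s t
  proof -
    have "corner (flip A) \<and> (\<exists>r s t. 0 < s \<and> 0 < t \<and> tight (flip A) r 0 1 s t)"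
    proof (rule f.corner_of_steep[OF _ _ _ h(3,2)])
      show "tight (flip A) q 1 0 t s"
        using h by (simp add: tight_swap)
      have "q \<noteq> 1"
        using tight_A[OF h(1)] no by auto
      then show "2 \<le> q"
        using deg[OF tight_A[OF h(1)]] by simp
    qed (use assms in simp)
    then show ?thesis
      by (auto simp: tight_swap)
  qed
  have "corner A \<and> corner (flip A)"
    using boundary_monomial step2 step3 by blast
  then show False
    using not_both_corners by blast
qed

text \<open>The combinatorial reason why an edge \<open>I_1^k\<close> makes all faces exceptional. A
  tight exponent involving both last variables is \<open>(0, 1, 1)\<close>. If there were further
  ones outside \<open>b = 0\<close> and outside \<open>c = 0\<close>, comparison with the ends of
  the edge would give \<open>s' < s\<close> and \<open>t' < t\<close>, then \<open>(0, 2, 0)\<close>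
  and \<open>(0, 0, 2)\<close>; but these cannot both lie strictly above the edge at
  \<open>(s, t)\<close>.\<close>

lemma tight_of_only2:
  assumes only: "only2 A s t k 0 0 0 1 1" and pos: "0 < s" "0 < t" "0 < s'" "0 < t'"
  shows "(\<forall>a b c. tight A a b c s' t' \<longrightarrow> a = 0 \<and> b = 1 \<and> c = 1 \<or> b = 0) \<or>
    (\<forall>a b c. tight A a b c s' t' \<longrightarrow> a = 0 \<and> b = 1 \<and> c = 1 \<or> c = 0)"
proof (rule ccontr)
  assume no: "\<not> ?thesis"
  have tk: "tight A k 0 0 s t" and tyz: "tight A 0 1 1 s t"
    using only by (auto simp: only2_def)
  have k: "real k = s + t"
    using tight_eq[OF tk tyz] by (simp add: val_def)
  have gt: "s + t < real a + real b * s + real c * t"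
    if "A a b c" "\<not> (a = k \<and> b = 0 \<and> c = 0)" "\<not> (a = 0 \<and> b = 1 \<and> c = 1)" for a b c
  proof -
    have "\<not> tight A a b c s t"
      using only that unfolding only2_def by blast
    then show ?thesis
      using tight_transfer[OF tyz that(1)] by (force simp: val_def)
  qed
  have le: "real a + real b * s' + real c * t' \<le> s' + t'" "real a + real b * s' + real c * t' \<le> s + t"
    if "tight A a b c s' t'" for a b c
    using tightD[OF that tight_A[OF tyz]] tightD[OF that tight_A[OF tk]] k by (simp_all add: val_def)
  have mixed: "a = 0 \<and> b = 1 \<and> c = 1" if "tight A a b c s' t'" "1 \<le> b" "1 \<le> c" for a b c
  proof -
    have "real a + (real b - 1) * s' + (real c - 1) * t' \<le> 0"
      using le(1)[OF that(1)] by (simp add: algebra_simps)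
    moreover have "0 \<le> (real b - 1) * s'" "0 \<le> (real c - 1) * t'"
      using that pos by auto
    ultimately have "real a = 0" "(real b - 1) * s' = 0" "(real c - 1) * t' = 0"
      by linarith+
    then show ?thesis
      using pos by auto
  qed
  obtain a b c1 where b: "tight A a b c1 s' t'" "b \<noteq> 0" "\<not> (a = 0 \<and> b = 1 \<and> c1 = 1)"
    using no by blast
  obtain a' b1 c where c: "tight A a' b1 c s' t'" "c \<noteq> 0" "\<not> (a' = 0 \<and> b1 = 1 \<and> c = 1)"
    using no by blast
  have z: "c1 = 0" "b1 = 0"
    using mixed[OF b(1)] mixed[OF c(1)] b c by (metis One_nat_def Suc_leI neq0_conv)+
  have bgt: "s + t < real a + real b * s" and cgt: "s + t < real a' + real c * t"
    using gt[OF tight_A[OF b(1)] _ b(3)] gt[OF tight_A[OF c(1)] _ c(3)] b(2) c(2) z by simp_all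
  have ble: "real a + real b * s' \<le> s' + t'" "real a + real b * s' \<le> s + t"
    and cle: "real a' + real c * t' \<le> s' + t'" "real a' + real c * t' \<le> s + t"
    using le[OF b(1)] le[OF c(1)] z by auto
  have "real b * s' < real b * s" "real c * t' < real c * t"
    using bgt ble cgt cle by linarith+
  then have st: "s' < s" "t' < t"
    using b c by simp_all
  have "b \<noteq> 1" "c \<noteq> 1"
    using bgt ble cgt cle st by auto
  then have bc: "2 \<le> b" "2 \<le> c"
    using b c by simp_all
  have m1: "2 * s' \<le> real b * s'" "2 * t' \<le> real c * t'"
    using bc pos by (auto intro!: mult_right_mono)
  have eq: "real a = 0" "real b * s' = 2 * s'" "real a' = 0" "real c * t' = 2 * t'"
    using m1 ble cle by linarith+
  then have "b = 2" "c = 2"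
    using pos by auto
  then show False
    using bgt cgt eq by simp
qed

section \<open>Newton diagrams and minimal exponents\<close>

lemma incseq_subsequence_nat:
  fixes f :: "nat \<Rightarrow> nat"
  obtains g where "strict_mono g" "incseq (\<lambda>n. f (g n))"
proof -
  obtain g where g: "strict_mono g" "monoseq (\<lambda>n. f (g n))"
    using seq_monosub[of f] by blast
  show ?thesis
  proof (cases "incseq (\<lambda>n. f (g n))")
    case True
    then show ?thesis
      using that g by blast
  next
    case False
    then have dec: "\<And>m n. m \<le> n \<Longrightarrow> f (g n) \<le> f (g m)"
      using g(2) by (auto simp: monoseq_def incseq_def)
    obtain N where N: "\<And>n. f (g N) \<le> f (g n)"
      using ex_has_least_nat[of "\<lambda>_. True" 0 "\<lambda>n. f (g n)"] by auto
    have "f (g (n + N)) = f (g N)" for n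
      using N dec[of N "n + N"] by (simp add: order.antisym)
    moreover have "strict_mono (\<lambda>n. g (n + N))"
      using g(1) by (simp add: strict_mono_def)
    ultimately show ?thesis
      using that[of "\<lambda>n. g (n + N)"] by (simp add: incseq_def)
  qed
qed

text \<open>The minimal elements will do. If there were infinitely many, a sequence of them, thinned
  out coordinate by coordinate to be nondecreasing, would contain two comparable ones.\<close>

lemma dickson:
  fixes S :: "(nat ^ 'n::finite) set"
  obtains M where "finite M" "M \<subseteq> S" "\<And>\<nu>. \<nu> \<in> S \<Longrightarrow> \<exists>\<mu>\<in>M. \<mu> \<le> \<nu>"
proof
  define M where "M = {\<mu> \<in> S. \<forall>\<nu>\<in>S. \<nu> \<le> \<mu> \<longrightarrow> \<nu> = \<mu>}"
  show "M \<subseteq> S"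
    by (auto simp: M_def)
  show "\<exists>\<mu>\<in>M. \<mu> \<le> \<nu>" if \<nu>S: "\<nu> \<in> S" for \<nu>
  proof -
    define size where "size \<mu> = (\<Sum>i\<in>UNIV. \<mu> $ i)" for \<mu> :: "nat ^ 'n"
    obtain \<mu> where \<mu>: "\<mu> \<in> S" "\<mu> \<le> \<nu>" "\<And>\<kappa>. \<kappa> \<in> S \<and> \<kappa> \<le> \<nu> \<Longrightarrow> size \<mu> \<le> size \<kappa>"
      using ex_has_least_nat[of "\<lambda>\<mu>. \<mu> \<in> S \<and> \<mu> \<le> \<nu>" \<nu> size] \<nu>S by auto
    have "\<kappa> = \<mu>" if "\<kappa> \<in> S" "\<kappa> \<le> \<mu>" for \<kappa>
    proof -
      have le: "\<And>i. \<kappa> $ i \<le> \<mu> $ i"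
        using that by (simp add: less_eq_vec_def)
      have "size \<mu> \<le> size \<kappa>"
        using \<mu>(2) that by (intro \<mu>(3)) auto
      moreover have "size \<kappa> \<le> size \<mu>"
        unfolding size_def by (intro sum_mono le)
      ultimately have "(\<Sum>i\<in>UNIV. \<mu> $ i - \<kappa> $ i) = 0"
        unfolding size_def by (subst sum_subtractf_nat) (use le in auto)
      then show ?thesis
        using le by (auto simp: vec_eq_iff intro: order.antisym)
    qed
    then show ?thesis
      using \<mu> by (auto simp: M_def)
  qed
  show "finite M"
  proof (rule ccontr)
    assume "infinite M"
    then obtain s :: "nat \<Rightarrow> nat ^ 'n" where s: "inj s" "range s \<subseteq> M"
      using infinite_countable_subset by blast
    have "\<exists>g. strict_mono g \<and> (\<forall>i\<in>I. incseq (\<lambda>n. s (g n) $ i))" if "finite I" for I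
      using that
    proof (induction I)
      case empty
      then show ?case
        using strict_mono_id by auto
    next
      case (insert i I)
      then obtain g where g: "strict_mono g" "\<forall>i\<in>I. incseq (\<lambda>n. s (g n) $ i)"
        by blast
      obtain h where h: "strict_mono h" "incseq (\<lambda>n. s (g (h n)) $ i)"
        by (rule incseq_subsequence_nat[of "\<lambda>n. s (g n) $ i"])
      have "strict_mono (\<lambda>n. g (h n))"
        using g h by (simp add: strict_mono_def)
      moreover have "incseq (\<lambda>n. s (g (h n)) $ j)" if "j \<in> I" for j
        using g(2) that strict_mono_mono[OF h(1)] by (auto simp: incseq_def mono_def)
      ultimately show ?case
        using h(2) by blast
    qed
    from this[of UNIV] obtain g where g: "strict_mono g" "\<And>i. incseq (\<lambda>n. s (g n) $ i)"
      by auto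
    have "s (g 0) \<le> s (g 1)"
      using g(2) by (simp add: less_eq_vec_def incseq_def)
    moreover have "s (g 0) \<in> M" "s (g 1) \<in> M"
      using s by auto
    ultimately have "s (g 0) = s (g 1)"
      by (auto simp: M_def)
    then show False
      using s(1) strict_monoD[OF g(1), of 0 1] by (auto dest!: injD)
  qed
qed

definition supp :: "(nat ^ 'n::finite \<Rightarrow> complex) \<Rightarrow> (nat ^ 'n) set" where
  "supp a = {\<nu>. a \<nu> \<noteq> 0}"

definition weight :: "real ^ 'n::finite \<Rightarrow> nat ^ 'n \<Rightarrow> real" where
  "weight u \<nu> = u \<bullet> exponent_point \<nu>"

text \<open>Keeps only the exponents on a face, which is itself a convex set of real points;
  \<open>compact_face_iff\<close> recovers the compact faces as hulls.\<close>

definition argmins :: "(nat ^ 'n::finite) set \<Rightarrow> real ^ 'n \<Rightarrow> (nat ^ 'n) set" where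
  "argmins S u = {\<nu> \<in> S. \<forall>\<mu>\<in>S. weight u \<nu> \<le> weight u \<mu>}"

lemma weight_sum: "weight u \<nu> = (\<Sum>i\<in>UNIV. u $ i * real (\<nu> $ i))"
  by (simp add: weight_def exponent_point_def inner_vec_def)

lemma weight_mono: "\<mu> \<le> \<nu> \<Longrightarrow> u \<in> nonneg_orthant \<Longrightarrow> weight u \<mu> \<le> weight u \<nu>"
  unfolding weight_sum nonneg_orthant_def less_eq_vec_def by (intro sum_mono mult_left_mono) auto

lemma weight_strict_mono:
  assumes "\<mu> \<le> \<nu>" "\<mu> \<noteq> \<nu>" "\<And>i. 0 < u $ i"
  shows "weight u \<mu> < weight u \<nu>"
proof -
  obtain i where i: "\<mu> $ i < \<nu> $ i"
    using assms(1,2) by (force simp: vec_eq_iff less_eq_vec_def not_less intro: order.antisym)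
  show ?thesis
    unfolding weight_sum
  proof (rule sum_strict_mono_ex1)
    show "\<forall>i\<in>UNIV. u $ i * real (\<mu> $ i) \<le> u $ i * real (\<nu> $ i)"
      using assms(1) less_imp_le[OF assms(3)] by (auto simp: less_eq_vec_def intro!: mult_left_mono)
    show "\<exists>i\<in>UNIV. u $ i * real (\<mu> $ i) < u $ i * real (\<nu> $ i)"
      using i assms(3)[of i] by (intro bexI[of _ i]) auto
  qed simp
qed

lemma exists_min_coordinate:
  fixes u :: "'a::linorder ^ 'n::finite"
  obtains i where "\<And>l. u $ i \<le> u $ l"
proof -
  have "Min (range (\<lambda>l. u $ l)) \<in> range (\<lambda>l. u $ l)"
    by (rule Min_in) auto
  then obtain i where "Min (range (\<lambda>l. u $ l)) = u $ i"
    by blast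
  then show ?thesis
    using that[of i] Min_le[of "range (\<lambda>l. u $ l)"] by auto
qed

lemma argmins_eq: "\<nu> \<in> argmins S u \<Longrightarrow> \<mu> \<in> argmins S u \<Longrightarrow> weight u \<nu> = weight u \<mu>"
  by (auto simp: argmins_def intro: order.antisym)

text \<open>The support may be infinite, but its minimum is already attained on a finite Dickson
  set.\<close>

lemma argmins_nonempty:
  assumes "S \<noteq> {}" "u \<in> nonneg_orthant"
  shows "argmins S u \<noteq> {}"
proof -
  obtain M where M: "finite M" "M \<subseteq> S" "\<And>\<nu>. \<nu> \<in> S \<Longrightarrow> \<exists>\<mu>\<in>M. \<mu> \<le> \<nu>"
    by (rule dickson[of S]) blast
  have "M \<noteq> {}"
    using M(3) assms(1) by blast
  then obtain \<mu> where \<mu>: "\<mu> \<in> M" "\<And>\<kappa>. \<kappa> \<in> M \<Longrightarrow> weight u \<mu> \<le> weight u \<kappa>"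
    using ex_min_if_finite[of "weight u ` M"] M(1) by (auto simp: not_less)
  have "weight u \<mu> \<le> weight u \<nu>" if "\<nu> \<in> S" for \<nu>
    using M(3)[OF that] \<mu>(2) weight_mono[OF _ assms(2)] order.trans by blast
  then show ?thesis
    using \<mu>(1) M(2) by (auto simp: argmins_def)
qed

lemma argmins_subset:
  assumes "M \<subseteq> S" "\<And>\<nu>. \<nu> \<in> S \<Longrightarrow> \<exists>\<mu>\<in>M. \<mu> \<le> \<nu>" "\<And>i. 0 < u $ i"
  shows "argmins S u \<subseteq> M"
proof
  fix \<nu> assume \<nu>: "\<nu> \<in> argmins S u"
  then obtain \<mu> where \<mu>: "\<mu> \<in> M" "\<mu> \<le> \<nu>"
    using assms(2) by (auto simp: argmins_def)
  have "\<mu> = \<nu>"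
    using weight_strict_mono[OF \<mu>(2) _ assms(3)] \<nu> \<mu> assms(1) by (force simp: argmins_def)
  then show "\<nu> \<in> M"
    using \<mu> by simp
qed

lemma finite_argmins:
  assumes "\<And>i. 0 < u $ i"
  shows "finite (argmins S u)"
proof -
  obtain M where M: "finite M" "M \<subseteq> S" "\<And>\<nu>. \<nu> \<in> S \<Longrightarrow> \<exists>\<mu>\<in>M. \<mu> \<le> \<nu>"
    by (rule dickson[of S]) blast
  show ?thesis
    using argmins_subset[OF M(2,3) assms] M(1) finite_subset by blast
qed

lemma exponent_point_inject [simp]: "exponent_point \<nu> = exponent_point \<mu> \<longleftrightarrow> \<nu> = \<mu>"
  by (simp add: exponent_point_def vec_eq_iff)

lemma exponent_point_nth [simp]: "exponent_point \<nu> $ i = real (\<nu> $ i)"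
  by (simp add: exponent_point_def)

lemma exponent_in_newton_diagram: "\<nu> \<in> supp a \<Longrightarrow> exponent_point \<nu> \<in> newton_diagram a"
  unfolding newton_diagram_def
  by (rule hull_inc) (force simp: supp_def nonneg_orthant_def)

lemma newton_diagram_translate:
  fixes a :: "nat ^ 'n::finite \<Rightarrow> complex"
  assumes "x \<in> newton_diagram a" "w \<in> nonneg_orthant"
  shows "x + w \<in> newton_diagram a"
proof -
  let ?X = "\<Union>\<nu>\<in>{\<nu>. a \<nu> \<noteq> 0}. (\<lambda>w. exponent_point \<nu> + w) ` nonneg_orthant"
  have "(\<lambda>x. x + w) ` (convex hull ?X) = convex hull ((\<lambda>x. x + w) ` ?X)"
    using convex_hull_translation[of w ?X] by (simp add: add.commute[of _ w])
  also have "\<dots> \<subseteq> convex hull ?X"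
  proof (rule hull_mono, safe)
    fix \<nu> and v :: "real ^ 'n" assume "a \<nu> \<noteq> 0" "v \<in> nonneg_orthant"
    moreover from this assms(2) have "v + w \<in> nonneg_orthant"
      by (simp add: nonneg_orthant_def)
    ultimately show "exponent_point \<nu> + v + w \<in> ?X"
      by (force simp: add.assoc)
  qed
  finally show ?thesis
    using assms(1) unfolding newton_diagram_def by blast
qed

lemma newton_diagram_lower_bound:
  fixes a :: "nat ^ 'n::finite \<Rightarrow> complex"
  assumes "x \<in> newton_diagram a" "u \<in> nonneg_orthant" "\<And>\<nu>. \<nu> \<in> supp a \<Longrightarrow> l \<le> weight u \<nu>"
  shows "l \<le> u \<bullet> x"
proof -
  have "newton_diagram a \<subseteq> {x. l \<le> u \<bullet> x}"
    unfolding newton_diagram_def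
  proof (rule hull_minimal)
    show "convex {x. l \<le> u \<bullet> x}"
      using convex_halfspace_ge[of l u] by simp
    show "(\<Union>\<nu>\<in>{\<nu>. a \<nu> \<noteq> 0}. (\<lambda>w. exponent_point \<nu> + w) ` nonneg_orthant) \<subseteq> {x. l \<le> u \<bullet> x}"
    proof safe
      fix \<nu> and w :: "real ^ 'n" assume "a \<nu> \<noteq> 0" "w \<in> nonneg_orthant"
      then have "l \<le> weight u \<nu>" "0 \<le> u \<bullet> w"
        using assms(2,3) by (auto simp: supp_def nonneg_orthant_def inner_vec_def intro!: sum_nonneg)
      then show "l \<le> u \<bullet> (exponent_point \<nu> + w)"
        by (simp add: inner_add_right weight_def)
    qed
  qed
  then show ?thesis
    using assms(1) by blast
qed

lemma support_value_eq:
  assumes "u \<in> nonneg_orthant" "\<nu> \<in> argmins (supp a) u"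
  shows "support_value u (newton_diagram a) = weight u \<nu>"
  unfolding support_value_def
proof (rule cInf_eq_minimum)
  show "weight u \<nu> \<in> {u \<bullet> v |v. v \<in> newton_diagram a}"
    using exponent_in_newton_diagram[of \<nu> a] assms(2) by (auto simp: argmins_def weight_def)
  show "weight u \<nu> \<le> y" if y: "y \<in> {u \<bullet> v |v. v \<in> newton_diagram a}" for y
  proof -
    obtain v where "v \<in> newton_diagram a" "y = u \<bullet> v"
      using y by blast
    then show ?thesis
      using newton_diagram_lower_bound[OF _ assms(1), of v a "weight u \<nu>"] assms(2)
      by (auto simp: argmins_def)
  qed
qed

text \<open>The set of points that either lie strictly above the supporting hyperplane or lie in the
  convex hull of the minimal exponents is convex.\<close>
lemma face_in_direction_eq_hull:
  fixes a :: "nat ^ 'n::finite \<Rightarrow> complex"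
  assumes pos: "\<And>i. 0 < u $ i" and ne: "supp a \<noteq> {}"
  shows "face_in_direction u (newton_diagram a) = convex hull (exponent_point ` argmins (supp a) u)"
proof -
  let ?H = "convex hull (exponent_point ` argmins (supp a) u)"
  have u: "u \<in> nonneg_orthant"
    using pos by (simp add: nonneg_orthant_def less_imp_le)
  obtain \<nu>0 where \<nu>0: "\<nu>0 \<in> argmins (supp a) u"
    using argmins_nonempty[OF ne u] by blast
  define l where "l = weight u \<nu>0"
  have l: "support_value u (newton_diagram a) = l"
    using support_value_eq[OF u \<nu>0] by (simp add: l_def)
  have H: "u \<bullet> x = l" if "x \<in> ?H" for x
  proof -
    have "?H \<subseteq> {x. u \<bullet> x = l}"
      using \<nu>0 by (intro hull_minimal convex_hyperplane) (auto simp: l_def weight_def[symmetric] dest: argmins_eq)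
    then show ?thesis
      using that by blast
  qed
  define C where "C = {x. l \<le> u \<bullet> x \<and> (u \<bullet> x = l \<longrightarrow> x \<in> ?H)}"
  have "convex C"
  proof (rule convexI)
    fix x y and \<alpha> \<beta> :: real assume xy: "x \<in> C" "y \<in> C" and ab: "0 \<le> \<alpha>" "0 \<le> \<beta>" "\<alpha> + \<beta> = 1"
    have val: "u \<bullet> (\<alpha> *\<^sub>R x + \<beta> *\<^sub>R y) = l + \<alpha> * (u \<bullet> x - l) + \<beta> * (u \<bullet> y - l)"
      using ab(3) by (simp add: inner_add_right algebra_simps) (metis distrib_right mult_1_left)
    have nn: "0 \<le> \<alpha> * (u \<bullet> x - l)" "0 \<le> \<beta> * (u \<bullet> y - l)"
      using xy ab by (auto simp: C_def)
    have "\<alpha> *\<^sub>R x + \<beta> *\<^sub>R y \<in> ?H" if "u \<bullet> (\<alpha> *\<^sub>R x + \<beta> *\<^sub>R y) = l"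
    proof -
      have z: "\<alpha> * (u \<bullet> x - l) = 0" "\<beta> * (u \<bullet> y - l) = 0"
        using nn val that by linarith+
      show ?thesis
      proof (cases "\<alpha> = 0 \<or> \<beta> = 0")
        case True
        then show ?thesis
          using z ab xy by (auto simp: C_def)
      next
        case False
        then have "x \<in> ?H" "y \<in> ?H"
          using z xy by (auto simp: C_def)
        then show ?thesis
          using convexD[OF convex_convex_hull _ _ ab] by blast
      qed
    qed
    then show "\<alpha> *\<^sub>R x + \<beta> *\<^sub>R y \<in> C"
      using nn val by (simp add: C_def)
  qed
  moreover have "exponent_point \<nu> + w \<in> C" if \<nu>: "a \<nu> \<noteq> 0" and w: "w \<in> nonneg_orthant" for \<nu> and w :: "real ^ 'n"
  proof -
    have lw: "l \<le> weight u \<nu>"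
      using \<nu>0 \<nu> by (simp add: l_def argmins_def supp_def)
    have uw: "0 \<le> u $ i * w $ i" for i
      using w pos[of i] by (auto simp: nonneg_orthant_def intro!: mult_nonneg_nonneg less_imp_le)
    then have "0 \<le> u \<bullet> w"
      by (auto simp: inner_vec_def intro!: sum_nonneg)
    moreover have "exponent_point \<nu> + w \<in> ?H" if "weight u \<nu> + u \<bullet> w = l"
    proof -
      have wt: "weight u \<nu> = l" "u \<bullet> w = 0"
        using that lw calculation by linarith+
      then have "\<forall>i\<in>UNIV. u $ i * w $ i = 0"
        using uw by (subst sum_nonneg_eq_0_iff[symmetric]) (auto simp: inner_vec_def)
      then have "w = 0"
        using pos by (simp add: vec_eq_iff less_imp_neq[symmetric])
      moreover have "\<nu> \<in> argmins (supp a) u"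
        using \<nu>0 \<nu> wt(1) by (simp add: argmins_def supp_def l_def)
      ultimately show ?thesis
        by (auto intro: hull_inc)
    qed
    ultimately show ?thesis
      using lw by (simp add: C_def inner_add_right weight_def)
  qed
  ultimately have "newton_diagram a \<subseteq> C"
    unfolding newton_diagram_def by (intro hull_minimal) auto
  then have "face_in_direction u (newton_diagram a) \<subseteq> ?H"
    by (auto simp: face_in_direction_def l C_def)
  moreover have "?H \<subseteq> newton_diagram a"
  proof (rule hull_minimal)
    show "convex (newton_diagram a)"
      by (simp add: newton_diagram_def)
  qed (auto simp: argmins_def exponent_in_newton_diagram)
  ultimately show ?thesis
    using H by (auto simp: face_in_direction_def l)
qed

text \<open>A zero entry of the normal vector would put a whole ray parallel to that axis into the
  face. Conversely, positive entries leave finitely many minimal exponents, and the hull of a finite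
  set is compact.\<close>

lemma compact_face_iff:
  assumes ne: "supp a \<noteq> {}"
  shows "S \<in> compact_faces a \<longleftrightarrow>
    (\<exists>u. (\<forall>i. 0 < u $ i) \<and> S = convex hull (exponent_point ` argmins (supp a) u))"
proof
  assume "S \<in> compact_faces a"
  then obtain u where u: "u \<in> nonneg_orthant" and S: "S = face_in_direction u (newton_diagram a)" "compact S"
    by (auto simp: compact_faces_def)
  have "0 < u $ i" for i
  proof (rule ccontr)
    assume "\<not> 0 < u $ i"
    then have ui: "u $ i = 0"
      using u by (simp add: nonneg_orthant_def order.antisym)
    obtain \<nu> where \<nu>: "\<nu> \<in> argmins (supp a) u"
      using argmins_nonempty[OF ne u] by blast
    have "exponent_point \<nu> + t *\<^sub>R axis i 1 \<in> S" if "0 \<le> t" for t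
    proof -
      have "exponent_point \<nu> + t *\<^sub>R axis i 1 \<in> newton_diagram a"
        using that \<nu> by (intro newton_diagram_translate exponent_in_newton_diagram)
          (auto simp: argmins_def nonneg_orthant_def axis_def)
      then show ?thesis
        unfolding S(1) face_in_direction_def support_value_eq[OF u \<nu>]
        using ui by (simp add: weight_def inner_add_right inner_axis)
    qed
    moreover obtain B where B: "\<And>x. x \<in> S \<Longrightarrow> norm x \<le> B"
      using compact_imp_bounded[OF S(2)] by (auto simp: bounded_iff)
    ultimately have *: "norm (exponent_point \<nu> + t *\<^sub>R axis i 1) \<le> B" if "0 \<le> t" for t
      using that by blast
    have "t \<le> B" if "0 \<le> t" for t
    proof -
      have "t \<le> \<bar>(exponent_point \<nu> + t *\<^sub>R axis i 1) $ i\<bar>"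
        using that by (simp add: axis_def)
      also have "\<dots> \<le> B"
        using order.trans[OF component_le_norm_cart *[OF that]] .
      finally show ?thesis .
    qed
    from this[of "\<bar>B\<bar> + 1"] show False
      by simp
  qed
  then show "\<exists>u. (\<forall>i. 0 < u $ i) \<and> S = convex hull (exponent_point ` argmins (supp a) u)"
    using S(1) face_in_direction_eq_hull[OF _ ne] by blast
next
  assume "\<exists>u. (\<forall>i. 0 < u $ i) \<and> S = convex hull (exponent_point ` argmins (supp a) u)"
  then obtain u where u: "\<And>i. 0 < u $ i" and S: "S = convex hull (exponent_point ` argmins (supp a) u)"
    by blast
  have "compact S"
    unfolding S by (intro finite_imp_compact_convex_hull finite_imageI finite_argmins u)
  moreover have "u \<noteq> 0"
    using u[of undefined] by auto
  then have "u \<in> nonneg_orthant - {0}"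
    using u by (auto simp: nonneg_orthant_def less_imp_le)
  ultimately show "S \<in> compact_faces a"
    using face_in_direction_eq_hull[OF u ne] S by (auto simp: compact_faces_def)
qed

text \<open>One Dickson set contains the minimal exponents for all positive weights at once, so only
  finitely many hulls arise. This makes the maximum in part (2) meaningful.\<close>

lemma finite_compact_faces:
  assumes "supp a \<noteq> {}"
  shows "finite (compact_faces a)"
proof -
  obtain M where M: "finite M" "M \<subseteq> supp a" "\<And>\<nu>. \<nu> \<in> supp a \<Longrightarrow> \<exists>\<mu>\<in>M. \<mu> \<le> \<nu>"
    by (rule dickson[of "supp a"]) blast
  have "compact_faces a \<subseteq> (\<lambda>X. convex hull (exponent_point ` X)) ` Pow M"
    using argmins_subset[OF M(2,3)] by (auto simp: compact_face_iff[OF assms])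
  then show ?thesis
    using M(1) finite_subset by blast
qed

lemma face_weight:
  assumes "x \<in> convex hull (exponent_point ` argmins S u)" "\<nu> \<in> argmins S u"
  shows "u \<bullet> x = weight u \<nu>"
proof -
  have "convex hull (exponent_point ` argmins S u) \<subseteq> {x. u \<bullet> x = weight u \<nu>}"
    using argmins_eq[OF _ assms(2)] by (intro hull_minimal convex_hyperplane) (auto simp: weight_def)
  then show ?thesis
    using assms(1) by blast
qed

text \<open>Relates the index set of \<open>face_part\<close>, all lattice points of the face, to
  \<open>argmins\<close>: lattice points beyond it have coefficient zero.\<close>

lemma argmins_face_iff:
  assumes "\<nu> \<in> S" "argmins S u \<noteq> {}"
  shows "exponent_point \<nu> \<in> convex hull (exponent_point ` argmins S u) \<longleftrightarrow> \<nu> \<in> argmins S u"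
proof
  assume h: "exponent_point \<nu> \<in> convex hull (exponent_point ` argmins S u)"
  obtain \<mu> where \<mu>: "\<mu> \<in> argmins S u"
    using assms(2) by blast
  show "\<nu> \<in> argmins S u"
    using face_weight[OF h \<mu>] \<mu> assms(1) by (simp add: argmins_def weight_def[symmetric])
qed (auto intro: hull_inc)

section \<open>Compact faces in three variables\<close>

lemma UNIV_three:
  fixes i j k :: 3
  assumes "i \<noteq> j" "i \<noteq> k" "j \<noteq> k"
  shows "UNIV = {i, j, k}"
proof (rule card_subset_eq[symmetric])
  show "card {i, j, k} = card (UNIV :: 3 set)"
    using assms by simp
qed auto

lemma exists_third:
  fixes i j :: 3
  assumes "i \<noteq> j"
  obtains k where "i \<noteq> k" "j \<noteq> k"
proof -
  have "{i, j} \<noteq> UNIV"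
  proof
    assume "{i, j} = UNIV"
    then have "card {i, j} = 3"
      by simp
    then show False
      using assms by simp
  qed
  then obtain k where "k \<notin> {i, j}"
    by blast
  then show ?thesis
    using that[of k] by auto
qed

lemma exists_other:
  fixes i :: 3
  obtains j where "i \<noteq> j"
  using that[of 1] that[of 2] by (cases "i = 1") auto

lemma sum_three:
  fixes i j k :: 3 and f :: "3 \<Rightarrow> 'a::comm_monoid_add"
  assumes "i \<noteq> j" "i \<noteq> k" "j \<noteq> k"
  shows "(\<Sum>l\<in>UNIV. f l) = f i + f j + f k"
  using assms by (simp add: UNIV_three[OF assms] add.assoc)

lemma weight_three:
  fixes i j k :: 3
  assumes "i \<noteq> j" "i \<noteq> k" "j \<noteq> k"
  shows "weight u \<nu> = u $ i * real (\<nu> $ i) + u $ j * real (\<nu> $ j) + u $ k * real (\<nu> $ k)"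
  unfolding weight_sum by (rule sum_three[OF assms])

lemma vec_eq_three:
  fixes x y :: "'a ^ 3" and i j k :: 3
  assumes "i \<noteq> j" "i \<noteq> k" "j \<noteq> k"
  shows "x = y \<longleftrightarrow> x $ i = y $ i \<and> x $ j = y $ j \<and> x $ k = y $ k"
proof -
  have "x = y \<longleftrightarrow> (\<forall>l\<in>UNIV. x $ l = y $ l)"
    by (simp add: vec_eq_iff)
  then show ?thesis
    by (simp add: UNIV_three[OF assms])
qed

text \<open>The third index is not named: whatever differs from \<open>i\<close> and
  \<open>j\<close> receives \<open>c\<close>. One chart lemma then serves all orderings of the
  coordinates.\<close>

definition vec3 :: "3 \<Rightarrow> 3 \<Rightarrow> 'a \<Rightarrow> 'a \<Rightarrow> 'a \<Rightarrow> 'a ^ 3" where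
  "vec3 i j a b c = (\<chi> l. if l = i then a else if l = j then b else c)"

definition triples :: "(nat ^ 3) set \<Rightarrow> 3 \<Rightarrow> 3 \<Rightarrow> nat \<Rightarrow> nat \<Rightarrow> nat \<Rightarrow> bool" where
  "triples S i j a b c \<longleftrightarrow> vec3 i j a b c \<in> S"

lemma vec3_nth:
  assumes "i \<noteq> j" "i \<noteq> k" "j \<noteq> k"
  shows "vec3 i j a b c $ i = a" "vec3 i j a b c $ j = b" "vec3 i j a b c $ k = c"
  using assms by (auto simp: vec3_def)

lemma vec3_collapse:
  assumes "i \<noteq> j" "i \<noteq> k" "j \<noteq> k"
  shows "vec3 i j (\<nu> $ i) (\<nu> $ j) (\<nu> $ k) = \<nu>"
  by (simp add: vec_eq_three[OF assms] vec3_nth[OF assms])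

lemma vec3_inject:
  assumes "i \<noteq> j" "i \<noteq> k" "j \<noteq> k"
  shows "vec3 i j a b c = vec3 i j a' b' c' \<longleftrightarrow> a = a' \<and> b = b' \<and> c = c'"
  by (simp add: vec_eq_three[OF assms] vec3_nth[OF assms])

lemma triples_collapse:
  assumes "i \<noteq> j" "i \<noteq> k" "j \<noteq> k"
  shows "triples S i j (\<nu> $ i) (\<nu> $ j) (\<nu> $ k) \<longleftrightarrow> \<nu> \<in> S"
  by (simp add: triples_def vec3_collapse[OF assms])

lemma val_weight:
  fixes i j k :: 3
  assumes "i \<noteq> j" "i \<noteq> k" "j \<noteq> k" "0 < u $ i"
  shows "val a b c (u $ j / u $ i) (u $ k / u $ i) = weight u (vec3 i j a b c) / u $ i"
  using assms(4) by (simp add: val_def weight_three[OF assms(1-3)] vec3_nth[OF assms(1-3)] field_simps)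

lemma tight_iff_argmins:
  assumes ijk: "i \<noteq> j" "i \<noteq> k" "j \<noteq> k" and pos: "0 < u $ i"
  shows "tight (triples S i j) a b c (u $ j / u $ i) (u $ k / u $ i) \<longleftrightarrow> vec3 i j a b c \<in> argmins S u"
proof -
  have "(\<forall>a' b' c'. triples S i j a' b' c' \<longrightarrow> weight u (vec3 i j a b c) \<le> weight u (vec3 i j a' b' c'))
      \<longleftrightarrow> (\<forall>\<mu>\<in>S. weight u (vec3 i j a b c) \<le> weight u \<mu>)"
    by (metis triples_def vec3_collapse[OF ijk])
  then show ?thesis
    using pos by (simp add: tight_def val_weight[OF ijk pos] divide_le_cancel argmins_def triples_def)
qed

text \<open>The ends of the segment \<open>I_i^n\<close>, as exponents.\<close>

definition special_pair :: "3 \<Rightarrow> nat \<Rightarrow> (nat ^ 3) set" where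
  "special_pair i n = {(\<chi> l. if l = i then n else 0), (\<chi> l. if l = i then 0 else 1)}"

lemma special_pair_vec3:
  assumes "i \<noteq> j" "i \<noteq> k" "j \<noteq> k"
  shows "special_pair i n = {vec3 i j n 0 0, vec3 i j 0 1 1}"
    "special_pair j n = {vec3 i j 0 n 0, vec3 i j 1 0 1}"
    "special_pair k n = {vec3 i j 0 0 n, vec3 i j 1 1 0}"
proof -
  show "special_pair i n = {vec3 i j n 0 0, vec3 i j 0 1 1}"
    unfolding special_pair_def
    by (intro arg_cong2[of _ _ _ _ insert] arg_cong[of _ _ "\<lambda>x. {x}"])
      (use assms in \<open>auto simp: vec_eq_three[OF assms] vec3_nth[OF assms]\<close>)
  show "special_pair j n = {vec3 i j 0 n 0, vec3 i j 1 0 1}"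
    unfolding special_pair_def
    by (intro arg_cong2[of _ _ _ _ insert] arg_cong[of _ _ "\<lambda>x. {x}"])
      (use assms in \<open>auto simp: vec_eq_three[OF assms] vec3_nth[OF assms]\<close>)
  show "special_pair k n = {vec3 i j 0 0 n, vec3 i j 1 1 0}"
    unfolding special_pair_def
    by (intro arg_cong2[of _ _ _ _ insert] arg_cong[of _ _ "\<lambda>x. {x}"])
      (use assms in \<open>auto simp: vec_eq_three[OF assms] vec3_nth[OF assms]\<close>)
qed

lemma only2_iff_argmins:
  assumes ijk: "i \<noteq> j" "i \<noteq> k" "j \<noteq> k" and pos: "0 < u $ i"
  shows "only2 (triples S i j) (u $ j / u $ i) (u $ k / u $ i) a b c a' b' c' \<longleftrightarrow>
    argmins S u = {vec3 i j a b c, vec3 i j a' b' c'}"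
proof
  assume h: "only2 (triples S i j) (u $ j / u $ i) (u $ k / u $ i) a b c a' b' c'"
  show "argmins S u = {vec3 i j a b c, vec3 i j a' b' c'}"
  proof (rule set_eqI)
    fix \<nu>
    show "\<nu> \<in> argmins S u \<longleftrightarrow> \<nu> \<in> {vec3 i j a b c, vec3 i j a' b' c'}"
      using h[unfolded only2_def tight_iff_argmins[OF ijk pos], rule_format, of "\<nu> $ i" "\<nu> $ j" "\<nu> $ k"]
      by (simp add: vec3_collapse[OF ijk] vec_eq_three[OF ijk, of \<nu>] vec3_nth[OF ijk])
  qed
next
  assume "argmins S u = {vec3 i j a b c, vec3 i j a' b' c'}"
  then show "only2 (triples S i j) (u $ j / u $ i) (u $ k / u $ i) a b c a' b' c'"
    unfolding only2_def tight_iff_argmins[OF ijk pos] by (simp add: vec3_inject[OF ijk])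
qed

lemma special_segment_eq_hull:
  "special_segment i n = convex hull (exponent_point ` special_pair i n)"
proof -
  have "real n *\<^sub>R axis i 1 = exponent_point (\<chi> l. if l = i then n else 0)"
    by (simp add: vec_eq_iff axis_def)
  moreover have "(\<chi> l. if l = i then 0 else 1) = exponent_point (\<chi> l. if l = i then 0 else 1)"
    by (simp add: vec_eq_iff)
  ultimately show ?thesis
    by (simp add: special_segment_def special_pair_def segment_convex_hull insert_commute del: One_nat_def)
qed

text \<open>The ends of the segment are extreme points of the hull, hence exponents of the support.
  No other lattice point lies on it: away from \<open>i\<close> its coordinates equal the parameter
  of the segment, which is thus 0 or 1.\<close>

lemma special_segment_face_iff:
  assumes ne: "supp a \<noteq> {}"
  shows "special_segment i n \<in> compact_faces_dim 1 a \<longleftrightarrow>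
    (\<exists>u. (\<forall>l. 0 < u $ l) \<and> argmins (supp a) u = special_pair i n)"
proof
  assume "special_segment i n \<in> compact_faces_dim 1 a"
  then obtain u where u: "\<And>l. 0 < u $ l"
    and eq: "special_segment i n = convex hull (exponent_point ` argmins (supp a) u)"
    by (auto simp: compact_faces_dim_def compact_face_iff[OF ne])
  let ?p = "\<chi> l. if l = i then n else 0" and ?q = "\<chi> l. if l = i then 0 else (1 :: nat)"
  have seg: "special_segment i n = closed_segment (exponent_point ?p) (exponent_point ?q)"
    by (simp only: special_segment_eq_hull special_pair_def segment_convex_hull image_insert image_empty)
  have "exponent_point ` special_pair i n \<subseteq> exponent_point ` argmins (supp a) u"
    using extreme_point_of_convex_hull[of _ "exponent_point ` argmins (supp a) u"]
      extreme_point_of_segment[of _ "exponent_point ?p" "exponent_point ?q"]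
    unfolding eq[symmetric] seg by (auto simp: special_pair_def)
  then have "special_pair i n \<subseteq> argmins (supp a) u"
    by (auto simp: image_iff subset_iff)
  moreover have "\<nu> \<in> special_pair i n" if "\<nu> \<in> argmins (supp a) u" for \<nu>
  proof -
    have "exponent_point \<nu> \<in> closed_segment (exponent_point ?p) (exponent_point ?q)"
      using hull_inc[of "exponent_point \<nu>" "exponent_point ` argmins (supp a) u" convex] that
      unfolding eq[symmetric] seg by simp
    then obtain x where x: "0 \<le> x" "x \<le> 1"
      "exponent_point \<nu> = (1 - x) *\<^sub>R exponent_point ?p + x *\<^sub>R exponent_point ?q"
      by (auto simp: in_segment)
    have c: "real (\<nu> $ l) = (1 - x) * real (?p $ l) + x * real (?q $ l)" for l
      using arg_cong[OF x(3), of "\<lambda>v. v $ l"] by simp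
    obtain j where j: "i \<noteq> j"
      by (rule exists_other)
    have "real (\<nu> $ j) = x"
      using c[of j] j by simp
    then have "\<nu> $ j \<le> 1" "x = real (\<nu> $ j)"
      using x by linarith+
    then consider "x = 0" | "x = 1"
      by (cases "\<nu> $ j = 0") auto
    then show ?thesis
    proof cases
      case 1
      then have "\<nu> = ?p"
        using c by (simp add: vec_eq_iff)
      then show ?thesis
        by (simp add: special_pair_def)
    next
      case 2
      then have "\<nu> = ?q"
        using c by (simp add: vec_eq_iff)
      then show ?thesis
        by (simp add: special_pair_def)
    qed
  qed
  ultimately have "argmins (supp a) u = special_pair i n"
    by blast
  then show "\<exists>u. (\<forall>l. 0 < u $ l) \<and> argmins (supp a) u = special_pair i n"
    using u by blast
next
  assume "\<exists>u. (\<forall>l. 0 < u $ l) \<and> argmins (supp a) u = special_pair i n"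
  then have "special_segment i n \<in> compact_faces a"
    unfolding compact_face_iff[OF ne] special_segment_eq_hull by metis
  moreover have "(\<chi> l. if l = i then n else 0) \<noteq> (\<chi> l. if l = i then 0 else (1 :: nat))"
  proof -
    obtain j where "i \<noteq> j"
      by (rule exists_other)
    then have "(\<chi> l. if l = i then n else 0) $ j \<noteq> (\<chi> l. if l = i then 0 else (1 :: nat)) $ j"
      by simp
    then show ?thesis
      by metis
  qed
  then have "aff_dim (special_segment i n) = 1"
    by (simp add: special_segment_eq_hull special_pair_def aff_dim_convex_hull aff_dim_2)
  ultimately show "special_segment i n \<in> compact_faces_dim 1 a"
    by (simp add: compact_faces_dim_def)
qed

text \<open>A plane with positive normal is not parallel to a coordinate plane, so the two meet in a
  line. Consequently no two-dimensional compact face lies in a coordinate plane.\<close>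

lemma collinear_in_plane:
  fixes X :: "(real ^ 3) set"
  assumes X: "\<And>x. x \<in> X \<Longrightarrow> u \<bullet> x = l" "\<And>x. x \<in> X \<Longrightarrow> x $ j = 0" and pos: "\<And>i. 0 < u $ i"
  shows "collinear X"
proof -
  obtain i where i: "j \<noteq> i"
    by (rule exists_other)
  obtain k where k: "j \<noteq> k" "i \<noteq> k"
    by (rule exists_third[OF i])
  note d = i k(1) k(2)
  define dir where "dir = vec3 j i 0 (u $ k) (- u $ i)"
  have "\<exists>c. x - y = c *\<^sub>R dir" if "x \<in> X" "y \<in> X" for x y
  proof -
    have "u \<bullet> (x - y) = 0" "(x - y) $ j = 0"
      using X that by (simp_all add: inner_diff_right)
    then have "u $ i * (x - y) $ i + u $ k * (x - y) $ k = 0"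
      by (simp add: inner_vec_def sum_three[OF d])
    then have "x - y = ((x - y) $ i / u $ k) *\<^sub>R dir"
      using pos[of k] \<open>(x - y) $ j = 0\<close>
      by (simp add: vec_eq_three[OF d] dir_def vec3_nth[OF d] field_simps)
    then show ?thesis ..
  qed
  then show ?thesis
    unfolding collinear_def by blast
qed


lemma compact_face_dim2_iff:
  fixes a :: "nat ^ 3 \<Rightarrow> complex"
  assumes ne: "supp a \<noteq> {}"
  shows "S \<in> compact_faces_dim 2 a \<longleftrightarrow>
    (\<exists>u. (\<forall>i. 0 < u $ i) \<and> S = convex hull (exponent_point ` argmins (supp a) u) \<and> \<not> collinear S)"
proof -
  have "aff_dim S = 2 \<longleftrightarrow> \<not> collinear S"
    if u: "\<forall>i. 0 < u $ i" "S = convex hull (exponent_point ` argmins (supp a) u)" for u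
  proof -
    have "u \<in> nonneg_orthant"
      using u(1) by (simp add: nonneg_orthant_def less_imp_le)
    then obtain \<nu> where \<nu>: "\<nu> \<in> argmins (supp a) u"
      using argmins_nonempty[OF ne] by blast
    have "S \<subseteq> {x. u \<bullet> x = weight u \<nu>}"
      using face_weight[OF _ \<nu>] u(2) by auto
    then have "aff_dim S \<le> aff_dim {x. u \<bullet> x = weight u \<nu>}"
      by (rule aff_dim_subset)
    also have "\<dots> = 2"
    proof -
      have "u \<noteq> 0"
        using u(1) by (metis less_irrefl zero_index)
      then show ?thesis
        using aff_dim_hyperplane[of u "weight u \<nu>"] by simp
    qed
    finally show ?thesis
      by (auto simp: collinear_aff_dim)
  qed
  then show ?thesis
    unfolding compact_faces_dim_def compact_face_iff[OF ne] by blast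
qed

text \<open>On a line all differences are multiples of one vector, so the determinant of their last
  two coordinates vanishes.\<close>

lemma spans_not_collinear:
  assumes ijk: "i \<noteq> j" "i \<noteq> k" "j \<noteq> k" and pos: "0 < u $ i"
    and sp: "spans (triples S i j) (u $ j / u $ i) (u $ k / u $ i)"
  shows "\<not> collinear (convex hull (exponent_point ` argmins S u))"
proof
  assume "collinear (convex hull (exponent_point ` argmins S u))"
  then obtain d where d: "\<And>x y. x \<in> convex hull (exponent_point ` argmins S u) \<Longrightarrow>
      y \<in> convex hull (exponent_point ` argmins S u) \<Longrightarrow> \<exists>c. x - y = c *\<^sub>R d"
    unfolding collinear_def by blast
  from sp show False
  proof (rule spansE)
    fix a1 b1 c1 a2 b2 c2 a3 b3 c3
    assume t: "tight (triples S i j) a1 b1 c1 (u $ j / u $ i) (u $ k / u $ i)"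
      "tight (triples S i j) a2 b2 c2 (u $ j / u $ i) (u $ k / u $ i)"
      "tight (triples S i j) a3 b3 c3 (u $ j / u $ i) (u $ k / u $ i)"
      and det: "(real b2 - real b1) * (real c3 - real c1) \<noteq> (real b3 - real b1) * (real c2 - real c1)"
    have inH: "exponent_point (vec3 i j a b c) \<in> convex hull (exponent_point ` argmins S u)"
      if "tight (triples S i j) a b c (u $ j / u $ i) (u $ k / u $ i)" for a b c
      using that unfolding tight_iff_argmins[OF ijk pos] by (auto intro: hull_inc)
    have diff: "\<exists>x. real b - real b' = x * d $ j \<and> real c - real c' = x * d $ k"
      if tt: "tight (triples S i j) a b c (u $ j / u $ i) (u $ k / u $ i)"
        "tight (triples S i j) a' b' c' (u $ j / u $ i) (u $ k / u $ i)" for a b c a' b' c'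
    proof -
      obtain x where x: "exponent_point (vec3 i j a b c) - exponent_point (vec3 i j a' b' c') = x *\<^sub>R d"
        using d[OF inH[OF tt(1)] inH[OF tt(2)]] by blast
      show ?thesis
        using arg_cong[OF x, of "\<lambda>v. v $ j"] arg_cong[OF x, of "\<lambda>v. v $ k"]
        by (auto simp: vec3_nth[OF ijk])
    qed
    obtain x where x: "real b2 - real b1 = x * d $ j" "real c2 - real c1 = x * d $ k"
      using diff[OF t(2,1)] by blast
    obtain y where y: "real b3 - real b1 = y * d $ j" "real c3 - real c1 = y * d $ k"
      using diff[OF t(3,1)] by blast
    show False
      using det unfolding x y by simp
  qed
qed

text \<open>A face of dimension two spans the whole supporting plane, whose point on the
  \<open>i\<close>-th axis is found by division.\<close>

lemma max_intercept_eq: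
  fixes u :: "real ^ 3"
  assumes pos: "\<And>i. 0 < u $ i" and \<nu>: "\<nu> \<in> argmins S u"
    and nc: "\<not> collinear (convex hull (exponent_point ` argmins S u))"
  shows "max_intercept (convex hull (exponent_point ` argmins S u)) = Max (range (\<lambda>i. weight u \<nu> / u $ i))"
proof -
  let ?F = "convex hull (exponent_point ` argmins S u)"
  have u0: "u \<noteq> 0"
    using pos[of 1] by auto
  have aff: "affine hull ?F = {x. u \<bullet> x = weight u \<nu>}"
  proof -
    have sub: "?F \<subseteq> {x. u \<bullet> x = weight u \<nu>}"
      using face_weight[OF _ \<nu>] by auto
    have hp: "aff_dim {x. u \<bullet> x = weight u \<nu>} = 2"
      using aff_dim_hyperplane[OF u0, of "weight u \<nu>"] by simp
    have "aff_dim ?F = aff_dim {x. u \<bullet> x = weight u \<nu>}"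
      using aff_dim_subset[OF sub] nc hp by (auto simp: collinear_aff_dim)
    then have "affine hull ?F = affine hull {x. u \<bullet> x = weight u \<nu>}"
      using aff_dim_eq_full_gen[OF sub] by blast
    also have "\<dots> = {x. u \<bullet> x = weight u \<nu>}"
      by (simp add: affine_hyperplane hull_same)
    finally show ?thesis .
  qed
  have "axis_intercept i ?F = weight u \<nu> / u $ i" for i
    unfolding axis_intercept_def aff
    using pos[of i] by (intro the_equality) (auto simp: inner_axis field_simps)
  then show ?thesis
    by (simp add: max_intercept_def)
qed

section \<open>Exceptional faces in terms of exponents\<close>

lemma infdist_coord_axis:
  "infdist w (coord_axis i) = norm (w - (w $ i) *\<^sub>R axis i 1)"
proof (rule order.antisym)
  have "(w $ i) *\<^sub>R axis i 1 \<in> coord_axis i"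
    by (auto simp: coord_axis_def)
  then show "infdist w (coord_axis i) \<le> norm (w - (w $ i) *\<^sub>R axis i 1)"
    using infdist_le by (fastforce simp: dist_norm)
  have "norm (w - (w $ i) *\<^sub>R axis i 1) \<le> dist w y" if y: "y \<in> coord_axis i" for y
  proof -
    obtain t where t: "y = t *\<^sub>R axis i 1"
      using y by (auto simp: coord_axis_def)
    show ?thesis
      unfolding dist_norm t by (intro norm_le_componentwise_cart) (auto simp: axis_def)
  qed
  then show "norm (w - (w $ i) *\<^sub>R axis i 1) \<le> infdist w (coord_axis i)"
    unfolding infdist_def by (auto simp: coord_axis_def intro!: cINF_greatest)
qed

lemma infdist_exponent_eq_1:
  fixes i j k :: 3
  assumes ijk: "i \<noteq> j" "i \<noteq> k" "j \<noteq> k"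
  shows "infdist (exponent_point \<omega>) (coord_axis i) = 1 \<longleftrightarrow>
    \<omega> $ j = 1 \<and> \<omega> $ k = 0 \<or> \<omega> $ j = 0 \<and> \<omega> $ k = 1"
proof -
  have "norm (exponent_point \<omega> - (exponent_point \<omega> $ i) *\<^sub>R axis i 1) = sqrt (real ((\<omega> $ j)\<^sup>2 + (\<omega> $ k)\<^sup>2))"
    using ijk by (simp add: norm_vec_def L2_set_def sum_three[OF ijk] axis_def)
  then have "infdist (exponent_point \<omega>) (coord_axis i) = 1 \<longleftrightarrow> (\<omega> $ j)\<^sup>2 + (\<omega> $ k)\<^sup>2 = 1"
    unfolding infdist_coord_axis by (simp only: real_sqrt_eq_1_iff of_nat_eq_1_iff)
  also have "\<dots> \<longleftrightarrow> \<omega> $ j = 1 \<and> \<omega> $ k = 0 \<or> \<omega> $ j = 0 \<and> \<omega> $ k = 1"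
  proof
    assume h: "(\<omega> $ j)\<^sup>2 + (\<omega> $ k)\<^sup>2 = 1"
    have "\<omega> $ j \<le> (\<omega> $ j)\<^sup>2" "\<omega> $ k \<le> (\<omega> $ k)\<^sup>2"
      by (simp_all add: power2_eq_square)
    then have "\<omega> $ j \<le> 1" "\<omega> $ k \<le> 1"
      using h by linarith+
    then have "\<omega> $ j = 0 \<or> \<omega> $ j = 1" "\<omega> $ k = 0 \<or> \<omega> $ k = 1"
      by linarith+
    then show "\<omega> $ j = 1 \<and> \<omega> $ k = 0 \<or> \<omega> $ j = 0 \<and> \<omega> $ k = 1"
      using h by auto
  qed auto
  finally show ?thesis .
qed

text \<open>The combinatorial form of exceptionality: \<open>\<omega>\<close> is the apex,
  \<open>i\<close> the axis at distance 1 from it, and \<open>j\<close> the coordinate that vanishes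
  on the base. Of the two unit positions at distance 1 only the one in direction \<open>j\<close>
  can occur.\<close>

definition lone_exponent :: "(nat ^ 3) set \<Rightarrow> bool" where
  "lone_exponent D \<longleftrightarrow> (\<exists>i j \<omega>. i \<noteq> j \<and> \<omega> \<in> D \<and> \<omega> $ j = 1 \<and> (\<forall>k. k \<noteq> i \<and> k \<noteq> j \<longrightarrow> \<omega> $ k = 0) \<and>
     (\<forall>\<nu>\<in>D. \<nu> = \<omega> \<or> \<nu> $ j = 0))"

text \<open>The definition speaks of vertices only. Integrality extends it to all exponents of the
  face: the \<open>j\<close>-th coordinate is 1 at the apex and 0 on the base, so it lies strictly
  between elsewhere.\<close>

lemma exceptional_imp_lone:
  fixes a :: "nat ^ 3 \<Rightarrow> complex"
  assumes pos: "\<And>i. 0 < u $ i" and ex: "convex hull (exponent_point ` argmins (supp a) u) \<in> exceptional_faces a"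
  shows "lone_exponent (argmins (supp a) u)"
proof -
  let ?D = "argmins (supp a) u"
  let ?F = "convex hull (exponent_point ` ?D)"
  obtain i where "exceptional_wrt a i ?F"
    using ex by (auto simp: exceptional_faces_def)
  then obtain w T j where F2: "?F \<in> compact_faces_dim 2 a" and w: "w \<in> polytope_vertices ?F"
    and dist: "infdist w (coord_axis i) = 1" and T: "T \<in> compact_faces_dim 1 a"
    and vT: "polytope_vertices ?F - {w} = polytope_vertices T" and ji: "j \<noteq> i" and Tj: "T \<subseteq> {v. v $ j = 0}"
    by (auto simp: exceptional_wrt_def)
  have "polytope_vertices ?F \<subseteq> exponent_point ` ?D"
    using extreme_point_of_convex_hull by (auto simp: polytope_vertices_def)
  then obtain \<omega> where \<omega>: "\<omega> \<in> ?D" "w = exponent_point \<omega>"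
    using w by blast
  obtain k where k: "i \<noteq> k" "j \<noteq> k"
    using exists_third[of i j] ji by metis
  note ijk = ji[symmetric] k
  have compF: "compact ?F"
    by (intro finite_imp_compact_convex_hull finite_imageI finite_argmins pos)
  have others: "v $ j = 0" if "v \<in> polytope_vertices ?F" "v \<noteq> w" for v
  proof -
    have "v \<in> polytope_vertices T"
      using that vT by blast
    then show ?thesis
      using Tj by (auto simp: polytope_vertices_def extreme_point_of_def)
  qed
  have FK: "?F = convex hull polytope_vertices ?F"
    unfolding polytope_vertices_def by (rule Krein_Milman_Minkowski) (use compF in auto)
  \<comment> \<open>Otherwise all vertices, hence the face, would lie in a coordinate plane, against
    dimension two.\<close>
  have "\<omega> $ j \<noteq> 0"
  proof
    assume "\<omega> $ j = 0"
    then have "polytope_vertices ?F \<subseteq> {x. x $ j = 0}"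
      using others \<omega>(2) by (metis (mono_tags, lifting) exponent_point_nth mem_Collect_eq of_nat_0 subsetI)
    moreover have "convex {x :: real ^ 3. x $ j = 0}"
      by (simp add: convex_def)
    ultimately have "?F \<subseteq> {x. x $ j = 0}"
      using FK hull_minimal by metis
    then have "collinear ?F"
      using collinear_in_plane[of ?F u "weight u \<omega>" j] face_weight[OF _ \<omega>(1)] pos by blast
    then show False
      using F2 by (simp add: compact_faces_dim_def collinear_aff_dim)
  qed
  then have \<omega>jk: "\<omega> $ j = 1" "\<omega> $ k = 0"
    using dist unfolding \<omega>(2) infdist_exponent_eq_1[OF ijk] by auto
  have D: "\<nu> = \<omega> \<or> \<nu> $ j = 0" if \<nu>: "\<nu> \<in> ?D" for \<nu>
  proof -
    have hull: "exponent_point \<nu> \<in> convex hull (insert w (polytope_vertices ?F - {w}))"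
      using hull_inc[of "exponent_point \<nu>" "exponent_point ` ?D" convex] \<nu> FK w
      by (simp add: insert_absorb)
    have vne: "polytope_vertices ?F - {w} \<noteq> {}"
    proof
      assume "polytope_vertices ?F - {w} = {}"
      then have "?F = convex hull {w}"
        using FK w by (metis Diff_eq_empty_iff insert_absorb subset_singletonD empty_iff)
      then show False
        using F2 by (simp add: compact_faces_dim_def)
    qed
    obtain x y z where xyz: "0 \<le> x" "0 \<le> y" "x + y = 1" "z \<in> convex hull (polytope_vertices ?F - {w})"
      "exponent_point \<nu> = x *\<^sub>R w + y *\<^sub>R z"
      using hull unfolding convex_hull_insert[OF vne] by blast
    have "convex hull (polytope_vertices ?F - {w}) \<subseteq> {x. x $ j = 0}"
      using others by (intro hull_minimal) (auto simp: convex_def)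
    then have zj: "z $ j = 0"
      using xyz(4) by blast
    \<comment> \<open>The barycentric coordinate of the apex is a natural number, hence 0 or
      1.\<close>
    have "real (\<nu> $ j) = x"
      using arg_cong[OF xyz(5), of "\<lambda>v. v $ j"] zj \<omega>(2) \<omega>jk by simp
    then have "\<nu> $ j = 0 \<or> x = 1"
      using xyz(1-3) by (cases "\<nu> $ j") auto
    then show ?thesis
      using xyz(3,5) \<omega>(2) by auto
  qed
  have "\<omega> $ l = 0" if "l \<noteq> i" "l \<noteq> j" for l
    using UNIV_three[OF ijk] that \<omega>jk by auto
  then show ?thesis
    unfolding lone_exponent_def
    by (intro exI[of _ i] exI[of _ j] exI[of _ \<omega>] conjI ballI D ji[symmetric] \<omega>(1) \<omega>jk) auto
qed

lemma lone_imp_exceptional: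
  fixes a :: "nat ^ 3 \<Rightarrow> complex"
  assumes pos: "\<And>i. 0 < u $ i" and F2: "convex hull (exponent_point ` argmins (supp a) u) \<in> compact_faces_dim 2 a"
    and ne: "supp a \<noteq> {}" and lone: "lone_exponent (argmins (supp a) u)"
  shows "convex hull (exponent_point ` argmins (supp a) u) \<in> exceptional_faces a"
proof -
  let ?D = "argmins (supp a) u"
  let ?F = "convex hull (exponent_point ` ?D)"
  obtain i j \<omega> where ij: "i \<noteq> j" and \<omega>: "\<omega> \<in> ?D" "\<omega> $ j = 1" "\<forall>k. k \<noteq> i \<and> k \<noteq> j \<longrightarrow> \<omega> $ k = 0"
    and others: "\<And>\<nu>. \<nu> \<in> ?D \<Longrightarrow> \<nu> = \<omega> \<or> \<nu> $ j = 0"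
    using lone unfolding lone_exponent_def by metis
  obtain k where k: "i \<noteq> k" "j \<noteq> k"
    by (rule exists_third[OF ij])
  note ijk = ij k
  let ?w = "exponent_point \<omega>"
  let ?E = "{\<nu> \<in> ?D. \<nu> $ j = 0}"
  let ?T = "convex hull (exponent_point ` ?E)"
  have D: "?D = insert \<omega> ?E"
    using others \<omega> by auto
  have finE: "finite (exponent_point ` ?E)"
    by (intro finite_imageI finite_subset[OF _ finite_argmins[OF pos]]) auto
  have Tj: "?T \<subseteq> {x. x $ j = 0}"
    by (intro hull_minimal) (auto simp: convex_def)
  have wT: "?w \<notin> ?T"
    using Tj \<omega>(2) by auto
  have Ene: "?E \<noteq> {}"
  proof
    assume E: "?E = {}"
    have "?D = {\<omega>}"
      using D unfolding E .
    then have "?F = {?w}"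
      by simp
    then show False
      using F2 by (simp add: compact_faces_dim_def)
  qed
  have hullF: "?F = convex hull (insert ?w (exponent_point ` ?E))"
    using D by (metis image_insert)
  have wF: "?w extreme_point_of ?F"
    unfolding hullF by (rule extreme_point_of_convex_hull_insert[OF finE wT])
  \<comment> \<open>Raising the weight of coordinate \<open>j\<close> keeps exactly those minimal
    exponents on which it vanishes; so the base is itself a compact face.\<close>
  have E_eq: "argmins (supp a) (u + axis j 1) = ?E"
  proof -
    have wt: "weight (u + axis j 1) \<nu> = weight u \<nu> + real (\<nu> $ j)" for \<nu>
      by (simp add: weight_def inner_add_left inner_axis_axis inner_axis')
    obtain \<epsilon> where \<epsilon>: "\<epsilon> \<in> ?D" "\<epsilon> $ j = 0"
      using Ene by blast
    show ?thesis
    proof (intro set_eqI iffI)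
      fix \<nu> assume \<nu>: "\<nu> \<in> argmins (supp a) (u + axis j 1)"
      then have "weight u \<nu> + real (\<nu> $ j) \<le> weight u \<epsilon>" "weight u \<epsilon> \<le> weight u \<nu>" "\<nu> \<in> supp a"
        using \<epsilon> wt[of \<epsilon>] wt[of \<nu>] by (auto simp: argmins_def)
      then have "\<nu> $ j = 0" "weight u \<nu> = weight u \<epsilon>" "\<nu> \<in> supp a"
        by linarith+
      then show "\<nu> \<in> ?E"
        using \<epsilon> by (simp add: argmins_def)
    next
      fix \<nu> assume "\<nu> \<in> ?E"
      then show "\<nu> \<in> argmins (supp a) (u + axis j 1)"
        by (auto simp: argmins_def wt intro: add_increasing2)
    qed
  qed
  have "?T \<in> compact_faces a"
    unfolding compact_face_iff[OF ne]
    by (rule exI[of _ "u + axis j 1"]) (use pos E_eq in \<open>auto simp: axis_def add_pos_nonneg\<close>)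
  moreover have "aff_dim ?T = 1"
  proof -
    have "collinear ?T"
      using collinear_in_plane[of ?T u "weight u \<omega>" j] face_weight[OF _ \<omega>(1)] pos Tj
        hull_mono[of "exponent_point ` ?E" "exponent_point ` ?D" convex] by blast
    then have "aff_dim ?T \<le> 1"
      by (simp add: collinear_aff_dim)
    moreover have "aff_dim ?F = 2"
      using F2 by (simp add: compact_faces_dim_def)
    moreover have "aff_dim ?F \<le> aff_dim ?T + 1"
      unfolding hullF aff_dim_convex_hull aff_dim_insert by simp
    ultimately show ?thesis
      by linarith
  qed
  ultimately have T1: "?T \<in> compact_faces_dim 1 a"
    by (simp add: compact_faces_dim_def)
  have vertices: "polytope_vertices ?F - {?w} = polytope_vertices ?T"
  proof -
    have "?T face_of ?F"
    proof -
      have "?F \<inter> {x. axis j 1 \<bullet> x = 0} face_of ?F"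
      proof (rule face_of_Int_supporting_hyperplane_ge)
        show "convex ?F"
          by simp
        have "?F \<subseteq> {x. x $ j \<ge> 0}"
          by (intro hull_minimal) (auto simp: convex_def)
        then show "0 \<le> axis j 1 \<bullet> x" if "x \<in> ?F" for x
          using that by (auto simp: inner_axis')
      qed
      moreover have "?F \<inter> {x. axis j 1 \<bullet> x = 0} = ?T"
      proof
        show "?T \<subseteq> ?F \<inter> {x. axis j 1 \<bullet> x = 0}"
          using Tj hull_mono[of "exponent_point ` ?E" "exponent_point ` ?D" convex]
          by (auto simp: inner_axis')
        show "?F \<inter> {x. axis j 1 \<bullet> x = 0} \<subseteq> ?T"
        proof
          fix x assume x: "x \<in> ?F \<inter> {x. axis j 1 \<bullet> x = 0}"
          then obtain p q z where pq: "0 \<le> p" "0 \<le> q" "p + q = 1" "z \<in> ?T" "x = p *\<^sub>R ?w + q *\<^sub>R z"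
            using Ene by (auto simp: hullF convex_hull_insert)
          have "z $ j = 0" "x $ j = 0"
            using Tj pq(4) x by (auto simp: inner_axis')
          then have "p = 0"
            using pq(5) \<omega>(2) by simp
          then show "x \<in> ?T"
            using pq by simp
        qed
      qed
      ultimately show ?thesis
        by simp
    qed
    then have 1: "v extreme_point_of ?T \<longleftrightarrow> v extreme_point_of ?F \<and> v \<in> ?T" for v
      by (rule extreme_point_of_face)
    have 2: "v \<in> ?T" if "v extreme_point_of ?F" "v \<noteq> ?w" for v
    proof -
      have "v \<in> insert ?w (exponent_point ` ?E)"
        using that(1) unfolding hullF by (rule extreme_point_of_convex_hull)
      then show ?thesis
        using that(2) hull_inc[of v "exponent_point ` ?E" convex] by blast
    qed
    show ?thesis
      unfolding polytope_vertices_def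
    proof (intro set_eqI iffI)
      fix v assume "v \<in> {v. v extreme_point_of ?F} - {?w}"
      then show "v \<in> {v. v extreme_point_of ?T}"
        using 1[of v] 2[of v] by simp
    next
      fix v assume v: "v \<in> {v. v extreme_point_of ?T}"
      then have "v \<noteq> ?w"
        using 1[of v] wT by (intro notI) simp
      then show "v \<in> {v. v extreme_point_of ?F} - {?w}"
        using 1[of v] v by simp
    qed
  qed
  have "infdist ?w (coord_axis i) = 1"
    unfolding infdist_exponent_eq_1[OF ijk] using \<omega> k by auto
  then have "exceptional_wrt a i ?F"
    unfolding exceptional_wrt_def
  proof (intro conjI bexI[of _ ?w] bexI[of _ ?T] exI[of _ j])
    show "?w \<in> polytope_vertices ?F"
      using wF by (simp add: polytope_vertices_def)
  qed (use F2 T1 vertices ij Tj in simp_all)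
  then show ?thesis
    by (auto simp: exceptional_faces_def)
qed

section \<open>Dominating monomials\<close>

text \<open>\<open>\<nu>\<close> gives the only term of least weight in the \<open>j\<close>-th
  derivative. Comparing the exponents before differentiation is equivalent, since all weights drop
  by \<open>u $ j\<close>.\<close>

definition dominates :: "(nat ^ 'n::finite) set \<Rightarrow> real ^ 'n \<Rightarrow> 'n \<Rightarrow> nat ^ 'n \<Rightarrow> bool" where
  "dominates S u j \<nu> \<longleftrightarrow> \<nu> \<in> S \<and> 1 \<le> \<nu> $ j \<and> (\<forall>\<mu>\<in>S. 1 \<le> \<mu> $ j \<and> \<mu> \<noteq> \<nu> \<longrightarrow> weight u \<nu> < weight u \<mu>)"

text \<open>The form of \<open>support3\<close> that is independent of a chart; finiteness is
  regained from Dickson's lemma.\<close>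

locale isolated_support =
  fixes S :: "(nat ^ 3) set"
  assumes degree_ge_2: "\<nu> \<in> S \<Longrightarrow> 2 \<le> (\<Sum>l\<in>UNIV. \<nu> $ l)"
    and near_axis: "\<exists>\<nu>\<in>S. (\<Sum>l\<in>UNIV - {i}. \<nu> $ l) \<le> 1"
    and on_plane: "\<exists>\<nu>\<in>S. \<nu> $ i = 0"
begin

lemma nonempty: "S \<noteq> {}"
  using on_plane by blast

lemma support3_triples:
  assumes ijk: "i \<noteq> j" "i \<noteq> k" "j \<noteq> k"
  shows "support3 (triples S i j)"
proof -
  have cover: "\<exists>M. finite M \<and> (\<forall>(a, b, c)\<in>M. triples S i j a b c) \<and>
      (\<forall>a b c. triples S i j a b c \<longrightarrow> (\<exists>(a', b', c')\<in>M. a' \<le> a \<and> b' \<le> b \<and> c' \<le> c \<and>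
        (1 \<le> vec3 i j a b c $ l \<longrightarrow> 1 \<le> vec3 i j a' b' c' $ l)))" for l
  proof -
    obtain M where M: "finite M" "M \<subseteq> S" "\<And>\<nu>. \<nu> \<in> S \<Longrightarrow> \<exists>\<mu>\<in>M. \<mu> \<le> \<nu>"
      by (rule dickson[of S]) blast
    \<comment> \<open>A second Dickson set, taken inside the exponents with positive
      \<open>l\<close>-th entry, provides the additional clause of the covers.\<close>
    obtain M' where M': "finite M'" "M' \<subseteq> {\<nu> \<in> S. 1 \<le> \<nu> $ l}"
      "\<And>\<nu>. \<nu> \<in> {\<nu> \<in> S. 1 \<le> \<nu> $ l} \<Longrightarrow> \<exists>\<mu>\<in>M'. \<mu> \<le> \<nu>"
      by (rule dickson[of "{\<nu> \<in> S. 1 \<le> \<nu> $ l}"]) blast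
    define f where "f \<nu> = (\<nu> $ i, \<nu> $ j, \<nu> $ k)" for \<nu> :: "nat ^ 3"
    show ?thesis
    proof (intro exI[of _ "f ` (M \<union> M')"] conjI allI impI)
      show "finite (f ` (M \<union> M'))"
        using M(1) M'(1) by simp
      show "\<forall>(a, b, c)\<in>f ` (M \<union> M'). triples S i j a b c"
        using M(2) M'(2) by (auto simp: f_def triples_collapse[OF ijk])
      fix a b c assume abc: "triples S i j a b c"
      have "\<exists>\<mu>\<in>M \<union> M'. \<mu> \<le> vec3 i j a b c \<and> (1 \<le> vec3 i j a b c $ l \<longrightarrow> 1 \<le> \<mu> $ l)"
      proof (cases "1 \<le> vec3 i j a b c $ l")
        case True
        then show ?thesis
          using M'(2) M'(3)[of "vec3 i j a b c"] abc by (auto simp: triples_def)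
      next
        case False
        then show ?thesis
          using M(3)[of "vec3 i j a b c"] abc by (auto simp: triples_def)
      qed
      then obtain \<mu> where \<mu>: "\<mu> \<in> M \<union> M'" "\<mu> \<le> vec3 i j a b c" "1 \<le> vec3 i j a b c $ l \<longrightarrow> 1 \<le> \<mu> $ l"
        by blast
      have "\<mu> $ i \<le> a" "\<mu> $ j \<le> b" "\<mu> $ k \<le> c"
        using \<mu>(2) vec3_nth[OF ijk, of a b c] unfolding less_eq_vec_def by metis+
      then show "\<exists>(a', b', c')\<in>f ` (M \<union> M'). a' \<le> a \<and> b' \<le> b \<and> c' \<le> c \<and>
        (1 \<le> vec3 i j a b c $ l \<longrightarrow> 1 \<le> vec3 i j a' b' c' $ l)"
        using \<mu> by (intro bexI[of _ "f \<mu>"]) (auto simp: f_def vec3_collapse[OF ijk])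
    qed
  qed
  have axis: "\<exists>\<nu>\<in>S. \<nu> $ m + \<nu> $ n \<le> 1" if "l \<noteq> m" "l \<noteq> n" "m \<noteq> n" for l m n
  proof -
    have "UNIV - {l} = {m, n}"
      using UNIV_three[OF that] that by auto
    then show ?thesis
      using near_axis[of l] that by simp
  qed
  have split: "x = 0 \<and> y = 0 \<or> x = 1 \<and> y = 0 \<or> x = 0 \<and> y = 1" if "x + y \<le> (1 :: nat)" for x y
    using that by linarith
  show ?thesis
  proof
    show "2 \<le> a + b + c" if "triples S i j a b c" for a b c
      using degree_ge_2[of "vec3 i j a b c"] that by (simp add: triples_def sum_three[OF ijk] vec3_nth[OF ijk])
    show "\<exists>p. triples S i j p 0 0 \<or> triples S i j p 1 0 \<or> triples S i j p 0 1"
      using axis[OF ijk] split triples_collapse[OF ijk, of S] by metis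
    show "\<exists>p. triples S i j 0 p 0 \<or> triples S i j 1 p 0 \<or> triples S i j 0 p 1"
      using axis[of j i k] ijk split triples_collapse[OF ijk, of S] by metis
    show "\<exists>p. triples S i j 0 0 p \<or> triples S i j 1 0 p \<or> triples S i j 0 1 p"
      using axis[of k i j] ijk split triples_collapse[OF ijk, of S] by metis
    show "\<exists>a c. triples S i j a 0 c"
      using on_plane[of j] triples_collapse[OF ijk, of S] by metis
    show "\<exists>a b. triples S i j a b 0"
      using on_plane[of k] triples_collapse[OF ijk, of S] by metis
  qed (use cover[of j] cover[of k] in \<open>simp_all add: vec3_nth[OF ijk]\<close>)
qed

end

lemma exc_of_lone_exponent:
  assumes ijk: "i \<noteq> j" "i \<noteq> k" "j \<noteq> k" and pos: "0 < u $ i" and lone: "lone_exponent (argmins S u)"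
  shows "exc (triples S i j) (u $ j / u $ i) (u $ k / u $ i)"
proof -
  obtain x y \<omega> where xy: "x \<noteq> y" "\<omega> \<in> argmins S u" "\<omega> $ y = 1" "\<forall>k. k \<noteq> x \<and> k \<noteq> y \<longrightarrow> \<omega> $ k = 0"
    and others: "\<forall>\<nu>\<in>argmins S u. \<nu> = \<omega> \<or> \<nu> $ y = 0"
    using lone unfolding lone_exponent_def by metis
  have \<omega>: "vec3 i j (\<omega> $ i) (\<omega> $ j) (\<omega> $ k) \<in> argmins S u"
    using xy(2) by (simp add: vec3_collapse[OF ijk])
  have l: "lone (triples S i j) (u $ j / u $ i) (u $ k / u $ i) (\<omega> $ i) (\<omega> $ j) (\<omega> $ k) (\<lambda>a b c. vec3 i j a b c $ y = 0)"
    unfolding lone_def tight_iff_argmins[OF ijk pos]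
  proof (intro conjI allI impI \<omega>)
    fix a b c assume "vec3 i j a b c \<in> argmins S u"
    then show "a = \<omega> $ i \<and> b = \<omega> $ j \<and> c = \<omega> $ k \<or> vec3 i j a b c $ y = 0"
      using others by (auto simp: vec_eq_three[OF ijk, of _ \<omega>] vec3_nth[OF ijk])
  qed
  have "x \<in> {i, j, k}" "y \<in> {i, j, k}"
    using UNIV_three[OF ijk] by auto
  then consider "x = i" "y = j" | "x = k" "y = j" | "x = i" "y = k" | "x = j" "y = k" | "x = j" "y = i" | "x = k" "y = i"
    using xy(1) by blast
  then show ?thesis
  proof cases
    case 1
    then show ?thesis
      using l xy(3,4) ijk unfolding exc_def by (auto simp: vec3_nth[OF ijk])
  next
    case 2
    then show ?thesis
      using l xy(3,4) ijk unfolding exc_def by (auto simp: vec3_nth[OF ijk])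
  next
    case 3
    then show ?thesis
      using l xy(3,4) ijk unfolding exc_def by (auto simp: vec3_nth[OF ijk])
  next
    case 4
    then show ?thesis
      using l xy(3,4) ijk unfolding exc_def by (auto simp: vec3_nth[OF ijk])
  next
    case 5
    then show ?thesis
      using l xy(3,4) ijk unfolding exc_def by (auto simp: vec3_nth[OF ijk])
  next
    case 6
    then show ?thesis
      using l xy(3,4) ijk unfolding exc_def by (auto simp: vec3_nth[OF ijk])
  qed
qed

lemma bad_support_triples:
  fixes a :: "nat ^ 3 \<Rightarrow> complex"
  assumes iso: "isolated_support (supp a)" and ijk: "i \<noteq> j" "i \<noteq> k" "j \<noteq> k"
    and m: "0 \<le> m" and pure: "\<And>p. vec3 i j p 0 0 \<in> supp a \<Longrightarrow> m < real p"
    and max: "\<And>F. F \<in> compact_faces_dim 2 a - exceptional_faces a \<Longrightarrow> max_intercept F \<le> m"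
    and no: "\<And>l n u. (\<And>i. 0 < u $ i) \<Longrightarrow> argmins (supp a) u \<noteq> special_pair l n"
  shows "bad_support (triples (supp a) i j) m"
proof -
  interpret isolated_support "supp a" by fact
  interpret t: support3 "triples (supp a) i j"
    by (rule support3_triples[OF ijk])
  define dir where "dir s t = vec3 i j 1 s (t :: real)" for s t
  have dir: "dir s t $ i = 1" "dir s t $ j / dir s t $ i = s" "dir s t $ k / dir s t $ i = t" "0 < dir s t $ i" for s t
    by (simp_all add: dir_def vec3_nth[OF ijk])
  have dir_pos: "0 < dir s t $ l" if "0 < s" "0 < t" for s t l
    using that by (simp add: dir_def vec3_def)
  have tdir: "tight (triples (supp a) i j) x y z s t \<longleftrightarrow> vec3 i j x y z \<in> argmins (supp a) (dir s t)" for x y z s t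
    using tight_iff_argmins[where u = "dir s t", OF ijk dir(4)] by (simp only: dir(2,3))
  have odir: "only2 (triples (supp a) i j) s t x y z x' y' z' \<longleftrightarrow>
      argmins (supp a) (dir s t) = {vec3 i j x y z, vec3 i j x' y' z'}" for x y z x' y' z' s t
    using only2_iff_argmins[where u = "dir s t", OF ijk dir(4)] by (simp only: dir(2,3))
  have not_only2: "\<not> only2 (triples (supp a) i j) s t x y z x' y' z'"
    if "0 < s" "0 < t" "{vec3 i j x y z, vec3 i j x' y' z'} = special_pair l n" for s t x y z x' y' z' l n
    unfolding odir that(3) by (rule no) (rule dir_pos[OF that(1,2)])
  show ?thesis
  proof
    show "0 \<le> m" by fact
    show "m < real p" if "triples (supp a) i j p 0 0" for p
      using pure that by (simp add: triples_def)
    show "exc (triples (supp a) i j) s t"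
      if st: "0 < s" "0 < t" and sp: "spans (triples (supp a) i j) s t"
        and xyz: "tight (triples (supp a) i j) x y z s t" and big: "m * min 1 (min s t) < val x y z s t" for s t x y z
    proof -
      let ?F = "convex hull (exponent_point ` argmins (supp a) (dir s t))"
      have pos: "\<And>l. 0 < dir s t $ l"
        using dir_pos st by blast
      have nc: "\<not> collinear ?F"
        by (rule spans_not_collinear[OF ijk dir(4)]) (simp only: dir(2,3) sp)
      have F2: "?F \<in> compact_faces_dim 2 a"
        unfolding compact_face_dim2_iff[OF nonempty] using pos nc by blast
      have \<nu>: "vec3 i j x y z \<in> argmins (supp a) (dir s t)"
        using xyz by (simp only: tdir)
      have w: "weight (dir s t) (vec3 i j x y z) = val x y z s t"
        using val_weight[where a=x and b=y and c=z and u="dir s t", OF ijk dir(4)]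
        by (simp only: dir(2,3)) (simp add: dir(1))
      have "m < max_intercept ?F"
      proof -
        \<comment> \<open>The index of a least entry of \<open>(1, s, t)\<close>, where the
          intercept is largest.\<close>
        define l where "l = (if 1 \<le> s \<and> 1 \<le> t then i else if s \<le> t then j else k)"
        have "dir s t $ l = min 1 (min s t)"
          using dir[of s t] by (auto simp: l_def min_def)
        then have "m < val x y z s t / dir s t $ l"
          using big pos[of l] by (simp add: pos_less_divide_eq)
        also have "\<dots> \<le> Max (range (\<lambda>l. weight (dir s t) (vec3 i j x y z) / dir s t $ l))"
          unfolding w by (rule Max_ge) auto
        also have "\<dots> = max_intercept ?F"
          using max_intercept_eq[OF pos \<nu> nc] by simp
        finally show ?thesis .
      qed
      then have "?F \<in> exceptional_faces a"
        using max[of ?F] F2 by auto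
      then have "lone_exponent (argmins (supp a) (dir s t))"
        by (intro exceptional_imp_lone pos)
      from exc_of_lone_exponent[OF ijk dir(4) this] show ?thesis
        by (simp only: dir(2,3))
    qed
    show "\<not> only2 (triples (supp a) i j) s t n 0 0 0 1 1" if "0 < s" "0 < t" for s t n
      by (rule not_only2[OF that special_pair_vec3(1)[OF ijk, symmetric]])
    show "\<not> only2 (triples (supp a) i j) s t 0 n 0 1 0 1" if "0 < s" "0 < t" for s t n
      by (rule not_only2[OF that special_pair_vec3(2)[OF ijk, symmetric]])
    show "\<not> only2 (triples (supp a) i j) s t 0 0 n 1 1 0" if "0 < s" "0 < t" for s t n
      by (rule not_only2[OF that special_pair_vec3(3)[OF ijk, symmetric]])
  qed
qed

text \<open>With \<open>m = 0\<close>, \<open>mixed_quadratic\<close> says that every variable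
  occurs in one of the quadratic monomials \<open>z_i z_j\<close> of the support. Hence at least two
  of the three are present, and two of them always share a variable, against
  \<open>not_two_mixed_quadratics\<close>.\<close>

lemma exists_special_pair:
  fixes a :: "nat ^ 3 \<Rightarrow> complex"
  assumes iso: "isolated_support (supp a)" and all: "compact_faces_dim 2 a - exceptional_faces a = {}"
  shows "\<exists>l n u. (\<forall>i. 0 < u $ i) \<and> argmins (supp a) u = special_pair l n"
proof (rule ccontr)
  assume no: "\<not> ?thesis"
  interpret isolated_support "supp a" by fact
  have bad: "bad_support (triples (supp a) i j) 0" if ijk: "i \<noteq> j" "i \<noteq> k" "j \<noteq> k" for i j k
  proof (rule bad_support_triples[OF iso ijk])
    show "0 < real p" if "vec3 i j p 0 0 \<in> supp a" for p
      using degree_ge_2[OF that] by (simp add: sum_three[OF ijk] vec3_nth[OF ijk])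
    show "max_intercept F \<le> 0" if "F \<in> compact_faces_dim 2 a - exceptional_faces a" for F
      using that all by blast
    show "argmins (supp a) u \<noteq> special_pair l n" if "\<And>i. 0 < u $ i" for l n u
      using no that by blast
  qed simp
  define Q where "Q i j \<longleftrightarrow> (\<chi> l. if l = i \<or> l = j then 1 else 0) \<in> supp a" for i j :: 3
  have Q_sym: "Q i j \<longleftrightarrow> Q j i" for i j
    unfolding Q_def by (simp only: disj_commute)
  have v: "vec3 i j 1 1 0 = (\<chi> l. if l = i \<or> l = j then 1 else 0)"
      "vec3 i j 1 0 1 = (\<chi> l. if l = i \<or> l = k then 1 else 0)"
      "vec3 i j 0 1 1 = (\<chi> l. if l = j \<or> l = k then 1 else (0 :: nat))" if ijk: "i \<noteq> j" "i \<noteq> k" "j \<noteq> k" for i j k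
    using ijk by (auto simp: vec_eq_three[OF ijk] vec3_nth[OF ijk])
  have one: "Q i j \<or> Q i k" if ijk: "i \<noteq> j" "i \<noteq> k" "j \<noteq> k" for i j k
    using bad_support.mixed_quadratic[OF bad[OF ijk] refl] unfolding triples_def v[OF ijk] Q_def .
  have two: "\<not> (Q i j \<and> Q j k)" if ijk: "i \<noteq> j" "i \<noteq> k" "j \<noteq> k" for i j k
  proof
    assume h: "Q i j \<and> Q j k"
    show False
    proof (rule bad_support.not_two_mixed_quadratics[OF bad[OF ijk]])
      show "triples (supp a) i j 1 1 0" "triples (supp a) i j 0 1 1"
        using h unfolding triples_def v[OF ijk] Q_def by blast+
      show "0 < real x + real z" if "triples (supp a) i j x 0 z" for x z
        using degree_ge_2[OF that[unfolded triples_def]] by (simp add: sum_three[OF ijk] vec3_nth[OF ijk])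
    qed
  qed
  have d: "(1 :: 3) \<noteq> 2" "(1 :: 3) \<noteq> 3" "(2 :: 3) \<noteq> 3"
    by auto
  show False
    using one[of 1 2 3] one[of 2 1 3] one[of 3 1 2] two[of 1 2 3] two[of 2 1 3] two[of 1 3 2] d Q_sym
    by metis
qed

text \<open>Used contrapositively in part (2), where a nonexceptional face exists. The alternative
  in \<open>tight_of_only2\<close> says which coordinate vanishes on the base;
  \<open>(0, 1, 1)\<close> must be present as apex, since otherwise the face would lie in a
  coordinate plane.\<close>

lemma exceptional_of_special_pair:
  fixes a :: "nat ^ 3 \<Rightarrow> complex"
  assumes ne: "supp a \<noteq> {}" and u: "\<And>l. 0 < u $ l" "argmins (supp a) u = special_pair i n"
    and F: "F \<in> compact_faces_dim 2 a"
  shows "F \<in> exceptional_faces a"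
proof -
  obtain v where v: "\<And>l. 0 < v $ l" "F = convex hull (exponent_point ` argmins (supp a) v)" "\<not> collinear F"
    using F unfolding compact_face_dim2_iff[OF ne] by blast
  obtain j where ij: "i \<noteq> j"
    by (rule exists_other)
  obtain k where k: "i \<noteq> k" "j \<noteq> k"
    by (rule exists_third[OF ij])
  note ijk = ij k
  have only: "only2 (triples (supp a) i j) (u $ j / u $ i) (u $ k / u $ i) n 0 0 0 1 1"
    unfolding only2_iff_argmins[OF ijk u(1)] u(2) by (rule special_pair_vec3[OF ijk])
  have planar: False if "\<forall>\<nu>\<in>argmins (supp a) v. \<nu> $ l = 0" for l
  proof -
    obtain \<nu> where \<nu>: "\<nu> \<in> argmins (supp a) v"
      using v(2,3) by (cases "argmins (supp a) v = {}") auto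
    have "F \<subseteq> {x. x $ l = 0}"
      unfolding v(2) using that by (intro hull_minimal) (auto simp: convex_def)
    then have "collinear F"
      using collinear_in_plane[of F v "weight v \<nu>" l] face_weight[OF _ \<nu>] v(1,2) by blast
    then show False
      using v(3) by simp
  qed
  let ?\<omega> = "vec3 i j 0 1 1 :: nat ^ 3"
  have \<omega>: "?\<omega> $ i = 0" "?\<omega> $ j = 1" "?\<omega> $ k = 1"
    by (simp_all add: vec3_nth[OF ijk])
  have lone: "lone_exponent (argmins (supp a) v)"
    if h: "\<forall>\<nu>\<in>argmins (supp a) v. \<nu> = ?\<omega> \<or> \<nu> $ l = 0" and l: "l = j \<and> l' = k \<or> l = k \<and> l' = j" for l l'
  proof -
    have "?\<omega> \<in> argmins (supp a) v"
    proof (rule ccontr)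
      assume "?\<omega> \<notin> argmins (supp a) v"
      then have "\<forall>\<nu>\<in>argmins (supp a) v. \<nu> $ l = 0"
        using h by metis
      then show False
        by (rule planar)
    qed
    moreover have "?\<omega> $ x = 0" if "x \<noteq> l'" "x \<noteq> l" for x
    proof -
      have "x = i"
        using UNIV_three[OF ijk] that l by blast
      then show ?thesis
        using \<omega>(1) by blast
    qed
    then have "\<forall>x. x \<noteq> l' \<and> x \<noteq> l \<longrightarrow> ?\<omega> $ x = 0"
      by blast
    moreover have "l' \<noteq> l" "?\<omega> $ l = 1"
      using l ijk \<omega> by auto
    ultimately show ?thesis
      unfolding lone_exponent_def using h by (intro exI[of _ l'] exI[of _ l] exI[of _ ?\<omega>] conjI)
  qed
  have tight_v: "tight (triples (supp a) i j) (\<nu> $ i) (\<nu> $ j) (\<nu> $ k) (v $ j / v $ i) (v $ k / v $ i)"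
    if "\<nu> \<in> argmins (supp a) v" for \<nu>
    using that by (simp add: tight_iff_argmins[OF ijk v(1)] vec3_collapse[OF ijk])
  have pos: "0 < u $ j / u $ i" "0 < u $ k / u $ i" "0 < v $ j / v $ i" "0 < v $ k / v $ i"
    using u(1) v(1) by simp_all
  have "lone_exponent (argmins (supp a) v)"
    using tight_of_only2[OF only pos]
  proof
    assume h: "\<forall>a' b c. tight (triples (supp a) i j) a' b c (v $ j / v $ i) (v $ k / v $ i) \<longrightarrow>
      a' = 0 \<and> b = 1 \<and> c = 1 \<or> b = 0"
    have "\<forall>\<nu>\<in>argmins (supp a) v. \<nu> = ?\<omega> \<or> \<nu> $ j = 0"
      using h[rule_format, OF tight_v] unfolding vec_eq_three[OF ijk] \<omega> by (rule ballI)
    then show ?thesis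
      by (rule lone[where l' = k]) simp
  next
    assume h: "\<forall>a' b c. tight (triples (supp a) i j) a' b c (v $ j / v $ i) (v $ k / v $ i) \<longrightarrow>
      a' = 0 \<and> b = 1 \<and> c = 1 \<or> c = 0"
    have "\<forall>\<nu>\<in>argmins (supp a) v. \<nu> = ?\<omega> \<or> \<nu> $ k = 0"
      using h[rule_format, OF tight_v] unfolding vec_eq_three[OF ijk] \<omega> by (rule ballI)
    then show ?thesis
      by (rule lone[where l' = j]) simp
  qed
  then show ?thesis
    using F lone_imp_exceptional[OF v(1) _ ne] unfolding v(2) by metis
qed

text \<open>On the same axis each end minimises against the other. On different axes the edge normal
  \<open>u\<close> gives \<open>u $ j < u $ i\<close> and \<open>u $ i * n < u $ j * m\<close>, so
  \<open>n < m\<close>; the normal \<open>v\<close> gives the opposite.\<close>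

lemma special_pair_unique:
  fixes u v :: "real ^ 3"
  assumes u: "\<And>l. 0 < u $ l" "argmins S u = special_pair i n"
    and v: "\<And>l. 0 < v $ l" "argmins S v = special_pair j m"
  shows "i = j \<and> n = m"
proof (cases "i = j")
  case True
  obtain j' where ij: "i \<noteq> j'"
    by (rule exists_other)
  obtain k where k: "i \<noteq> k" "j' \<noteq> k"
    by (rule exists_third[OF ij])
  note ijk = ij k
  have "vec3 i j' n 0 0 \<in> argmins S u" "vec3 i j' m 0 0 \<in> argmins S v"
    unfolding u(2) v(2) True[symmetric] special_pair_vec3(1)[OF ijk] by simp_all
  then have "u $ i * real n \<le> u $ i * real m" "v $ i * real m \<le> v $ i * real n"
    by (auto simp: argmins_def weight_three[OF ijk] vec3_nth[OF ijk])
  then have "n \<le> m" "m \<le> n"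
    using u(1)[of i] v(1)[of i] by simp_all
  then show ?thesis
    using True by simp
next
  case False
  obtain k where k: "i \<noteq> k" "j \<noteq> k"
    by (rule exists_third[OF False])
  note ijk = False k
  have Du: "argmins S u = {vec3 i j n 0 0, vec3 i j 0 1 1}"
    unfolding u(2) by (rule special_pair_vec3(1)[OF ijk])
  have Dv: "argmins S v = {vec3 i j 0 m 0, vec3 i j 1 0 1}"
    unfolding v(2) by (rule special_pair_vec3(2)[OF ijk])
  have inS: "vec3 i j n 0 0 \<in> S" "vec3 i j 0 1 1 \<in> S" "vec3 i j 0 m 0 \<in> S" "vec3 i j 1 0 1 \<in> S"
    using Du Dv by (auto simp: argmins_def)
  note w = weight_three[OF ijk] vec3_nth[OF ijk]
  have strict: "weight x \<kappa> < weight x \<mu>" if "\<kappa> \<in> argmins S x" "\<mu> \<in> S" "\<mu> \<notin> argmins S x" for x \<kappa> \<mu>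
    using that by (force simp: argmins_def)
  have nu: "vec3 i j 0 m 0 \<notin> argmins S u" "vec3 i j 1 0 1 \<notin> argmins S u"
    "vec3 i j n 0 0 \<notin> argmins S v" "vec3 i j 0 1 1 \<notin> argmins S v"
  proof -
    show "vec3 i j 1 0 1 \<notin> argmins S u" "vec3 i j 0 1 1 \<notin> argmins S v"
      unfolding Du Dv by (simp_all add: vec3_inject[OF ijk])
    have "n \<noteq> 0"
      using argmins_eq[of "vec3 i j n 0 0" S u "vec3 i j 0 1 1"] Du add_pos_pos[OF u(1)[of j] u(1)[of k]]
      by (intro notI) (simp add: w)
    moreover have "m \<noteq> 0"
      using argmins_eq[of "vec3 i j 0 m 0" S v "vec3 i j 1 0 1"] Dv add_pos_pos[OF v(1)[of i] v(1)[of k]]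
      by (intro notI) (simp add: w)
    ultimately show "vec3 i j 0 m 0 \<notin> argmins S u" "vec3 i j n 0 0 \<notin> argmins S v"
      unfolding Du Dv by (simp_all add: vec3_inject[OF ijk])
  qed
  have yz: "vec3 i j 0 1 1 \<in> argmins S u" "vec3 i j n 0 0 \<in> argmins S u"
    "vec3 i j 1 0 1 \<in> argmins S v" "vec3 i j 0 m 0 \<in> argmins S v"
    using Du Dv by auto
  have 1: "u $ j < u $ i" "u $ i * real n < u $ j * real m"
    using strict[OF yz(1) inS(4) nu(2)] strict[OF yz(2) inS(3) nu(1)] by (simp_all add: w)
  have 2: "v $ i < v $ j" "v $ j * real m < v $ i * real n"
    using strict[OF yz(3) inS(2) nu(4)] strict[OF yz(4) inS(1) nu(3)] by (simp_all add: w)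
  have "u $ j * real m \<le> u $ i * real m" "v $ i * real n \<le> v $ j * real n"
    using 1 2 by (auto intro!: mult_right_mono)
  then have "u $ i * real n < u $ i * real m" "v $ j * real m < v $ j * real n"
    using 1 2 by linarith+
  then have "real n < real m" "real m < real n"
    using u(1)[of i] v(1)[of j] by (simp_all add: mult_less_cancel_left)
  then show ?thesis
    by simp
qed

text \<open>The chart is based at an index \<open>i\<close> of least weight, so that both quotients
  are at least 1. The monomial found is \<open>z_i^q z_j\<close>, and differentiation by
  \<open>z_j\<close> leaves weight \<open>q * u $ i\<close>.\<close>

lemma dominates_of_nonexceptional:
  fixes a :: "nat ^ 3 \<Rightarrow> complex"
  assumes iso: "isolated_support (supp a)" and m: "2 \<le> m"
    and max: "\<And>F. F \<in> compact_faces_dim 2 a - exceptional_faces a \<Longrightarrow> max_intercept F \<le> m"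
    and no: "\<And>l n u. (\<And>i. 0 < u $ i) \<Longrightarrow> argmins (supp a) u \<noteq> special_pair l n"
    and u: "\<And>l. 0 < u $ l" "\<And>l. u $ i \<le> u $ l" and big: "\<And>\<nu>. \<nu> \<in> supp a \<Longrightarrow> m * u $ i < weight u \<nu>"
  shows "\<exists>j \<nu>. dominates (supp a) u j \<nu> \<and> weight u \<nu> - u $ j \<le> (m - 1) * u $ i"
proof -
  obtain j where ij: "i \<noteq> j"
    by (rule exists_other)
  obtain k where k: "i \<noteq> k" "j \<noteq> k"
    by (rule exists_third[OF ij])
  note ijk = ij k
  define s where "s = u $ j / u $ i"
  define t where "t = u $ k / u $ i"
  have st: "1 \<le> s" "1 \<le> t"
    using u by (simp_all add: s_def t_def le_divide_eq)
  have w: "val x y z s t = weight u (vec3 i j x y z) / u $ i" for x y z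
    unfolding s_def t_def by (rule val_weight[OF ijk u(1)])
  interpret b: bad_support "triples (supp a) i j" m
  proof (rule bad_support_triples[OF iso ijk _ _ max no])
    show "m < real p" if "vec3 i j p 0 0 \<in> supp a" for p
      using big[OF that] u(1)[of i] by (simp add: weight_three[OF ijk] vec3_nth[OF ijk])
  qed (use m in auto)
  have "m < val x y z s t" if "triples (supp a) i j x y z" for x y z
    using big[of "vec3 i j x y z"] that u(1)[of i] by (simp add: triples_def w pos_less_divide_eq)
  from b.dominating_monomial[OF m st this] obtain q where q: "real q + 1 \<le> m"
    and dom: "triples (supp a) i j q 1 0 \<and> (\<forall>a' b c. triples (supp a) i j a' b c \<and> 1 \<le> b \<and> \<not> (a' = q \<and> b = 1 \<and> c = 0) \<longrightarrow> val q 1 0 s t < val a' b c s t) \<or>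
      triples (supp a) i j q 0 1 \<and> (\<forall>a' b c. triples (supp a) i j a' b c \<and> 1 \<le> c \<and> \<not> (a' = q \<and> b = 0 \<and> c = 1) \<longrightarrow> val q 0 1 s t < val a' b c s t)"
    by blast
  have qm: "u $ i * real q \<le> (m - 1) * u $ i"
    using q u(1)[of i] by simp
  from dom show ?thesis
  proof
    assume h: "triples (supp a) i j q 1 0 \<and> (\<forall>a' b c. triples (supp a) i j a' b c \<and> 1 \<le> b \<and> \<not> (a' = q \<and> b = 1 \<and> c = 0) \<longrightarrow> val q 1 0 s t < val a' b c s t)"
    have "weight u (vec3 i j q 1 0) < weight u \<mu>" if "\<mu> \<in> supp a" "1 \<le> \<mu> $ j" "\<mu> \<noteq> vec3 i j q 1 0" for \<mu>
      using h[THEN conjunct2, rule_format, of "\<mu> $ i" "\<mu> $ j" "\<mu> $ k"] that u(1)[of i]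
      by (auto simp: triples_collapse[OF ijk] w vec3_collapse[OF ijk] vec_eq_three[OF ijk, of \<mu>] vec3_nth[OF ijk] divide_less_cancel)
    then have "dominates (supp a) u j (vec3 i j q 1 0)"
      using h by (simp add: dominates_def triples_def vec3_nth[OF ijk])
    moreover have "weight u (vec3 i j q 1 0) - u $ j = u $ i * real q"
      by (simp add: weight_three[OF ijk] vec3_nth[OF ijk])
    then have "weight u (vec3 i j q 1 0) - u $ j \<le> (m - 1) * u $ i"
      using qm by simp
    ultimately show ?thesis
      by blast
  next
    assume h: "triples (supp a) i j q 0 1 \<and> (\<forall>a' b c. triples (supp a) i j a' b c \<and> 1 \<le> c \<and> \<not> (a' = q \<and> b = 0 \<and> c = 1) \<longrightarrow> val q 0 1 s t < val a' b c s t)"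
    have "weight u (vec3 i j q 0 1) < weight u \<mu>" if "\<mu> \<in> supp a" "1 \<le> \<mu> $ k" "\<mu> \<noteq> vec3 i j q 0 1" for \<mu>
      using h[THEN conjunct2, rule_format, of "\<mu> $ i" "\<mu> $ j" "\<mu> $ k"] that u(1)[of i]
      by (auto simp: triples_collapse[OF ijk] w vec3_collapse[OF ijk] vec_eq_three[OF ijk, of \<mu>] vec3_nth[OF ijk] divide_less_cancel)
    then have "dominates (supp a) u k (vec3 i j q 0 1)"
      using h by (simp add: dominates_def triples_def vec3_nth[OF ijk])
    moreover have "weight u (vec3 i j q 0 1) - u $ k = u $ i * real q"
      by (simp add: weight_three[OF ijk] vec3_nth[OF ijk])
    then have "weight u (vec3 i j q 0 1) - u $ k \<le> (m - 1) * u $ i"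
      using qm by simp
    ultimately show ?thesis
      by blast
  qed
qed

text \<open>The pure power of the edge is \<open>z_i^n\<close>; by \<open>big\<close> its axis
  cannot be the one of least weight \<open>i0\<close>. Hence \<open>z_i0\<close> divides the other
  end \<open>z_i0 z_k\<close>, whose derivative by \<open>z_k\<close> has weight only
  \<open>u $ i0\<close>; the strict bounds in \<open>big\<close> make all other terms of that
  derivative heavier.\<close>

lemma dominates_of_special_pair:
  assumes iso: "isolated_support S" and v: "argmins S v = special_pair i n" and n: "2 \<le> n"
    and u: "\<And>l. 0 < u $ l" "\<And>l. u $ i0 \<le> u $ l" and big: "\<And>\<nu>. \<nu> \<in> S \<Longrightarrow> real n * u $ i0 < weight u \<nu>"
  shows "\<exists>j \<nu>. dominates S u j \<nu> \<and> weight u \<nu> - u $ j \<le> (real n - 1) * u $ i0"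
proof -
  interpret isolated_support S by fact
  have "i \<noteq> i0"
  proof
    assume i: "i = i0"
    obtain j where ij: "i \<noteq> j"
      by (rule exists_other)
    obtain k where k: "i \<noteq> k" "j \<noteq> k"
      by (rule exists_third[OF ij])
    note ijk = ij k
    have "vec3 i j n 0 0 \<in> argmins S v"
      unfolding v special_pair_vec3(1)[OF ijk] by simp
    then have "vec3 i j n 0 0 \<in> S"
      by (simp add: argmins_def)
    from big[OF this] show False
      by (simp add: weight_three[OF ijk] vec3_nth[OF ijk] i[symmetric] mult.commute)
  qed
  then obtain k where k: "i \<noteq> k" "i0 \<noteq> k"
    by (rule exists_third)
  note ijk = \<open>i \<noteq> i0\<close> k
  note w = weight_three[OF ijk] vec3_nth[OF ijk]
  have "{vec3 i i0 n 0 0, vec3 i i0 0 1 1} \<subseteq> S"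
    using v unfolding special_pair_vec3(1)[OF ijk] by (auto simp: argmins_def)
  then have S: "vec3 i i0 n 0 0 \<in> S" "vec3 i i0 0 1 1 \<in> S"
    by auto
  have n2: "2 * u $ i0 \<le> real n * u $ i0"
    using n u(1)[of i0] by (intro mult_right_mono) auto
  have gt: "u $ i0 < u $ i" "u $ i0 < u $ k"
  proof -
    show "u $ i0 < u $ i"
      using big[OF S(1)] n by (simp add: w mult.commute[of _ "real n"])
    have "real n * u $ i0 < u $ i0 + u $ k"
      using big[OF S(2)] by (simp add: w)
    then show "u $ i0 < u $ k"
      using n2 by linarith
  qed
  have "weight u (vec3 i i0 0 1 1) < weight u \<mu>" if \<mu>: "\<mu> \<in> S" "1 \<le> \<mu> $ k" "\<mu> \<noteq> vec3 i i0 0 1 1" for \<mu>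
  proof (rule ccontr)
    assume "\<not> ?thesis"
    then have le: "u $ i * real (\<mu> $ i) + u $ i0 * real (\<mu> $ i0) + u $ k * (real (\<mu> $ k) - 1) \<le> u $ i0"
      by (simp add: w algebra_simps)
    have nn: "0 \<le> u $ i * real (\<mu> $ i)" "0 \<le> u $ i0 * real (\<mu> $ i0)" "0 \<le> u $ k * (real (\<mu> $ k) - 1)"
      using u(1) \<mu>(2) by (simp_all add: less_imp_le)
    have i0: "\<mu> $ i = 0"
    proof (rule ccontr)
      assume "\<mu> $ i \<noteq> 0"
      then have "u $ i * 1 \<le> u $ i * real (\<mu> $ i)"
        using u(1)[of i] by (intro mult_left_mono) auto
      then show False
        using le nn gt by linarith
    qed
    have k1: "\<mu> $ k = 1"
    proof (rule ccontr)
      assume "\<mu> $ k \<noteq> 1"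
      then have "u $ k * 1 \<le> u $ k * (real (\<mu> $ k) - 1)"
        using u(1)[of k] \<mu>(2) by (intro mult_left_mono) auto
      then show False
        using le nn gt by linarith
    qed
    have "u $ i0 * real (\<mu> $ i0) \<le> u $ i0 * 1"
      using le nn by linarith
    then have "\<mu> $ i0 \<le> 1"
      using u(1)[of i0] by simp
    moreover have "2 \<le> \<mu> $ i + \<mu> $ i0 + \<mu> $ k"
      using degree_ge_2[OF \<mu>(1)] by (simp add: sum_three[OF ijk])
    ultimately have "\<mu> $ i0 = 1"
      using i0 k1 by simp
    then show False
      using \<mu>(3) i0 k1 by (simp add: vec_eq_three[OF ijk] vec3_nth[OF ijk])
  qed
  then have "dominates S u k (vec3 i i0 0 1 1)"
    using S(2) by (simp add: dominates_def vec3_nth[OF ijk])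
  moreover have "weight u (vec3 i i0 0 1 1) - u $ k \<le> (real n - 1) * u $ i0"
    using n2 by (simp add: w algebra_simps)
  ultimately show ?thesis
    by blast
qed

section \<open>Termwise differentiation\<close>

definition vdeg :: "nat ^ 'n::finite \<Rightarrow> nat" where
  "vdeg \<nu> = (\<Sum>i\<in>UNIV. \<nu> $ i)"

text \<open>The exponent after differentiation. Truncated subtraction is harmless, as it always
  comes with the coefficient \<open>\<nu> $ i\<close>, which is then 0.\<close>

definition lower :: "'n \<Rightarrow> nat ^ 'n::finite \<Rightarrow> nat ^ 'n" where
  "lower i \<nu> = (\<chi> j. if j = i then \<nu> $ j - 1 else \<nu> $ j)"

lemma norm_monomial: "norm (monomial z \<nu>) = (\<Prod>i\<in>UNIV. norm (z $ i) ^ (\<nu> $ i))"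
  by (simp add: monomial_def prod_norm[symmetric] norm_power)

lemma norm_monomial_le:
  assumes "\<And>i. norm (z $ i) \<le> \<rho>"
  shows "norm (monomial z \<nu>) \<le> \<rho> ^ vdeg \<nu>"
  unfolding norm_monomial vdeg_def power_sum
  by (intro prod_mono conjI power_mono assms) auto

lemma monomial_add: "monomial z (\<mu> + \<nu>) = monomial z \<mu> * monomial z \<nu>"
  by (simp add: monomial_def power_add prod.distrib)

lemma vdeg_add: "vdeg (\<mu> + \<nu>) = vdeg \<mu> + vdeg \<nu>"
  by (simp add: vdeg_def sum.distrib)

lemma monomial_update:
  "monomial (\<chi> j. if j = i then t else z $ j) \<nu> = t ^ (\<nu> $ i) * (\<Prod>j\<in>UNIV - {i}. (z $ j) ^ (\<nu> $ j))"
proof -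
  have "(\<Prod>j\<in>UNIV - {i}. (if j = i then t else z $ j) ^ (\<nu> $ j)) = (\<Prod>j\<in>UNIV - {i}. (z $ j) ^ (\<nu> $ j))"
    by (intro prod.cong) auto
  then show ?thesis
    unfolding monomial_def by (subst prod.remove[of UNIV i]) auto
qed

lemma monomial_update_lower:
  "monomial (\<chi> j. if j = i then t else z $ j) (lower i \<nu>) =
    t ^ (\<nu> $ i - 1) * (\<Prod>j\<in>UNIV - {i}. (z $ j) ^ (\<nu> $ j))"
proof -
  have "(\<Prod>j\<in>UNIV - {i}. (z $ j) ^ (lower i \<nu> $ j)) = (\<Prod>j\<in>UNIV - {i}. (z $ j) ^ (\<nu> $ j))"
    by (intro prod.cong) (auto simp: lower_def)
  then show ?thesis
    by (simp add: monomial_update) (simp add: lower_def)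
qed

lemma update_same [simp]: "(\<chi> j. if j = i then z $ i else z $ j) = z"
  by (simp add: vec_eq_iff)

lemma monomial_has_derivative:
  "((\<lambda>t. monomial (\<chi> j. if j = i then t else z $ j) \<nu>) has_field_derivative
     of_nat (\<nu> $ i) * monomial (\<chi> j. if j = i then t else z $ j) (lower i \<nu>)) (at t)"
  unfolding monomial_update_lower unfolding monomial_update
  by (auto intro!: derivative_eq_intros)

text \<open>The finite partial sums converge uniformly on a disc in the chosen variable, so
  holomorphic limits may be differentiated termwise. A general exponent map \<open>E\<close> lets
  the lemma apply to the series of \<open>f\<close> and to those of its derivatives.\<close>

lemma power_family_has_derivative:
  fixes b :: "'b \<Rightarrow> complex" and E :: "'b \<Rightarrow> nat ^ 'n::finite"
  assumes summ: "(\<lambda>\<nu>. norm (b \<nu>) * \<rho> ^ vdeg (E \<nu>)) summable_on UNIV" and z: "\<And>j. norm (z $ j) < \<rho>"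
  obtains D where
    "((\<lambda>t. \<Sum>\<^sub>\<infinity>\<nu>. b \<nu> * monomial (\<chi> j. if j = i then t else z $ j) (E \<nu>)) has_field_derivative D) (at (z $ i))"
    "((\<lambda>\<nu>. of_nat (E \<nu> $ i) * b \<nu> * monomial z (lower i (E \<nu>))) has_sum D) UNIV"
proof -
  define upd where "upd t = (\<chi> j. if j = i then t else z $ j)" for t
  define r where "r = \<rho> - norm (z $ i)"
  have r: "0 < r"
    using z by (simp add: r_def)
  define g where "g t = (\<Sum>\<^sub>\<infinity>\<nu>. b \<nu> * monomial (upd t) (E \<nu>))" for t
  define f where "f X t = (\<Sum>\<nu>\<in>X. b \<nu> * monomial (upd t) (E \<nu>))" for X t
  define f' where "f' X t = (\<Sum>\<nu>\<in>X. of_nat (E \<nu> $ i) * b \<nu> * monomial (upd t) (lower i (E \<nu>)))" for X t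
  have bound: "norm (b \<nu> * monomial (upd t) (E \<nu>)) \<le> norm (b \<nu>) * \<rho> ^ vdeg (E \<nu>)"
    if "t \<in> cball (z $ i) r" for \<nu> t
  proof -
    have "norm t \<le> \<rho>"
      using that norm_triangle_ineq2[of t "z $ i"] by (simp add: r_def dist_norm norm_minus_commute)
    then have "norm (monomial (upd t) (E \<nu>)) \<le> \<rho> ^ vdeg (E \<nu>)"
      using z by (intro norm_monomial_le) (simp add: upd_def less_imp_le)
    then show ?thesis
      by (simp add: norm_mult mult_left_mono)
  qed
  have ulim: "uniform_limit (cball (z $ i) r) f g (finite_subsets_at_top UNIV)"
    unfolding f_def[abs_def] g_def[abs_def] using bound summ by (rule Weierstrass_m_test_general)
  have der: "(f X has_field_derivative f' X t) (at t)" for X t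
  proof -
    have "((\<lambda>t. \<Sum>\<nu>\<in>X. b \<nu> * monomial (upd t) (E \<nu>)) has_field_derivative
      (\<Sum>\<nu>\<in>X. b \<nu> * (of_nat (E \<nu> $ i) * monomial (upd t) (lower i (E \<nu>))))) (at t)"
      unfolding upd_def by (intro DERIV_sum DERIV_cmult monomial_has_derivative)
    then show ?thesis
      unfolding f_def[abs_def] f'_def by (simp add: mult.left_commute mult.assoc)
  qed
  then have "continuous_on (cball (z $ i) r) (f X)" for X
    by (meson DERIV_isCont continuous_at_imp_continuous_on)
  then have "\<forall>\<^sub>F X in finite_subsets_at_top UNIV. continuous_on (cball (z $ i) r) (f X) \<and>
      (\<forall>w\<in>ball (z $ i) r. (f X has_field_derivative f' X w) (at w))"
    using der by simp
  then obtain g' where g': "\<And>w. w \<in> ball (z $ i) r \<Longrightarrow>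
      (g has_field_derivative g' w) (at w) \<and> ((\<lambda>X. f' X w) \<longlongrightarrow> g' w) (finite_subsets_at_top UNIV)"
    by (rule has_complex_derivative_uniform_limit[OF _ ulim finite_subsets_at_top_neq_bot r]) blast
  have upd: "upd (z $ i) = z"
    by (simp add: upd_def)
  show ?thesis
  proof
    show "((\<lambda>t. \<Sum>\<^sub>\<infinity>\<nu>. b \<nu> * monomial (\<chi> j. if j = i then t else z $ j) (E \<nu>)) has_field_derivative g' (z $ i)) (at (z $ i))"
      using g'[of "z $ i"] r by (simp add: g_def[abs_def] upd_def)
    show "((\<lambda>\<nu>. of_nat (E \<nu> $ i) * b \<nu> * monomial z (lower i (E \<nu>))) has_sum g' (z $ i)) UNIV"
      using g'[of "z $ i"] r by (simp add: has_sum_def f'_def upd)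
  qed
qed

lemma power_family_summable:
  fixes b :: "'b \<Rightarrow> complex" and E :: "'b \<Rightarrow> nat ^ 'n::finite"
  assumes summ: "(\<lambda>\<nu>. norm (b \<nu>) * \<rho> ^ vdeg (E \<nu>)) summable_on UNIV" and z: "\<And>j. norm (z $ j) \<le> \<rho>"
  shows "(\<lambda>\<nu>. b \<nu> * monomial z (E \<nu>)) summable_on X"
proof -
  have "(\<lambda>\<nu>. norm (b \<nu> * monomial z (E \<nu>))) summable_on UNIV"
    by (rule summable_on_comparison_test[OF summ])
      (simp_all add: norm_mult mult_left_mono norm_monomial_le[OF z])
  then show ?thesis
    by (rule summable_on_subset_banach[OF abs_summable_summable]) simp
qed

lemma power_family_continuous:
  fixes b :: "'b \<Rightarrow> complex" and E :: "'b \<Rightarrow> nat ^ 'n::finite"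
  assumes summ: "(\<lambda>\<nu>. norm (b \<nu>) * \<rho> ^ vdeg (E \<nu>)) summable_on UNIV"
  shows "continuous_on {z. \<forall>j. norm (z $ j) \<le> \<rho>} (\<lambda>z. \<Sum>\<^sub>\<infinity>\<nu>. b \<nu> * monomial z (E \<nu>))"
proof (rule uniform_limit_theorem)
  show "uniform_limit {z. \<forall>j. norm (z $ j) \<le> \<rho>} (\<lambda>X z. \<Sum>\<nu>\<in>X. b \<nu> * monomial z (E \<nu>))
      (\<lambda>z. \<Sum>\<^sub>\<infinity>\<nu>. b \<nu> * monomial z (E \<nu>)) (finite_subsets_at_top UNIV)"
    by (rule Weierstrass_m_test_general[OF _ summ])
      (simp add: norm_mult mult_left_mono norm_monomial_le)
  show "\<forall>\<^sub>F X in finite_subsets_at_top UNIV.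
      continuous_on {z. \<forall>j. norm (z $ j) \<le> \<rho>} (\<lambda>z. \<Sum>\<nu>\<in>X. b \<nu> * monomial z (E \<nu>))"
    unfolding monomial_def by (intro always_eventually allI continuous_intros)
qed simp

text \<open>Every further exponent is a proper multiple of one in \<open>M\<close>, and its surplus
  factor is small on a small polydisc. \<open>L\<close> compensates for replacing powers of
  \<open>\<sigma>\<close>, \<open>K\<close> sums the coefficients.\<close>

lemma power_family_tail:
  fixes c :: "'b \<Rightarrow> complex" and E :: "'b \<Rightarrow> nat ^ 'n::finite"
  assumes summ: "(\<lambda>\<nu>. norm (c \<nu>) * \<sigma> ^ vdeg (E \<nu>)) summable_on UNIV" and \<sigma>: "0 < \<sigma>" and M: "finite M"
    and cover: "\<And>\<nu>. c \<nu> \<noteq> 0 \<Longrightarrow> \<nu> \<notin> M \<Longrightarrow> \<exists>\<mu>\<in>M. E \<mu> \<le> E \<nu> \<and> E \<mu> \<noteq> E \<nu>" and \<epsilon>: "0 < \<epsilon>"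
  obtains \<delta> where "0 < \<delta>" "\<And>z. (\<And>i. norm (z $ i) \<le> \<delta>) \<Longrightarrow>
    norm ((\<Sum>\<^sub>\<infinity>\<nu>. c \<nu> * monomial z (E \<nu>)) - (\<Sum>\<mu>\<in>M. c \<mu> * monomial z (E \<mu>)))
      \<le> \<epsilon> * (\<Sum>\<mu>\<in>M. norm (monomial z (E \<mu>)))"
proof -
  define K where "K = (\<Sum>\<^sub>\<infinity>\<nu>. norm (c \<nu>) * \<sigma> ^ vdeg (E \<nu>))"
  define L where "L = (\<Sum>\<mu>\<in>M. 1 / \<sigma> ^ vdeg (E \<mu>))"
  have K: "0 \<le> K"
    unfolding K_def using \<sigma> by (intro infsum_nonneg) auto
  have L: "0 \<le> L"
    unfolding L_def using \<sigma> by (intro sum_nonneg) auto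
  \<comment> \<open>Makes \<open>\<delta> / \<sigma> * (L * K)\<close> at most
    \<open>\<epsilon>\<close>; the summand 1 keeps the denominator positive.\<close>
  define \<delta> where "\<delta> = min \<sigma> (\<sigma> * \<epsilon> / (1 + L * K))"
  have LK: "0 < 1 + L * K"
    using K L by (simp add: add_pos_nonneg)
  have \<delta>: "0 < \<delta>" "\<delta> \<le> \<sigma>"
    using \<sigma> \<epsilon> LK by (simp_all add: \<delta>_def)
  have \<delta>LK: "\<delta> / \<sigma> * (L * K) \<le> \<epsilon>"
  proof -
    have "\<delta> / \<sigma> \<le> \<epsilon> / (1 + L * K)"
      using \<sigma> by (simp add: \<delta>_def divide_le_eq min_le_iff_disj)
    then have "\<delta> / \<sigma> * (L * K) \<le> \<epsilon> / (1 + L * K) * (1 + L * K)"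
      using \<delta> \<sigma> \<epsilon> K L LK by (intro mult_mono) auto
    then show ?thesis
      using LK by simp
  qed
  show ?thesis
  proof (rule that[OF \<delta>(1)])
    fix z :: "complex ^ 'n" assume z: "\<And>i. norm (z $ i) \<le> \<delta>"
    define N where "N = (\<Sum>\<mu>\<in>M. norm (monomial z (E \<mu>)))"
    have N: "0 \<le> N"
      unfolding N_def by (intro sum_nonneg) auto
    have z\<sigma>: "norm (z $ i) \<le> \<sigma>" for i
      using z[of i] \<delta> by linarith
    have single: "norm (c \<nu> * monomial z (E \<nu>)) \<le> N * (\<delta> / \<sigma>) * L * (norm (c \<nu>) * \<sigma> ^ vdeg (E \<nu>))" if \<nu>M: "\<nu> \<notin> M" for \<nu>
    proof (cases "c \<nu> = 0")
      case False
      then obtain \<mu> where \<mu>: "\<mu> \<in> M" "E \<mu> \<le> E \<nu>" "E \<mu> \<noteq> E \<nu>"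
        using cover[OF _ \<nu>M] by blast
      define \<kappa> where "\<kappa> = E \<nu> - E \<mu>"
      have split: "E \<nu> = E \<mu> + \<kappa>"
        using \<mu>(2) by (simp add: \<kappa>_def vec_eq_iff less_eq_vec_def)
      have "\<kappa> \<noteq> 0"
        using \<mu>(3) split by auto
      then have "1 \<le> vdeg \<kappa>"
        by (simp add: vdeg_def vec_eq_iff Suc_le_eq sum_nonneg_eq_0_iff neq0_conv[symmetric] del: neq0_conv)
      then have "(\<delta> / \<sigma>) ^ vdeg \<kappa> \<le> (\<delta> / \<sigma>) ^ 1"
        using \<delta> \<sigma> by (intro power_decreasing) auto
      then have "\<delta> ^ vdeg \<kappa> \<le> \<delta> / \<sigma> * \<sigma> ^ vdeg \<kappa>"
        using \<sigma> by (simp add: power_divide divide_le_eq)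
      moreover have "norm (monomial z \<kappa>) \<le> \<delta> ^ vdeg \<kappa>"
        by (rule norm_monomial_le[OF z])
      ultimately have k: "norm (monomial z \<kappa>) \<le> \<delta> / \<sigma> * \<sigma> ^ vdeg \<kappa>"
        by linarith
      have m: "norm (monomial z (E \<mu>)) \<le> N"
        unfolding N_def using M \<mu>(1) by (intro member_le_sum) auto
      have l: "1 / \<sigma> ^ vdeg (E \<mu>) \<le> L"
        unfolding L_def using M \<mu>(1) \<sigma> by (intro member_le_sum) auto
      have "norm (monomial z (E \<nu>)) \<le> N * (\<delta> / \<sigma> * \<sigma> ^ vdeg \<kappa>)"
        unfolding split monomial_add norm_mult using m k N by (intro mult_mono) auto
      also have "\<dots> = N * (\<delta> / \<sigma>) * (1 / \<sigma> ^ vdeg (E \<mu>)) * \<sigma> ^ vdeg (E \<nu>)"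
        using \<sigma> by (simp add: split vdeg_add power_add)
      also have "\<dots> \<le> N * (\<delta> / \<sigma>) * L * \<sigma> ^ vdeg (E \<nu>)"
        using l N \<delta> \<sigma> by (intro mult_right_mono mult_left_mono) auto
      finally have "norm (c \<nu>) * norm (monomial z (E \<nu>)) \<le> norm (c \<nu>) * (N * (\<delta> / \<sigma>) * L * \<sigma> ^ vdeg (E \<nu>))"
        by (rule mult_left_mono) simp
      then show ?thesis
        by (simp add: norm_mult mult_ac)
    qed (use N \<delta> \<sigma> L in simp)
    have sum: "(\<lambda>\<nu>. c \<nu> * monomial z (E \<nu>)) summable_on X" for X
      by (rule power_family_summable[OF summ z\<sigma>])
    have "(\<Sum>\<^sub>\<infinity>\<nu>. c \<nu> * monomial z (E \<nu>)) - (\<Sum>\<mu>\<in>M. c \<mu> * monomial z (E \<mu>)) = (\<Sum>\<^sub>\<infinity>\<nu>\<in>UNIV - M. c \<nu> * monomial z (E \<nu>))"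
      using infsum_Diff[OF sum sum, of M UNIV] M by simp
    also have "norm \<dots> \<le> (\<Sum>\<^sub>\<infinity>\<nu>\<in>UNIV - M. N * (\<delta> / \<sigma>) * L * (norm (c \<nu>) * \<sigma> ^ vdeg (E \<nu>)))"
    proof (rule norm_infsum_le)
      show "((\<lambda>\<nu>. c \<nu> * monomial z (E \<nu>)) has_sum (\<Sum>\<^sub>\<infinity>\<nu>\<in>UNIV - M. c \<nu> * monomial z (E \<nu>))) (UNIV - M)"
        by (rule has_sum_infsum[OF sum])
      show "((\<lambda>\<nu>. N * (\<delta> / \<sigma>) * L * (norm (c \<nu>) * \<sigma> ^ vdeg (E \<nu>))) has_sum
         (\<Sum>\<^sub>\<infinity>\<nu>\<in>UNIV - M. N * (\<delta> / \<sigma>) * L * (norm (c \<nu>) * \<sigma> ^ vdeg (E \<nu>)))) (UNIV - M)"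
        by (intro has_sum_infsum summable_on_cmult_right summable_on_subset_banach[OF summ]) auto
    qed (use single in auto)
    also have "\<dots> = N * (\<delta> / \<sigma>) * L * (\<Sum>\<^sub>\<infinity>\<nu>\<in>UNIV - M. norm (c \<nu>) * \<sigma> ^ vdeg (E \<nu>))"
      by (rule infsum_cmult_right') 
    also have "\<dots> \<le> N * (\<delta> / \<sigma>) * L * K"
    proof (rule mult_left_mono)
      show "(\<Sum>\<^sub>\<infinity>\<nu>\<in>UNIV - M. norm (c \<nu>) * \<sigma> ^ vdeg (E \<nu>)) \<le> K"
        unfolding K_def
        by (rule infsum_mono_neutral) (use \<sigma> summ in \<open>auto intro: summable_on_subset_banach\<close>)
    qed (use N \<delta> \<sigma> L in auto)
    also have "\<dots> = N * (\<delta> / \<sigma> * (L * K))"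
      by (simp add: mult_ac)
    also have "\<dots> \<le> N * \<epsilon>"
      using \<delta>LK N by (rule mult_left_mono)
    finally show "norm ((\<Sum>\<^sub>\<infinity>\<nu>. c \<nu> * monomial z (E \<nu>)) - (\<Sum>\<mu>\<in>M. c \<mu> * monomial z (E \<mu>)))
        \<le> \<epsilon> * (\<Sum>\<mu>\<in>M. norm (monomial z (E \<mu>)))"
      by (simp add: N_def mult.commute)
  qed
qed

text \<open>Halving the radius pays for the factor \<open>\<nu> $ j\<close>, since a number is at
  most the corresponding power of 2.\<close>

lemma derivative_family_summable:
  fixes a :: "nat ^ 'n::finite \<Rightarrow> complex"
  assumes "(\<lambda>\<nu>. norm (a \<nu>) * \<rho> ^ vdeg \<nu>) summable_on UNIV" "0 < \<rho>"
  shows "(\<lambda>\<nu>. norm (of_nat (\<nu> $ j) * a \<nu>) * (\<rho> / 2) ^ vdeg (lower j \<nu>)) summable_on UNIV"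
proof (rule summable_on_comparison_test[OF summable_on_cmult_right[OF assms(1), of "2 / \<rho>"]])
  fix \<nu> :: "nat ^ 'n"
  show "norm (of_nat (\<nu> $ j) * a \<nu>) * (\<rho> / 2) ^ vdeg (lower j \<nu>) \<le> 2 / \<rho> * (norm (a \<nu>) * \<rho> ^ vdeg \<nu>)"
  proof (cases "\<nu> $ j = 0")
    case False
    have "vdeg \<nu> = \<nu> $ j + (\<Sum>i\<in>UNIV - {j}. \<nu> $ i)"
      unfolding vdeg_def by (subst sum.remove[of UNIV j]) auto
    moreover have "vdeg (lower j \<nu>) = (\<nu> $ j - 1) + (\<Sum>i\<in>UNIV - {j}. \<nu> $ i)"
      unfolding vdeg_def by (subst sum.remove[of UNIV j]) (auto simp: lower_def intro!: sum.cong)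
    ultimately have v: "vdeg \<nu> = Suc (vdeg (lower j \<nu>))" "\<nu> $ j \<le> vdeg \<nu>"
      using False by simp_all
    have "vdeg \<nu> \<le> 2 ^ vdeg \<nu>"
      by (rule less_imp_le[OF less_exp])
    then have "real (\<nu> $ j) \<le> 2 ^ vdeg \<nu>"
      using v(2) by (metis of_nat_le_iff of_nat_numeral of_nat_power order.trans)
    then have "real (\<nu> $ j) * (\<rho> / 2) ^ vdeg (lower j \<nu>) \<le> 2 ^ vdeg \<nu> * (\<rho> / 2) ^ vdeg (lower j \<nu>)"
      using assms(2) by (intro mult_right_mono) auto
    also have "\<dots> = 2 / \<rho> * \<rho> ^ vdeg \<nu>"
      using assms(2) by (simp add: v(1) power_divide)
    finally have "norm (a \<nu>) * (real (\<nu> $ j) * (\<rho> / 2) ^ vdeg (lower j \<nu>)) \<le> norm (a \<nu>) * (2 / \<rho> * \<rho> ^ vdeg \<nu>)"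
      by (rule mult_left_mono) simp
    then show ?thesis
      by (simp add: norm_mult mult_ac)
  qed (use assms in simp)
qed (use assms in simp)

lemma taylor_expansion_gradient:
  fixes f :: "complex ^ 'n::finite \<Rightarrow> complex"
  assumes "has_taylor_expansion f a"
  obtains \<rho> where "0 < \<rho>"
    "\<And>j. (\<lambda>\<nu>. norm (of_nat (\<nu> $ j) * a \<nu>) * \<rho> ^ vdeg (lower j \<nu>)) summable_on UNIV"
    "\<And>z j. (\<And>i. norm (z $ i) \<le> \<rho>) \<Longrightarrow>
      gradient f z $ j = (\<Sum>\<^sub>\<infinity>\<nu>. of_nat (\<nu> $ j) * a \<nu> * monomial z (lower j \<nu>))"
    "\<And>z. (\<And>i. norm (z $ i) \<le> \<rho>) \<Longrightarrow> f z = (\<Sum>\<^sub>\<infinity>\<nu>. a \<nu> * monomial z \<nu>)"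
proof -
  obtain r where r: "0 < r" "\<And>z. norm z < r \<Longrightarrow> ((\<lambda>\<nu>. a \<nu> * monomial z \<nu>) has_sum f z) UNIV"
    using assms unfolding has_taylor_expansion_def by blast
  \<comment> \<open>The closed polydisc of this radius lies in the ball of convergence; summability
    is read off at its corner with all coordinates \<open>\<rho>\<close>.\<close>
  define \<rho> where "\<rho> = r / (2 * real CARD('n))"
  have \<rho>: "0 < \<rho>"
    using r by (simp add: \<rho>_def)
  have small: "norm z < r" if "\<And>i. norm (z $ i) \<le> \<rho>" for z :: "complex ^ 'n"
  proof -
    have "norm z \<le> (\<Sum>i\<in>UNIV. norm (z $ i))"
      by (simp add: norm_vec_def L2_set_le_sum)
    also have "\<dots> \<le> (\<Sum>i\<in>(UNIV :: 'n set). \<rho>)"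
      by (intro sum_mono that)
    also have "\<dots> = r / 2"
      by (simp add: \<rho>_def)
    finally show ?thesis
      using r(1) by simp
  qed
  have f: "f z = (\<Sum>\<^sub>\<infinity>\<nu>. a \<nu> * monomial z \<nu>)" if "\<And>i. norm (z $ i) \<le> \<rho>" for z
    using r(2)[OF small[OF that]] by (simp add: infsumI)
  have summ: "(\<lambda>\<nu>. norm (a \<nu>) * \<rho> ^ vdeg \<nu>) summable_on UNIV"
  proof -
    define p :: "complex ^ 'n" where "p = (\<chi> i. of_real \<rho>)"
    have "(\<lambda>\<nu>. a \<nu> * monomial p \<nu>) summable_on UNIV"
      using r(2)[of p] small[of p] \<rho> by (auto simp: p_def summable_on_def)
    then have "(\<lambda>\<nu>. norm (a \<nu> * monomial p \<nu>)) summable_on UNIV"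
      by (simp add: summable_on_iff_abs_summable_on_complex)
    moreover have "norm (a \<nu> * monomial p \<nu>) = norm (a \<nu>) * \<rho> ^ vdeg \<nu>" for \<nu>
      using \<rho> by (simp add: norm_mult norm_monomial p_def vdeg_def power_sum)
    ultimately show ?thesis
      by simp
  qed
  have grad: "gradient f z $ j = (\<Sum>\<^sub>\<infinity>\<nu>. of_nat (\<nu> $ j) * a \<nu> * monomial z (lower j \<nu>))"
    if z: "\<And>i. norm (z $ i) \<le> \<rho> / 2" for z j
  proof -
    have z': "norm (z $ i) < \<rho>" for i
      using z[of i] \<rho> by linarith
    obtain D where D: "((\<lambda>t. \<Sum>\<^sub>\<infinity>\<nu>. a \<nu> * monomial (\<chi> i. if i = j then t else z $ i) \<nu>) has_field_derivative D) (at (z $ j))"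
      "((\<lambda>\<nu>. of_nat (\<nu> $ j) * a \<nu> * monomial z (lower j \<nu>)) has_sum D) UNIV"
      by (rule power_family_has_derivative[OF summ z'])
    have "((\<lambda>t. f (\<chi> i. if i = j then t else z $ i)) has_field_derivative D) (at (z $ j))"
    proof (rule has_field_derivative_transform_within_open[OF D(1), of "ball 0 \<rho>"])
      show "(\<Sum>\<^sub>\<infinity>\<nu>. a \<nu> * monomial (\<chi> i. if i = j then t else z $ i) \<nu>) = f (\<chi> i. if i = j then t else z $ i)"
        if "t \<in> ball 0 \<rho>" for t
        using that z' by (intro f[symmetric]) (simp add: less_imp_le)
    qed (use z' in auto)
    then show ?thesis
      using D(2) by (simp add: gradient_def partial_deriv_def DERIV_imp_deriv infsumI)
  qed
  show ?thesis
  proof (rule that[of "\<rho> / 2"])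
    show "f z = (\<Sum>\<^sub>\<infinity>\<nu>. a \<nu> * monomial z \<nu>)" if "\<And>i. norm (z $ i) \<le> \<rho> / 2" for z
      using \<rho> by (intro f order.trans[OF that]) simp
  qed (use \<rho> derivative_family_summable[OF summ \<rho>] grad in auto)
qed

lemma lower_mono: "\<mu> \<le> \<nu> \<Longrightarrow> lower j \<mu> \<le> lower j \<nu>"
  by (auto simp: less_eq_vec_def lower_def intro: diff_le_mono)

lemma lower_inject:
  assumes "1 \<le> \<mu> $ j" "1 \<le> \<nu> $ j" "lower j \<mu> = lower j \<nu>"
  shows "\<mu> = \<nu>"
proof -
  have "\<mu> $ i = \<nu> $ i" for i
  proof -
    have "lower j \<mu> $ i = lower j \<nu> $ i"
      using assms(3) by simp
    then show ?thesis
      using assms(1,2) by (cases "i = j") (simp_all add: lower_def)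
  qed
  then show ?thesis
    by (simp add: vec_eq_iff)
qed

text \<open>A single finite set serves all derivatives: the union of Dickson sets of the exponents
  divisible by each variable. The error is relative to the sum of the absolute values of the
  monomials, so the estimate survives cancellation among them.\<close>

lemma gradient_approx:
  fixes f :: "complex ^ 'n::finite \<Rightarrow> complex"
  assumes f: "has_taylor_expansion f a"
  obtains M where "finite M" "M \<subseteq> supp a"
    "\<And>j \<nu>. \<nu> \<in> supp a \<Longrightarrow> 1 \<le> \<nu> $ j \<Longrightarrow> \<exists>\<mu>\<in>M. 1 \<le> \<mu> $ j \<and> \<mu> \<le> \<nu>"
    "\<And>\<epsilon> j. 0 < \<epsilon> \<Longrightarrow> \<exists>\<delta>>0. \<forall>z. (\<forall>i. norm (z $ i) \<le> \<delta>) \<longrightarrow>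
      norm (gradient f z $ j - (\<Sum>\<mu>\<in>{\<mu>\<in>M. 1 \<le> \<mu> $ j}. of_nat (\<mu> $ j) * a \<mu> * monomial z (lower j \<mu>)))
        \<le> \<epsilon> * (\<Sum>\<mu>\<in>{\<mu>\<in>M. 1 \<le> \<mu> $ j}. norm (monomial z (lower j \<mu>)))"
proof -
  obtain \<rho> where \<rho>: "0 < \<rho>"
    "\<And>j. (\<lambda>\<nu>. norm (of_nat (\<nu> $ j) * a \<nu>) * \<rho> ^ vdeg (lower j \<nu>)) summable_on UNIV"
    "\<And>z j. (\<And>i. norm (z $ i) \<le> \<rho>) \<Longrightarrow>
      gradient f z $ j = (\<Sum>\<^sub>\<infinity>\<nu>. of_nat (\<nu> $ j) * a \<nu> * monomial z (lower j \<nu>))"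
    by (rule taylor_expansion_gradient[OF f]) blast
  have "\<exists>M. finite M \<and> M \<subseteq> {\<nu> \<in> supp a. 1 \<le> \<nu> $ j} \<and> (\<forall>\<nu>\<in>supp a. 1 \<le> \<nu> $ j \<longrightarrow> (\<exists>\<mu>\<in>M. \<mu> \<le> \<nu>))" for j
    by (rule dickson[of "{\<nu> \<in> supp a. 1 \<le> \<nu> $ j}"]) auto
  then obtain Mj where Mj: "\<And>j. finite (Mj j)" "\<And>j. Mj j \<subseteq> {\<nu> \<in> supp a. 1 \<le> \<nu> $ j}"
    "\<And>j \<nu>. \<nu> \<in> supp a \<Longrightarrow> 1 \<le> \<nu> $ j \<Longrightarrow> \<exists>\<mu>\<in>Mj j. \<mu> \<le> \<nu>"
    by metis
  define M where "M = (\<Union>j. Mj j)"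
  have cov: "\<exists>\<mu>\<in>M. 1 \<le> \<mu> $ j \<and> \<mu> \<le> \<nu>" if "\<nu> \<in> supp a" "1 \<le> \<nu> $ j" for j \<nu>
    using Mj(3)[OF that] Mj(2) by (fastforce simp: M_def)
  have finM: "finite M"
    using Mj(1) by (simp add: M_def)
  show ?thesis
  proof (rule that[OF finM _ cov])
    show "M \<subseteq> supp a"
      using Mj(2) by (auto simp: M_def)
    fix \<epsilon> :: real and j assume \<epsilon>: "0 < \<epsilon>"
    have "\<exists>\<mu>\<in>{\<mu>\<in>M. 1 \<le> \<mu> $ j}. lower j \<mu> \<le> lower j \<nu> \<and> lower j \<mu> \<noteq> lower j \<nu>"
      if "of_nat (\<nu> $ j) * a \<nu> \<noteq> 0" "\<nu> \<notin> {\<mu>\<in>M. 1 \<le> \<mu> $ j}" for \<nu>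
    proof -
      have \<nu>: "\<nu> \<in> supp a" "1 \<le> \<nu> $ j"
        using that(1) by (auto simp: supp_def)
      then obtain \<mu> where "\<mu> \<in> M" "1 \<le> \<mu> $ j" "\<mu> \<le> \<nu>"
        using cov by blast
      then show ?thesis
        using lower_mono[of \<mu> \<nu> j] lower_inject[of \<mu> j \<nu>] \<nu>(2) that(2) by blast
    qed
    then obtain \<delta> where \<delta>: "0 < \<delta>" "\<And>z. (\<And>i. norm (z $ i) \<le> \<delta>) \<Longrightarrow>
      norm ((\<Sum>\<^sub>\<infinity>\<nu>. of_nat (\<nu> $ j) * a \<nu> * monomial z (lower j \<nu>)) -
        (\<Sum>\<mu>\<in>{\<mu>\<in>M. 1 \<le> \<mu> $ j}. of_nat (\<mu> $ j) * a \<mu> * monomial z (lower j \<mu>)))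
      \<le> \<epsilon> * (\<Sum>\<mu>\<in>{\<mu>\<in>M. 1 \<le> \<mu> $ j}. norm (monomial z (lower j \<mu>)))"
      using power_family_tail[OF \<rho>(2) \<rho>(1), of "{\<mu>\<in>M. 1 \<le> \<mu> $ j}" j \<epsilon>] finM \<epsilon> by auto
    show "\<exists>\<delta>>0. \<forall>z. (\<forall>i. norm (z $ i) \<le> \<delta>) \<longrightarrow>
      norm (gradient f z $ j - (\<Sum>\<mu>\<in>{\<mu>\<in>M. 1 \<le> \<mu> $ j}. of_nat (\<mu> $ j) * a \<mu> * monomial z (lower j \<mu>)))
        \<le> \<epsilon> * (\<Sum>\<mu>\<in>{\<mu>\<in>M. 1 \<le> \<mu> $ j}. norm (monomial z (lower j \<mu>)))"
    proof (intro exI[of _ "min \<rho> \<delta>"] conjI allI impI)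
      show "0 < min \<rho> \<delta>"
        using \<rho>(1) \<delta>(1) by simp
      fix z :: "complex ^ 'n" assume "\<forall>i. norm (z $ i) \<le> min \<rho> \<delta>"
      then have "\<And>i. norm (z $ i) \<le> \<rho>" "\<And>i. norm (z $ i) \<le> \<delta>"
        by simp_all
      then show "norm (gradient f z $ j - (\<Sum>\<mu>\<in>{\<mu>\<in>M. 1 \<le> \<mu> $ j}. of_nat (\<mu> $ j) * a \<mu> * monomial z (lower j \<mu>)))
        \<le> \<epsilon> * (\<Sum>\<mu>\<in>{\<mu>\<in>M. 1 \<le> \<mu> $ j}. norm (monomial z (lower j \<mu>)))"
        using \<rho>(3) \<delta>(2) by simp
    qed
  qed
qed

section \<open>The support of an isolated singularity\<close>

lemma infsum_single:
  fixes g :: "'b \<Rightarrow> 'c::{comm_monoid_add, t2_space}"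
  assumes "\<And>x. x \<noteq> x0 \<Longrightarrow> g x = 0"
  shows "(\<Sum>\<^sub>\<infinity>x. g x) = g x0"
proof -
  have "(\<Sum>\<^sub>\<infinity>x. g x) = (\<Sum>\<^sub>\<infinity>x\<in>{x0}. g x)"
    by (rule infsum_cong_neutral) (use assms in auto)
  then show ?thesis
    by simp
qed

lemma monomial_eq_0: "z $ i = 0 \<Longrightarrow> 1 \<le> \<nu> $ i \<Longrightarrow> monomial z \<nu> = 0"
  unfolding monomial_def by (rule prod_zero) (auto intro!: bexI[of _ i])

lemma monomial_0_exponent [simp]: "monomial z 0 = 1"
  by (simp add: monomial_def)

lemma gradient_continuous:
  fixes f :: "complex ^ 'n::finite \<Rightarrow> complex"
  assumes f: "has_taylor_expansion f a"
  obtains r where "0 < r" "continuous_on (ball 0 r) (gradient f)"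
proof -
  obtain \<rho> where \<rho>: "0 < \<rho>"
    "\<And>j. (\<lambda>\<nu>. norm (of_nat (\<nu> $ j) * a \<nu>) * \<rho> ^ vdeg (lower j \<nu>)) summable_on UNIV"
    "\<And>z j. (\<And>i. norm (z $ i) \<le> \<rho>) \<Longrightarrow>
      gradient f z $ j = (\<Sum>\<^sub>\<infinity>\<nu>. of_nat (\<nu> $ j) * a \<nu> * monomial z (lower j \<nu>))"
    by (rule taylor_expansion_gradient[OF f]) blast
  have small: "norm (z $ i) \<le> \<rho>" if "z \<in> ball 0 \<rho>" for z :: "complex ^ 'n" and i
  proof -
    have "norm (z $ i) \<le> norm z"
      by (rule Finite_Cartesian_Product.norm_nth_le)
    then show ?thesis
      using that by simp
  qed
  have "continuous_on (ball 0 \<rho>) (\<lambda>z. gradient f z $ j)" for j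
  proof -
    have "continuous_on (ball 0 \<rho>) (\<lambda>z. \<Sum>\<^sub>\<infinity>\<nu>. of_nat (\<nu> $ j) * a \<nu> * monomial z (lower j \<nu>))"
      by (rule continuous_on_subset[OF power_family_continuous[OF \<rho>(2)]]) (use small in auto)
    then show ?thesis
      by (rule continuous_on_eq) (use \<rho>(3) small in auto)
  qed
  then have "continuous_on (ball 0 \<rho>) (\<lambda>z. \<chi> j. gradient f z $ j)"
    by (rule continuous_on_vec_lambda)
  then show ?thesis
    using that[OF \<rho>(1)] by simp
qed

text \<open>Low degrees are absent because \<open>f\<close> and its gradient vanish at 0. Without an
  exponent near an axis the gradient vanishes along that axis. If \<open>z_k\<close> divided
  \<open>f\<close>, the gradient would vanish wherever the quotient does on the plane
  \<open>z_k = 0\<close>; the quotient vanishes at 0, and zeros of a holomorphic function of two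
  variables are not isolated.\<close>

lemma isolated_support_supp:
  fixes f :: "complex ^ 3 \<Rightarrow> complex"
  assumes f: "has_taylor_expansion f a" and iso: "isolated_singularity f"
  shows "isolated_support (supp a)"
proof -
  obtain \<rho> where \<rho>: "0 < \<rho>"
    "\<And>j. (\<lambda>\<nu>. norm (of_nat (\<nu> $ j) * a \<nu>) * \<rho> ^ vdeg (lower j \<nu>)) summable_on UNIV"
    "\<And>z j. (\<And>i. norm (z $ i) \<le> \<rho>) \<Longrightarrow>
      gradient f z $ j = (\<Sum>\<^sub>\<infinity>\<nu>. of_nat (\<nu> $ j) * a \<nu> * monomial z (lower j \<nu>))"
    "\<And>z. (\<And>i. norm (z $ i) \<le> \<rho>) \<Longrightarrow> f z = (\<Sum>\<^sub>\<infinity>\<nu>. a \<nu> * monomial z \<nu>)"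
    by (rule taylor_expansion_gradient[OF f]) blast
  have f0: "f 0 = 0" "gradient f 0 = 0"
    using iso by (auto simp: isolated_singularity_def is_singularity_def)
  obtain r where r: "0 < r" "\<And>z. z \<noteq> 0 \<Longrightarrow> norm z < r \<Longrightarrow> gradient f z \<noteq> 0"
    using iso by (auto simp: isolated_singularity_def eventually_at dist_norm)
  have grad0: "gradient f z $ j = 0"
    if z: "\<And>i. norm (z $ i) \<le> \<rho>" "\<And>\<nu>. \<nu> \<in> supp a \<Longrightarrow> 1 \<le> \<nu> $ j \<Longrightarrow> \<exists>l. z $ l = 0 \<and> 1 \<le> lower j \<nu> $ l" for z j
  proof -
    have "of_nat (\<nu> $ j) * a \<nu> * monomial z (lower j \<nu>) = 0" for \<nu>
    proof (cases "\<nu> \<in> supp a \<and> 1 \<le> \<nu> $ j")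
      case True
      then obtain l where "z $ l = 0" "1 \<le> lower j \<nu> $ l"
        using z(2) by blast
      then show ?thesis
        by (simp add: monomial_eq_0[of z l])
    qed (auto simp: supp_def)
    then show ?thesis
      unfolding \<rho>(3)[OF z(1)] by (simp only: infsum_0_simp)
  qed
  have monomial0: "monomial (0 :: complex ^ 3) \<nu> = 0" if "\<nu> \<noteq> 0" for \<nu>
  proof -
    obtain i where "\<nu> $ i \<noteq> 0"
      using \<open>\<nu> \<noteq> 0\<close> by (auto simp: vec_eq_iff)
    then show ?thesis
      by (intro monomial_eq_0[of _ i]) auto
  qed
  have a0: "a 0 = 0"
  proof -
    have "f 0 = (\<Sum>\<^sub>\<infinity>\<nu>. a \<nu> * monomial 0 \<nu>)"
      using \<rho>(1) by (intro \<rho>(4)) simp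
    also have "\<dots> = a 0 * monomial (0 :: complex ^ 3) 0"
      by (rule infsum_single[of 0 "\<lambda>\<nu>. a \<nu> * monomial 0 \<nu>"]) (simp add: monomial0)
    finally show ?thesis
      using f0 by simp
  qed
  have a1: "a (axis j 1) = 0" for j
  proof -
    have lax: "lower j (axis j 1) = 0" and ax: "axis j 1 $ j = (1 :: nat)"
      by (simp_all add: lower_def vec_eq_iff axis_def)
    have low: "of_nat (\<nu> $ j) * a \<nu> * monomial 0 (lower j \<nu>) = 0" if \<nu>: "\<nu> \<noteq> axis j 1" for \<nu>
    proof (cases "\<nu> $ j = 0")
      case False
      have "lower j \<nu> \<noteq> 0"
      proof
        assume "lower j \<nu> = 0"
        then have "lower j \<nu> = lower j (axis j 1)"
          unfolding lax .
        moreover have "1 \<le> \<nu> $ j" "1 \<le> (axis j 1 :: nat ^ 3) $ j"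
          using False ax by linarith+
        ultimately have "\<nu> = axis j 1"
          by (intro lower_inject[of \<nu> j])
        then show False
          using \<nu> by simp
      qed
      then show ?thesis
        by (simp add: monomial0)
    qed simp
    have "gradient f 0 $ j = (\<Sum>\<^sub>\<infinity>\<nu>. of_nat (\<nu> $ j) * a \<nu> * monomial 0 (lower j \<nu>))"
      using \<rho>(1) by (intro \<rho>(3)) simp
    also have "\<dots> = of_nat (axis j 1 $ j) * a (axis j 1) * monomial 0 (lower j (axis j 1))"
      by (rule infsum_single[of "axis j 1" "\<lambda>\<nu>. of_nat (\<nu> $ j) * a \<nu> * monomial 0 (lower j \<nu>)"]) (rule low)
    finally have "gradient f 0 $ j = a (axis j 1)"
      unfolding lax ax by simp
    then show ?thesis
      using f0 by simp
  qed
  have deg: "2 \<le> (\<Sum>l\<in>UNIV. \<nu> $ l)" if "\<nu> \<in> supp a" for \<nu>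
  proof (rule ccontr)
    assume "\<not> 2 \<le> (\<Sum>l\<in>UNIV. \<nu> $ l)"
    then have le: "(\<Sum>l\<in>UNIV. \<nu> $ l) \<le> 1"
      by simp
    have "\<nu> \<noteq> 0"
      using that a0 by (auto simp: supp_def)
    then obtain j where j: "\<nu> $ j \<noteq> 0"
      by (auto simp: vec_eq_iff)
    have split: "\<nu> $ j + (\<Sum>l\<in>UNIV - {j}. \<nu> $ l) \<le> 1"
      using le by (subst (asm) sum.remove[of UNIV j]) auto
    then have "\<nu> $ j = 1" "(\<Sum>l\<in>UNIV - {j}. \<nu> $ l) = 0"
      using j by linarith+
    then have "\<nu> = axis j 1"
      by (auto simp: vec_eq_iff axis_def)
    then show False
      using that a1 by (simp add: supp_def)
  qed
  show ?thesis
  proof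
    show "2 \<le> (\<Sum>l\<in>UNIV. \<nu> $ l)" if "\<nu> \<in> supp a" for \<nu>
      by (rule deg[OF that])
    show "\<exists>\<nu>\<in>supp a. (\<Sum>l\<in>UNIV - {i}. \<nu> $ l) \<le> 1" for i
    proof (rule ccontr)
      assume no: "\<not> (\<exists>\<nu>\<in>supp a. (\<Sum>l\<in>UNIV - {i}. \<nu> $ l) \<le> 1)"
      define s where "s = min \<rho> (r / 2)"
      have s: "0 < s" "s \<le> \<rho>" "s < r"
        using \<rho>(1) r(1) by (auto simp: s_def)
      define z :: "complex ^ 3" where "z = axis i (of_real s)"
      have sq: "(norm (z $ l))\<^sup>2 = (if l = i then s\<^sup>2 else 0)" for l
        using s by (simp add: z_def axis_def)
      have "norm z = s"
        using s by (simp add: norm_vec_def L2_set_def sq)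
      then have "z \<noteq> 0"
        using s by auto
      have "gradient f z $ j = 0" for j
      proof (rule grad0)
        show "norm (z $ l) \<le> \<rho>" for l
          using s \<rho>(1) by (auto simp: z_def axis_def)
        fix \<nu> assume \<nu>: "\<nu> \<in> supp a" "1 \<le> \<nu> $ j"
        then have ge: "2 \<le> (\<Sum>l\<in>UNIV - {i}. \<nu> $ l)"
          using no by force
        \<comment> \<open>Differentiation lowers one entry by one, and the entries away from
          \<open>i\<close> sum to at least 2.\<close>
        have "\<exists>l\<in>UNIV - {i}. 1 \<le> lower j \<nu> $ l"
        proof (rule ccontr)
          assume no: "\<not> ?thesis"
          have "\<nu> $ l \<le> (if l = j then 1 else 0)" if "l \<in> UNIV - {i}" for l
            using no that by (auto simp: lower_def split: if_splits)
          then have "(\<Sum>l\<in>UNIV - {i}. \<nu> $ l) \<le> (\<Sum>l\<in>UNIV - {i}. if l = j then 1 else 0)"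
            by (rule sum_mono)
          also have "\<dots> \<le> 1"
            by simp
          finally show False
            using ge by simp
        qed
        then show "\<exists>l. z $ l = 0 \<and> 1 \<le> lower j \<nu> $ l"
          by (auto simp: z_def axis_def)
      qed
      then have "gradient f z = 0"
        by (simp add: vec_eq_iff)
      then show False
        using r(2)[OF \<open>z \<noteq> 0\<close>] \<open>norm z = s\<close> s by simp
    qed
    show "\<exists>\<nu>\<in>supp a. \<nu> $ k = 0" for k
    proof (rule ccontr)
      assume no: "\<not> (\<exists>\<nu>\<in>supp a. \<nu> $ k = 0)"
      obtain i where ki: "k \<noteq> i"
        by (rule exists_other)
      obtain j where j: "k \<noteq> j" "i \<noteq> j"
        by (rule exists_third[OF ki])
      note kij = ki j
      define p where "p x y = vec3 k i 0 x (y :: complex)" for x y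
      have p: "p x y $ k = 0" "p x y $ i = x" "p x y $ j = y" for x y
        by (simp_all add: p_def vec3_nth[OF kij])
      have p_le: "norm (p x y $ l) \<le> s" if "norm x \<le> s" "norm y \<le> s" for x y s l
        using that order.trans[OF norm_ge_zero that(1)] by (auto simp: p_def vec3_def)
      have p_norm: "norm (p x y) \<le> norm x + norm y" for x y
        using L2_set_le_sum[of UNIV "\<lambda>l. norm (p x y $ l)"] norm_ge_zero
        by (simp add: norm_vec_def sum_three[OF kij] p)
      \<comment> \<open>The restriction of \<open>f / z_k\<close> to the plane
        \<open>z_k = 0\<close>, which is there the only derivative of \<open>f\<close> that can be
        nonzero.\<close>
      define G where "G x y = (\<Sum>\<^sub>\<infinity>\<nu>. of_nat (\<nu> $ k) * a \<nu> * monomial (p x y) (lower k \<nu>))" for x y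
      define s where "s = min (\<rho> / 2) (r / 3)"
      have s: "0 < s" "s < \<rho>" "s + s < r"
        using \<rho>(1) r(1) by (auto simp: s_def)
      have G0: "G x y \<noteq> 0" if "norm x \<le> s" "norm y \<le> s" "x \<noteq> 0 \<or> y \<noteq> 0" for x y
      proof
        assume "G x y = 0"
        have small: "\<And>l. norm (p x y $ l) \<le> \<rho>"
          using p_le[OF that(1,2)] s by (meson less_imp_le order.trans)
        have "gradient f (p x y) $ l = 0" for l
        proof (cases "l = k")
          case True
          then show ?thesis
            using \<rho>(3)[OF small] \<open>G x y = 0\<close> by (simp add: G_def)
        next
          case False
          show ?thesis
          proof (rule grad0[OF small])
            fix \<nu> assume "\<nu> \<in> supp a" "1 \<le> \<nu> $ l"
            then show "\<exists>m. p x y $ m = 0 \<and> 1 \<le> lower l \<nu> $ m"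
              using no False by (intro exI[of _ k]) (auto simp: p lower_def)
          qed
        qed
        then have "gradient f (p x y) = 0"
          by (simp add: vec_eq_iff)
        moreover have "p x y \<noteq> 0"
          using that(3) p(2)[of x y] p(3)[of x y] by auto
        moreover have "norm (p x y) < r"
          using p_norm[of x y] that s by linarith
        ultimately show False
          using r(2) by blast
      qed
      have G00: "G 0 0 = 0"
      proof -
        have "p 0 0 = 0"
          by (simp add: p_def vec3_def vec_eq_iff)
        then show ?thesis
          using \<rho>(3)[of 0 k] \<rho>(1) f0 by (simp add: G_def)
      qed
      have contp: "continuous_on X (\<lambda>w. p (fst w) (snd w))" for X
        unfolding p_def vec3_def
      proof (rule continuous_on_vec_lambda)
        fix l
        show "continuous_on X (\<lambda>w. if l = k then 0 else if l = i then fst w else snd w)"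
          by (cases "l = k"; cases "l = i") (auto intro!: continuous_intros)
      qed
      have contG: "continuous_on (cball 0 s \<times> cball 0 s) (\<lambda>w. G (fst w) (snd w))"
      proof -
        have "continuous_on (cball 0 s \<times> cball 0 s)
            ((\<lambda>z. \<Sum>\<^sub>\<infinity>\<nu>. of_nat (\<nu> $ k) * a \<nu> * monomial z (lower k \<nu>)) \<circ> (\<lambda>w. p (fst w) (snd w)))"
        proof (rule continuous_on_compose[OF contp continuous_on_subset[OF power_family_continuous[OF \<rho>(2)]]])
          show "(\<lambda>w. p (fst w) (snd w)) ` (cball 0 s \<times> cball 0 s) \<subseteq> {z. \<forall>j. norm (z $ j) \<le> \<rho>}"
            using s by (auto intro!: order.trans[OF p_le[where s = s]])
        qed
        then show ?thesis
          by (simp add: G_def comp_def)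
      qed
      have holG: "(\<lambda>x. G x y) field_differentiable (at x)" if "norm x < s" "norm y \<le> s" for x y
      proof -
        have "norm (p x y $ l) < \<rho>" for l
          using p_le[of x s y l] that s by simp
        then obtain D where
          "((\<lambda>t. \<Sum>\<^sub>\<infinity>\<nu>. (of_nat (\<nu> $ k) * a \<nu>) * monomial (\<chi> l. if l = i then t else p x y $ l) (lower k \<nu>)) has_field_derivative D) (at (p x y $ i))"
          by (rule power_family_has_derivative[OF \<rho>(2)[of k]])
        moreover have "(\<chi> l. if l = i then t else p x y $ l) = p t y" for t
          using kij by (auto simp: vec_eq_iff p_def vec3_def)
        ultimately show ?thesis
          unfolding field_differentiable_def by (auto simp: G_def p)
      qed
      obtain x0 where x0: "x0 \<in> sphere 0 s" "\<And>x. x \<in> sphere 0 s \<Longrightarrow> norm (G x0 0) \<le> norm (G x 0)"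
      proof -
        have "continuous_on (sphere 0 s) (\<lambda>x. norm (G x 0))"
        proof -
          have "continuous_on (sphere 0 s) ((\<lambda>w. G (fst w) (snd w)) \<circ> (\<lambda>x. (x, 0)))"
            by (rule continuous_on_compose) (use s in \<open>auto intro!: continuous_intros continuous_on_subset[OF contG]\<close>)
          then show ?thesis
            by (simp add: comp_def continuous_on_norm)
        qed
        moreover have "sphere (0 :: complex) s \<noteq> {}"
          using s by simp
        ultimately show ?thesis
          using continuous_attains_inf[OF compact_sphere] that by blast
      qed
      define d where "d = norm (G x0 0)"
      have d: "0 < d"
        using G0[of x0 0] x0(1) s by (auto simp: d_def)
      have "uniformly_continuous_on (cball 0 s \<times> cball 0 s) (\<lambda>w. G (fst w) (snd w))"
        by (intro compact_uniformly_continuous contG compact_Times compact_cball)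
      then obtain \<eta> where \<eta>: "0 < \<eta>" "\<And>w w'. w \<in> cball 0 s \<times> cball 0 s \<Longrightarrow> w' \<in> cball 0 s \<times> cball 0 s \<Longrightarrow>
          dist w' w < \<eta> \<Longrightarrow> dist (G (fst w') (snd w')) (G (fst w) (snd w)) < d / 2"
        using d unfolding uniformly_continuous_on_def by (metis half_gt_zero)
      define y :: complex where "y = of_real (min s (\<eta> / 2))"
      have y: "norm y \<le> s" "norm y < \<eta>" "y \<noteq> 0"
        using s \<eta>(1) by (auto simp: y_def)
      have close: "norm (G x y - G x 0) < d / 2" if "norm x \<le> s" for x
        using \<eta>(2)[of "(x, 0)" "(x, y)"] that y s by (simp add: dist_Pair_Pair dist_norm)
      \<comment> \<open>For fixed small nonzero \<open>y\<close> the function \<open>1 / G\<close>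
        has no pole in the disc and is at most \<open>2 / d\<close> on its boundary, but at the
        centre \<open>G\<close> is already smaller than \<open>d / 2\<close>.\<close>
      have "norm (inverse (G 0 y)) \<le> 2 / d"
      proof (rule maximum_modulus_frontier[of "\<lambda>x. inverse (G x y)" "cball 0 s"])
        show "(\<lambda>x. inverse (G x y)) holomorphic_on interior (cball 0 s)"
        proof -
          have "(\<lambda>x. G x y) holomorphic_on ball 0 s"
            unfolding holomorphic_on_def using holG y(1)
            by (auto intro: field_differentiable_at_within)
          then show ?thesis
            unfolding interior_cball by (rule holomorphic_on_inverse) (use G0 y in auto)
        qed
        have "continuous_on (cball 0 s) ((\<lambda>w. G (fst w) (snd w)) \<circ> (\<lambda>x. (x, y)))"
          by (rule continuous_on_compose) (use y in \<open>auto intro!: continuous_intros continuous_on_subset[OF contG]\<close>)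
        then show "continuous_on (closure (cball 0 s)) (\<lambda>x. inverse (G x y))"
          using G0 y by (auto simp: comp_def intro!: continuous_on_inverse)
        fix x assume "x \<in> frontier (cball (0 :: complex) s)"
        then have x: "x \<in> sphere 0 s"
          using s by (simp add: frontier_cball)
        then have "d \<le> norm (G x 0)" "norm (G x y - G x 0) < d / 2"
          using x0(2) close by (auto simp: d_def)
        then have "d / 2 \<le> norm (G x y)"
          using norm_triangle_ineq2[of "G x 0" "G x y"] by (simp add: norm_minus_commute)
        then show "norm (inverse (G x y)) \<le> 2 / d"
          using le_imp_inverse_le[of "d / 2" "norm (G x y)"] d by (simp add: norm_inverse)
      qed (use s in auto)
      moreover have "norm (G 0 y) < d / 2"
        using close[of 0] s G00 by simp
      moreover have "0 < norm (G 0 y)"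
        using G0[of 0 y] y s by simp
      ultimately show False
        using d by (simp only: norm_inverse) (simp add: field_simps)
    qed
  qed
qed

section \<open>Failure of a gradient bound along a weight\<close>

lemma subsequence_convergent_or_infinite:
  fixes x :: "nat \<Rightarrow> real"
  obtains g where "strict_mono g"
    "convergent (\<lambda>n. x (g n)) \<or> filterlim (\<lambda>n. x (g n)) at_top sequentially \<or> filterlim (\<lambda>n. x (g n)) at_bot sequentially"
proof -
  obtain l g where g: "strict_mono g" "((\<lambda>n. ereal (x n)) \<circ> g) \<longlonglongrightarrow> l"
    using compact_complete_linorder[of "\<lambda>n. ereal (x n)"] by blast
  have "convergent (\<lambda>n. x (g n)) \<or> filterlim (\<lambda>n. x (g n)) at_top sequentially \<or> filterlim (\<lambda>n. x (g n)) at_bot sequentially"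
  proof (cases l)
    case (real r)
    then have "(\<lambda>n. x (g n)) \<longlonglongrightarrow> r"
      using g(2) by (simp add: comp_def)
    then show ?thesis
      by (auto simp: convergent_def)
  next
    case PInf
    then show ?thesis
      using g(2) by (simp add: comp_def tendsto_PInfty filterlim_at_top_dense)
  next
    case MInf
    then show ?thesis
      using g(2) by (simp add: comp_def tendsto_MInfty filterlim_at_bot_dense)
  qed
  then show ?thesis
    using that g(1) by blast
qed

lemma subsequence_classified:
  fixes U :: "nat \<Rightarrow> 'a::real_inner"
  assumes "finite V"
  shows "\<exists>g. strict_mono g \<and> (\<forall>v\<in>V. convergent (\<lambda>n. U (g n) \<bullet> v) \<or>
    filterlim (\<lambda>n. U (g n) \<bullet> v) at_top sequentially \<or> filterlim (\<lambda>n. U (g n) \<bullet> v) at_bot sequentially)"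
  using assms
proof (induction V)
  case empty
  then show ?case
    using strict_mono_id by auto
next
  case (insert v V)
  then obtain g where g: "strict_mono g" "\<And>v. v \<in> V \<Longrightarrow> convergent (\<lambda>n. U (g n) \<bullet> v) \<or>
    filterlim (\<lambda>n. U (g n) \<bullet> v) at_top sequentially \<or> filterlim (\<lambda>n. U (g n) \<bullet> v) at_bot sequentially"
    by blast
  obtain h where h: "strict_mono h" "convergent (\<lambda>n. U (g (h n)) \<bullet> v) \<or>
    filterlim (\<lambda>n. U (g (h n)) \<bullet> v) at_top sequentially \<or> filterlim (\<lambda>n. U (g (h n)) \<bullet> v) at_bot sequentially"
    by (rule subsequence_convergent_or_infinite[of "\<lambda>n. U (g n) \<bullet> v"])
  have sub: "convergent (\<lambda>n. U (g (h n)) \<bullet> w) \<or>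
    filterlim (\<lambda>n. U (g (h n)) \<bullet> w) at_top sequentially \<or> filterlim (\<lambda>n. U (g (h n)) \<bullet> w) at_bot sequentially" if "w \<in> V" for w
    using g(2)[OF that] convergent_subseq_convergent[OF _ h(1), of "\<lambda>n. U (g n) \<bullet> w"]
      filterlim_compose[OF _ filterlim_subseq[OF h(1)], of "\<lambda>n. U (g n) \<bullet> w"] by (auto simp: comp_def)
  have "strict_mono (\<lambda>n. g (h n))"
    using g(1) h(1) by (simp add: strict_mono_def)
  then show ?case
    using sub h(2) by (intro exI[of _ "\<lambda>n. g (h n)"]) auto
qed

text \<open>\<open>P\<close> is the projection to the span of those functionals that converge along the subsequence.\<close>
lemma rectify:
  fixes U :: "nat \<Rightarrow> 'a::euclidean_space"
  assumes V: "finite V"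
  obtains g P Q p where "strict_mono g" "\<And>n. U (g n) = P n + Q n" "P \<longlonglongrightarrow> p"
    "\<And>v. v \<in> V \<Longrightarrow> (\<forall>n. Q n \<bullet> v = 0) \<or> filterlim (\<lambda>n. Q n \<bullet> v) at_top sequentially \<or>
      filterlim (\<lambda>n. Q n \<bullet> v) at_bot sequentially"
proof -
  obtain g where g: "strict_mono g" "\<And>v. v \<in> V \<Longrightarrow> convergent (\<lambda>n. U (g n) \<bullet> v) \<or>
    filterlim (\<lambda>n. U (g n) \<bullet> v) at_top sequentially \<or> filterlim (\<lambda>n. U (g n) \<bullet> v) at_bot sequentially"
    using subsequence_classified[OF V, of U] by blast
  define W where "W = {v \<in> V. convergent (\<lambda>n. U (g n) \<bullet> v)}"
  obtain B where B: "B \<subseteq> span W" "pairwise orthogonal B" "\<And>x. x \<in> B \<Longrightarrow> norm x = 1"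
    "independent B" "card B = dim (span W)" "span B = span W"
    using orthonormal_basis_subspace[of "span W"] by auto
  have finB: "finite B"
    using B(4) by (rule independent_imp_finite)
  have conv: "convergent (\<lambda>n. U (g n) \<bullet> w)" if "w \<in> span W" for w
    using that
  proof (induction rule: span_induct_alt)
    case base
    then show ?case
      by (simp add: convergent_const)
  next
    case (step c x y)
    then show ?case
      unfolding inner_add_right inner_scaleR_right
      by (intro convergent_add convergent_mult convergent_const) (auto simp: W_def)
  qed
  define P where "P n = (\<Sum>b\<in>B. (U (g n) \<bullet> b) *\<^sub>R b)" for n
  define Q where "Q n = U (g n) - P n" for n
  have Pv: "P n \<bullet> v = U (g n) \<bullet> v" if "v \<in> span W" for n v
  proof -
    have "(\<Sum>b\<in>B. (v \<bullet> b) *\<^sub>R b) = v"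
      by (rule orthonormal_basis_expand) (use B finB that in auto)
    then have "U (g n) \<bullet> v = (\<Sum>b\<in>B. (v \<bullet> b) * (U (g n) \<bullet> b))"
      by (metis (no_types, lifting) inner_scaleR_right inner_sum_right sum.cong)
    also have "\<dots> = P n \<bullet> v"
      unfolding P_def inner_sum_left by (intro sum.cong) (simp_all add: inner_commute mult.commute)
    finally show ?thesis by simp
  qed
  have "convergent P"
  proof -
    have "convergent (\<lambda>n. (U (g n) \<bullet> b) *\<^sub>R b)" if "b \<in> B" for b
    proof -
      have "convergent (\<lambda>n. U (g n) \<bullet> b)"
        by (rule conv) (use that B(1) in auto)
      then obtain L where "(\<lambda>n. U (g n) \<bullet> b) \<longlonglongrightarrow> L"
        by (auto simp: convergent_def)
      then have "(\<lambda>n. (U (g n) \<bullet> b) *\<^sub>R b) \<longlonglongrightarrow> L *\<^sub>R b"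
        by (intro tendsto_intros)
      then show ?thesis
        by (rule convergentI)
    qed
    then show ?thesis
      unfolding P_def[abs_def] by (intro convergent_sum)
  qed
  then obtain p where p: "P \<longlonglongrightarrow> p"
    by (auto simp: convergent_def)
  show ?thesis
  proof (rule that[OF g(1) _ p])
    show "U (g n) = P n + Q n" for n
      by (simp add: Q_def)
    show "(\<forall>n. Q n \<bullet> v = 0) \<or> filterlim (\<lambda>n. Q n \<bullet> v) at_top sequentially \<or>
      filterlim (\<lambda>n. Q n \<bullet> v) at_bot sequentially" if "v \<in> V" for v
    proof (cases "v \<in> W")
      case True
      then show ?thesis
        using Pv[OF span_base[OF True]] by (simp add: Q_def inner_diff_left)
    next
      case False
      have lim: "(\<lambda>n. - (P n \<bullet> v)) \<longlonglongrightarrow> - (p \<bullet> v)"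
        by (intro tendsto_intros p)
      have eq: "Q n \<bullet> v = - (P n \<bullet> v) + U (g n) \<bullet> v" for n
        by (simp add: Q_def inner_diff_left)
      have top: "filterlim (\<lambda>n. Q n \<bullet> v) at_top sequentially" if "filterlim (\<lambda>n. U (g n) \<bullet> v) at_top sequentially"
        unfolding eq by (rule filterlim_tendsto_add_at_top[OF lim that])
      have bot: "filterlim (\<lambda>n. Q n \<bullet> v) at_bot sequentially" if h: "filterlim (\<lambda>n. U (g n) \<bullet> v) at_bot sequentially"
      proof -
        have "filterlim (\<lambda>n. P n \<bullet> v + - (U (g n) \<bullet> v)) at_top sequentially"
          using h by (intro filterlim_tendsto_add_at_top[OF tendsto_inner[OF p tendsto_const]])
            (simp add: filterlim_uminus_at_bot)
        then show ?thesis
          by (simp add: filterlim_uminus_at_bot eq)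
      qed
      show ?thesis
        using g(2)[OF that] False that top bot by (auto simp: W_def)
    qed
  qed
qed

lemma monomial_scale:
  assumes "\<And>i. z $ i = T $ i * of_real (exp (- (Q $ i)))"
  shows "monomial z \<kappa> = monomial T \<kappa> * of_real (exp (- weight Q \<kappa>))"
proof -
  have "monomial z \<kappa> = (\<Prod>i\<in>UNIV. (T $ i) ^ (\<kappa> $ i) * of_real (exp (- (Q $ i * real (\<kappa> $ i)))))"
    unfolding monomial_def assms by (intro prod.cong) (simp_all add: power_mult_distrib exp_of_nat2_mult[symmetric] mult.commute flip: of_real_power exp_of_nat_mult)
  also have "\<dots> = monomial T \<kappa> * of_real (exp (- weight Q \<kappa>))"
    by (simp add: monomial_def prod.distrib weight_sum exp_sum[symmetric] sum_negf flip: of_real_prod)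
  finally show ?thesis .
qed

text \<open>After multiplication by \<open>exp (weight (Q n) (E \<mu>0))\<close>, terms of the same
  weight converge to their values at \<open>\<tau>\<close>, the heavier ones tend to 0, and the
  error stays relative to a bounded sum.\<close>

lemma initial_form_limit:
  fixes c :: "'b \<Rightarrow> complex" and E :: "'b \<Rightarrow> nat ^ 'n::finite"
  assumes N: "finite N" and T: "T \<longlonglongrightarrow> \<tau>"
    and z: "\<And>n i. z n $ i = T n $ i * of_real (exp (- (Q n $ i)))"
    and cmp: "\<And>\<mu>. \<mu> \<in> N \<Longrightarrow> (\<forall>n. weight (Q n) (E \<mu>) = weight (Q n) (E \<mu>0)) \<or>
        filterlim (\<lambda>n. weight (Q n) (E \<mu>) - weight (Q n) (E \<mu>0)) at_top sequentially"
    and g: "\<And>\<epsilon>. 0 < \<epsilon> \<Longrightarrow> \<forall>\<^sub>F n in sequentially.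
        norm (g n - (\<Sum>\<mu>\<in>N. c \<mu> * monomial (z n) (E \<mu>))) \<le> \<epsilon> * (\<Sum>\<mu>\<in>N. norm (monomial (z n) (E \<mu>)))"
  shows "(\<lambda>n. g n * of_real (exp (weight (Q n) (E \<mu>0)))) \<longlonglongrightarrow>
    (\<Sum>\<mu>\<in>{\<mu>\<in>N. \<forall>n. weight (Q n) (E \<mu>) = weight (Q n) (E \<mu>0)}. c \<mu> * monomial \<tau> (E \<mu>))"
proof -
  define e where "e n = (of_real (exp (weight (Q n) (E \<mu>0))) :: complex)" for n
  define x where "x \<mu> n = monomial (z n) (E \<mu>) * e n" for \<mu> n
  define l where "l \<mu> = (if \<forall>n. weight (Q n) (E \<mu>) = weight (Q n) (E \<mu>0) then monomial \<tau> (E \<mu>) else 0)" for \<mu>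
  have x_eq: "x \<mu> n = monomial (T n) (E \<mu>) * of_real (exp (- (weight (Q n) (E \<mu>) - weight (Q n) (E \<mu>0))))" for \<mu> n
    unfolding x_def e_def monomial_scale[OF z] by (simp add: mult.assoc exp_diff exp_minus field_simps flip: of_real_mult)
  have monT: "(\<lambda>n. monomial (T n) \<kappa>) \<longlonglongrightarrow> monomial \<tau> \<kappa>" for \<kappa>
    unfolding monomial_def by (intro tendsto_intros T)
  have xl: "x \<mu> \<longlonglongrightarrow> l \<mu>" if "\<mu> \<in> N" for \<mu>
  proof (cases "\<forall>n. weight (Q n) (E \<mu>) = weight (Q n) (E \<mu>0)")
    case True
    then show ?thesis
      using monT[of "E \<mu>"] by (simp add: l_def x_eq[abs_def])
  next
    case False
    then have "filterlim (\<lambda>n. weight (Q n) (E \<mu>) - weight (Q n) (E \<mu>0)) at_top sequentially"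
      using cmp[OF that] by blast
    then have "filterlim (\<lambda>n. - (weight (Q n) (E \<mu>) - weight (Q n) (E \<mu>0))) at_bot sequentially"
      by (simp only: filterlim_uminus_at_top)
    then have "(\<lambda>n. exp (- (weight (Q n) (E \<mu>) - weight (Q n) (E \<mu>0)))) \<longlonglongrightarrow> 0"
      by (rule filterlim_compose[OF exp_at_bot])
    then have "(\<lambda>n. monomial (T n) (E \<mu>) * of_real (exp (- (weight (Q n) (E \<mu>) - weight (Q n) (E \<mu>0))))) \<longlonglongrightarrow> monomial \<tau> (E \<mu>) * of_real 0"
      by (intro tendsto_mult tendsto_of_real monT)
    moreover have "l \<mu> = 0"
      unfolding l_def by (rule if_not_P[OF False])
    ultimately show ?thesis
      by (simp add: x_eq[abs_def])
  qed
  define S where "S n = (\<Sum>\<mu>\<in>N. c \<mu> * x \<mu> n)" for n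
  define L' where "L' = (\<Sum>\<mu>\<in>N. norm (l \<mu>))"
  have S: "S \<longlonglongrightarrow> (\<Sum>\<mu>\<in>N. c \<mu> * l \<mu>)"
    unfolding S_def[abs_def] by (intro tendsto_intros xl)
  have N': "(\<lambda>n. \<Sum>\<mu>\<in>N. norm (x \<mu> n)) \<longlonglongrightarrow> L'"
    unfolding L'_def by (intro tendsto_intros xl)
  have L'0: "0 \<le> L'"
    unfolding L'_def by (intro sum_nonneg) auto
  have "(\<lambda>n. g n * e n - S n) \<longlonglongrightarrow> 0"
  proof (rule tendstoI)
    fix r :: real assume r: "0 < r"
    define \<epsilon> where "\<epsilon> = r / (2 * (L' + 1))"
    have \<epsilon>: "0 < \<epsilon>"
      using r L'0 by (simp add: \<epsilon>_def)
    have "\<forall>\<^sub>F n in sequentially. (\<Sum>\<mu>\<in>N. norm (x \<mu> n)) < L' + 1"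
      by (rule order_tendstoD[OF N']) simp
    with g[OF \<epsilon>] show "\<forall>\<^sub>F n in sequentially. dist (g n * e n - S n) 0 < r"
    proof eventually_elim
      case (elim n)
      have en: "norm (e n) = exp (weight (Q n) (E \<mu>0))"
        by (simp add: e_def)
      have "g n * e n - S n = (g n - (\<Sum>\<mu>\<in>N. c \<mu> * monomial (z n) (E \<mu>))) * e n"
        by (simp add: S_def x_def left_diff_distrib sum_distrib_right mult.assoc)
      then have "norm (g n * e n - S n) = norm (g n - (\<Sum>\<mu>\<in>N. c \<mu> * monomial (z n) (E \<mu>))) * norm (e n)"
        by (simp add: norm_mult)
      also have "\<dots> \<le> \<epsilon> * (\<Sum>\<mu>\<in>N. norm (monomial (z n) (E \<mu>))) * norm (e n)"
        using elim(1) by (intro mult_right_mono) auto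
      also have "\<dots> = \<epsilon> * (\<Sum>\<mu>\<in>N. norm (x \<mu> n))"
        by (simp add: x_def norm_mult sum_distrib_right mult.assoc)
      also have "\<dots> \<le> \<epsilon> * (L' + 1)"
        using elim(2) \<epsilon> by (intro mult_left_mono) auto
      also have "\<dots> = r / 2"
        using L'0 by (simp add: \<epsilon>_def field_simps)
      finally show ?case
        using r by (simp add: dist_norm)
    qed
  qed
  from tendsto_add[OF this S] have "(\<lambda>n. g n * e n) \<longlonglongrightarrow> (\<Sum>\<mu>\<in>N. c \<mu> * l \<mu>)"
    by simp
  also have "(\<Sum>\<mu>\<in>N. c \<mu> * l \<mu>) = (\<Sum>\<mu>\<in>{\<mu>\<in>N. \<forall>n. weight (Q n) (E \<mu>) = weight (Q n) (E \<mu>0)}. c \<mu> * monomial \<tau> (E \<mu>))"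
    by (rule sum.mono_neutral_cong_right) (use N in \<open>auto simp: l_def\<close>)
  finally show ?thesis
    by (simp add: e_def)
qed

lemma weight_lower: "1 \<le> \<nu> $ j \<Longrightarrow> weight u (lower j \<nu>) = weight u \<nu> - u $ j"
proof -
  assume j: "1 \<le> \<nu> $ j"
  have "weight u \<nu> = u $ j * real (\<nu> $ j) + (\<Sum>i\<in>UNIV - {j}. u $ i * real (\<nu> $ i))"
    unfolding weight_sum by (subst sum.remove[of UNIV j]) auto
  moreover have "weight u (lower j \<nu>) = u $ j * real (\<nu> $ j - 1) + (\<Sum>i\<in>UNIV - {j}. u $ i * real (\<nu> $ i))"
    unfolding weight_sum by (subst sum.remove[of UNIV j]) (auto simp: lower_def intro!: sum.cong)
  ultimately show ?thesis
    using j by (simp add: of_nat_diff algebra_simps)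
qed

lemma gradient_face_part:
  "gradient (face_part a S) z $ j =
    (\<Sum>\<nu>\<in>{\<nu>. exponent_point \<nu> \<in> S}. of_nat (\<nu> $ j) * a \<nu> * monomial z (lower j \<nu>))"
proof -
  have "((\<lambda>t. \<Sum>\<nu>\<in>{\<nu>. exponent_point \<nu> \<in> S}. a \<nu> * monomial (\<chi> i. if i = j then t else z $ i) \<nu>) has_field_derivative
    (\<Sum>\<nu>\<in>{\<nu>. exponent_point \<nu> \<in> S}. a \<nu> * (of_nat (\<nu> $ j) * monomial (\<chi> i. if i = j then z $ j else z $ i) (lower j \<nu>)))) (at (z $ j))"
    by (intro DERIV_sum DERIV_cmult monomial_has_derivative)
  then show ?thesis
    by (simp add: gradient_def partial_deriv_def face_part_def DERIV_imp_deriv mult_ac)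
qed

text \<open>The failing inequality is strict and \<open>gradient f\<close> is continuous, so it
  persists under a small shift along the diagonal, which makes all coordinates nonzero. The point 0
  itself cannot fail, as the right-hand side is 0 there.\<close>

lemma failing_torus_point:
  fixes f :: "complex ^ 'n::finite \<Rightarrow> complex"
  assumes cont: "continuous_on (ball 0 r0) (gradient f)" and r0: "0 < r0" and C: "0 < C" and r: "0 < r"
    and fail: "\<not> (\<exists>C>0. \<exists>r>0. \<forall>z. norm z < r \<longrightarrow> C * norm z powr \<alpha> \<le> norm (gradient f z))"
  obtains z where "norm z < r" "\<And>i. z $ i \<noteq> 0" "norm (gradient f z) < C * norm z powr \<alpha>"
proof -
  have "0 < min r r0"
    using r r0 by simp
  then obtain z0 where z0: "norm z0 < min r r0" "norm (gradient f z0) < C * norm z0 powr \<alpha>"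
    using fail C not_le by metis
  have z0n: "z0 \<noteq> 0"
    using z0(2) by auto
  define w where "w t = z0 + (\<chi> i. of_real t)" for t :: real
  have w: "(w \<longlongrightarrow> z0) (at_right 0)"
  proof -
    have "(w \<longlongrightarrow> z0 + (\<chi> i. of_real 0)) (at_right 0)"
      unfolding w_def by (intro tendsto_intros)
    moreover have "z0 + (\<chi> i. of_real 0) = z0"
      by (simp add: vec_eq_iff)
    ultimately show ?thesis
      by simp
  qed
  have "isCont (gradient f) z0"
    using cont z0(1) by (simp add: continuous_on_eq_continuous_at)
  then have lim: "((\<lambda>t. C * norm (w t) powr \<alpha> - norm (gradient f (w t))) \<longlongrightarrow> C * norm z0 powr \<alpha> - norm (gradient f z0)) (at_right 0)"
    by (intro tendsto_intros isCont_tendsto_compose[OF _ w] w) (use z0n in auto)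
  have ev1: "\<forall>\<^sub>F t in at_right 0. 0 < C * norm (w t) powr \<alpha> - norm (gradient f (w t))"
    by (rule order_tendstoD(1)[OF lim]) (use z0(2) in simp)
  have ev2: "\<forall>\<^sub>F t in at_right 0. norm (w t) < r"
    by (rule order_tendstoD(2)[OF tendsto_norm[OF w]]) (use z0(1) in simp)
  have ev3: "\<forall>\<^sub>F t in at_right 0. \<forall>i\<in>UNIV. w t $ i \<noteq> 0"
  proof (rule eventually_ball_finite, simp, rule ballI)
    fix i :: 'n
    show "\<forall>\<^sub>F t in at_right 0. w t $ i \<noteq> 0"
    proof (cases "z0 $ i = 0")
      case True
      then show ?thesis
        using eventually_at_right_less[of 0] by (auto simp: w_def elim: eventually_mono)
    next
      case False
      have "((\<lambda>t. w t $ i) \<longlongrightarrow> z0 $ i) (at_right 0)"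
        by (intro tendsto_vec_nth w)
      then show ?thesis
        using False by (rule tendsto_imp_eventually_ne)
    qed
  qed
  have "\<forall>\<^sub>F t in at_right 0. 0 < C * norm (w t) powr \<alpha> - norm (gradient f (w t)) \<and> norm (w t) < r \<and> (\<forall>i\<in>UNIV. w t $ i \<noteq> 0)"
    using ev1 ev2 ev3 by eventually_elim auto
  then obtain t where "0 < C * norm (w t) powr \<alpha> - norm (gradient f (w t))" "norm (w t) < r" "\<forall>i\<in>UNIV. w t $ i \<noteq> 0"
    using eventually_happens'[OF trivial_limit_at_right_real[of 0]] by blast
  then show ?thesis
    using that[of "w t"] by auto
qed


text \<open>No curve selection is used. After \<open>rectify\<close>, the weights of two exponents
  of \<open>M\<close> along \<open>Q n\<close> either coincide for all \<open>n\<close> or drift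
  apart to infinity. Hence one late vector \<open>Q n\<close> orders the exponents as the limit
  does, and can serve as \<open>u\<close>.\<close>

lemma gradient_bound_failure:
  fixes f :: "complex ^ 'n::finite \<Rightarrow> complex"
  assumes f: "has_taylor_expansion f a" and kou: "kouchnirenko_nondegenerate a" and ne: "supp a \<noteq> {}"
    and \<alpha>: "0 \<le> \<alpha>"
    and fail: "\<not> (\<exists>C>0. \<exists>r>0. \<forall>z. norm z < r \<longrightarrow> C * norm z powr \<alpha> \<le> norm (gradient f z))"
  obtains u i where "\<And>l. 0 < u $ l" "\<And>l. u $ i \<le> u $ l"
    "\<And>\<nu>. \<nu> \<in> supp a \<Longrightarrow> (\<alpha> + 1) * u $ i < weight u \<nu>"
    "\<And>j \<nu>. dominates (supp a) u j \<nu> \<Longrightarrow> \<alpha> * u $ i < weight u \<nu> - u $ j"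
proof -
  obtain r0 where r0: "0 < r0" "continuous_on (ball 0 r0) (gradient f)"
    by (rule gradient_continuous[OF f])
  obtain M where M: "finite M" "M \<subseteq> supp a"
    "\<And>j \<nu>. \<nu> \<in> supp a \<Longrightarrow> 1 \<le> \<nu> $ j \<Longrightarrow> \<exists>\<mu>\<in>M. 1 \<le> \<mu> $ j \<and> \<mu> \<le> \<nu>"
    and approx: "\<And>\<epsilon> j. 0 < \<epsilon> \<Longrightarrow> \<exists>\<delta>>0. \<forall>z. (\<forall>i. norm (z $ i) \<le> \<delta>) \<longrightarrow>
      norm (gradient f z $ j - (\<Sum>\<mu>\<in>{\<mu>\<in>M. 1 \<le> \<mu> $ j}. of_nat (\<mu> $ j) * a \<mu> * monomial z (lower j \<mu>)))
        \<le> \<epsilon> * (\<Sum>\<mu>\<in>{\<mu>\<in>M. 1 \<le> \<mu> $ j}. norm (monomial z (lower j \<mu>)))"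
    by (rule gradient_approx[OF f]) blast
  have "\<exists>z. norm z < inverse (real (Suc n)) \<and> (\<forall>i. z $ i \<noteq> 0) \<and>
      norm (gradient f z) < inverse (real (Suc n)) * norm z powr \<alpha>" for n
  proof -
    have "0 < inverse (real (Suc n))"
      by simp
    then show ?thesis
      by (rule failing_torus_point[OF r0(2,1) _ _ fail]) auto
  qed
  then obtain z where z: "\<And>n. norm (z n) < inverse (real (Suc n))" "\<And>n i. z n $ i \<noteq> 0"
      "\<And>n. norm (gradient f (z n)) < inverse (real (Suc n)) * norm (z n) powr \<alpha>"
    by metis
  have inv0: "(\<lambda>n. inverse (real (Suc n))) \<longlonglongrightarrow> 0"
    by (rule LIMSEQ_inverse_real_of_nat)
  have norm0: "(\<lambda>n. norm (z n)) \<longlonglongrightarrow> 0"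
    by (rule tendsto_sandwich[OF _ _ tendsto_const inv0])
      (simp_all add: less_imp_le[OF z(1)] always_eventually del: of_nat_Suc)
  have zi0: "(\<lambda>n. norm (z n $ i)) \<longlonglongrightarrow> 0" for i
    by (rule tendsto_sandwich[OF _ _ tendsto_const norm0]) (auto simp: Finite_Cartesian_Product.norm_nth_le)
  define U :: "nat \<Rightarrow> real ^ 'n" where "U n = (\<chi> i. - ln (norm (z n $ i)))" for n
  have Utop: "filterlim (\<lambda>n. U n $ i) at_top sequentially" for i
  proof -
    have "filterlim (\<lambda>n. norm (z n $ i)) (at_right 0) sequentially"
      unfolding filterlim_at using zi0[of i] z(2) by auto
    then have "filterlim (\<lambda>n. ln (norm (z n $ i))) at_bot sequentially"
      by (rule filterlim_compose[OF ln_at_0])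
    then show ?thesis
      by (simp add: U_def filterlim_uminus_at_top)
  qed
  \<comment> \<open>The differences of exponents decide which terms of a derivative survive in the
    limit.\<close>
  define V where "V = (\<lambda>(\<mu>, \<nu>). exponent_point \<mu> - exponent_point \<nu>) ` (M \<times> M) \<union> range (\<lambda>i. axis i (1::real))"
  have "finite V"
    using M(1) by (simp add: V_def)
  then obtain g P Q0 p where g: "strict_mono g" "\<And>n. U (g n) = P n + Q0 n" "P \<longlonglongrightarrow> p"
    "\<And>v. v \<in> V \<Longrightarrow> (\<forall>n. Q0 n \<bullet> v = 0) \<or> filterlim (\<lambda>n. Q0 n \<bullet> v) at_top sequentially \<or>
      filterlim (\<lambda>n. Q0 n \<bullet> v) at_bot sequentially"
    by (rule rectify[of V U]) blast
  \<comment> \<open>The arguments of the coordinates. Their limit, together with the limit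
    \<open>p\<close> of the bounded part of the logarithms, forms the torus point
    \<open>\<tau>\<close>.\<close>
  define W :: "nat \<Rightarrow> complex ^ 'n" where "W n = (\<chi> i. z (g n) $ i / of_real (norm (z (g n) $ i)))" for n
  have normW: "norm (W n $ i) = 1" for n i
    using z(2) by (simp add: W_def norm_divide)
  have "bounded (range W)"
  proof -
    have "norm (W n) \<le> real CARD('n)" for n
      using L2_set_le_sum[of UNIV "\<lambda>i. norm (W n $ i)"] by (simp add: norm_vec_def normW)
    then show ?thesis
      by (auto simp: bounded_iff)
  qed
  then obtain w h where h: "strict_mono h" "(W \<circ> h) \<longlonglongrightarrow> w"
    using bounded_imp_convergent_subsequence by blast
  define k where "k n = g (h n)" for n
  define Z where "Z n = z (k n)" for n
  define Q where "Q n = Q0 (h n)" for n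
  define T :: "nat \<Rightarrow> complex ^ 'n" where "T n = (\<chi> i. W (h n) $ i * of_real (exp (- (P (h n) $ i))))" for n
  define \<tau> :: "complex ^ 'n" where "\<tau> = (\<chi> i. w $ i * of_real (exp (- (p $ i))))"
  have k: "strict_mono k"
    using g(1) h(1) by (simp add: strict_mono_def k_def)
  have Ph: "(\<lambda>n. P (h n)) \<longlonglongrightarrow> p"
    using LIMSEQ_subseq_LIMSEQ[OF g(3) h(1)] by (simp add: comp_def)
  have Wh: "(\<lambda>n. W (h n)) \<longlonglongrightarrow> w"
    using h(2) by (simp add: comp_def)
  have T: "T \<longlonglongrightarrow> \<tau>"
    unfolding T_def[abs_def] \<tau>_def by (intro tendsto_intros Ph Wh)
  have \<tau>: "\<tau> $ i \<noteq> 0" for i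
  proof -
    have "(\<lambda>n. norm (W (h n) $ i)) \<longlonglongrightarrow> norm (w $ i)"
      by (intro tendsto_intros Wh)
    then have "norm (w $ i) = 1"
      unfolding normW by (simp add: LIMSEQ_const_iff)
    then show ?thesis
      by (auto simp: \<tau>_def)
  qed
  have Z: "Z n $ i = T n $ i * of_real (exp (- (Q n $ i)))" for n i
  proof -
    have "P (h n) $ i + Q n $ i = U (k n) $ i"
      using g(2)[of "h n"] by (simp add: Q_def k_def)
    then have "exp (- (P (h n) $ i)) * exp (- (Q n $ i)) = exp (- U (k n) $ i)"
      by (simp flip: exp_add)
    also have "\<dots> = norm (Z n $ i)"
      using z(2) by (simp add: U_def Z_def)
    finally have "T n $ i * of_real (exp (- (Q n $ i))) = W (h n) $ i * of_real (norm (Z n $ i))"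
      by (simp add: T_def mult.assoc flip: of_real_mult)
    then show ?thesis
      using z(2) by (simp add: W_def Z_def k_def)
  qed
  have Q: "(\<forall>n. Q n \<bullet> v = 0) \<or> filterlim (\<lambda>n. Q n \<bullet> v) at_top sequentially \<or>
      filterlim (\<lambda>n. Q n \<bullet> v) at_bot sequentially" if "v \<in> V" for v
    using g(4)[OF that] filterlim_compose[OF _ filterlim_subseq[OF h(1)], of "\<lambda>n. Q0 n \<bullet> v"] by (auto simp: Q_def)
  have Qtop: "filterlim (\<lambda>n. Q n $ i) at_top sequentially" for i
  proof -
    have "filterlim (\<lambda>n. U (k n) $ i) at_top sequentially"
      by (rule filterlim_compose[OF Utop filterlim_subseq[OF k]])
    moreover have "(\<lambda>n. - (P (h n) $ i)) \<longlonglongrightarrow> - (p $ i)"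
      by (intro tendsto_intros Ph)
    ultimately have "filterlim (\<lambda>n. - (P (h n) $ i) + U (k n) $ i) at_top sequentially"
      using filterlim_tendsto_add_at_top by blast
    moreover have "- (P (h n) $ i) + U (k n) $ i = Q n $ i" for n
      using g(2)[of "h n"] by (simp add: Q_def k_def)
    ultimately show ?thesis
      by simp
  qed
  define rel where "rel \<mu> \<nu> \<longleftrightarrow> (\<forall>n. weight (Q n) \<mu> = weight (Q n) \<nu>)" for \<mu> \<nu>
  define gt where "gt \<mu> \<nu> \<longleftrightarrow> filterlim (\<lambda>n. weight (Q n) \<mu> - weight (Q n) \<nu>) at_top sequentially" for \<mu> \<nu>
  have cmp: "rel \<mu> \<nu> \<or> gt \<mu> \<nu> \<or> gt \<nu> \<mu>" if "\<mu> \<in> M" "\<nu> \<in> M" for \<mu> \<nu>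
  proof -
    have "exponent_point \<mu> - exponent_point \<nu> \<in> V"
      using that by (force simp: V_def)
    moreover have "Q n \<bullet> (exponent_point \<mu> - exponent_point \<nu>) = weight (Q n) \<mu> - weight (Q n) \<nu>" for n
      by (simp add: weight_def inner_diff_right)
    moreover have "filterlim (\<lambda>n. weight (Q n) \<mu> - weight (Q n) \<nu>) at_bot sequentially \<longleftrightarrow> gt \<nu> \<mu>"
      unfolding gt_def filterlim_uminus_at_bot by simp
    ultimately show ?thesis
      using Q[of "exponent_point \<mu> - exponent_point \<nu>"] by (auto simp: rel_def gt_def)
  qed
  have gt_ev: "\<forall>\<^sub>F n in sequentially. weight (Q n) \<nu> < weight (Q n) \<mu>" if "gt \<mu> \<nu>" for \<mu> \<nu>
    using filterlim_at_top_dense[THEN iffD1, OF that[unfolded gt_def], rule_format, of 0] by simp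
  have "\<forall>\<^sub>F n in sequentially. \<forall>\<mu>\<in>M. \<forall>\<nu>\<in>M. rel \<mu> \<nu> \<or> gt \<mu> \<nu> \<and> weight (Q n) \<nu> < weight (Q n) \<mu> \<or>
      gt \<nu> \<mu> \<and> weight (Q n) \<mu> < weight (Q n) \<nu>"
  proof (intro eventually_ball_finite M(1) ballI)
    fix \<mu> \<nu> assume "\<mu> \<in> M" "\<nu> \<in> M"
    then consider "rel \<mu> \<nu>" | "gt \<mu> \<nu>" | "gt \<nu> \<mu>"
      using cmp by blast
    then show "\<forall>\<^sub>F n in sequentially. rel \<mu> \<nu> \<or> gt \<mu> \<nu> \<and> weight (Q n) \<nu> < weight (Q n) \<mu> \<or>
      gt \<nu> \<mu> \<and> weight (Q n) \<mu> < weight (Q n) \<nu>"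
      by cases (auto intro: eventually_mono[OF gt_ev])
  qed
  moreover have "\<forall>\<^sub>F n in sequentially. \<forall>i\<in>UNIV. 0 < Q n $ i"
    using Qtop by (intro eventually_ball_finite) (auto simp: filterlim_at_top_dense)
  moreover
  \<comment> \<open>\<open>\<mu>0\<close> has least weight among the terms of the
    \<open>j\<close>-th derivative, and the leading part through it does not vanish at
    \<open>\<tau>\<close>; the size of the derivative is then known exactly.\<close>
  define low where "low j \<mu>0 \<longleftrightarrow> 1 \<le> \<mu>0 $ j \<and> (\<forall>\<mu>\<in>M. 1 \<le> \<mu> $ j \<longrightarrow> rel \<mu> \<mu>0 \<or> gt \<mu> \<mu>0) \<and>
    (\<Sum>\<mu>\<in>{\<mu>\<in>M. 1 \<le> \<mu> $ j \<and> rel \<mu> \<mu>0}. of_nat (\<mu> $ j) * a \<mu> * monomial \<tau> (lower j \<mu>)) \<noteq> 0" for j \<mu>0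
  obtain K where K: "0 < K" "\<And>n. (\<Sum>i\<in>UNIV. norm (T n $ i)) \<le> K"
  proof -
    have "(\<lambda>n. \<Sum>i\<in>UNIV. norm (T n $ i)) \<longlonglongrightarrow> (\<Sum>i\<in>UNIV. norm (\<tau> $ i))"
      by (intro tendsto_intros T)
    then have "convergent (\<lambda>n. \<Sum>i\<in>UNIV. norm (T n $ i))"
      by (rule convergentI)
    then have "Bseq (\<lambda>n. \<Sum>i\<in>UNIV. norm (T n $ i))"
      by (rule convergent_imp_Bseq)
    then obtain K where K: "0 < K" "\<And>n. norm (\<Sum>i\<in>UNIV. norm (T n $ i)) \<le> K"
      unfolding Bseq_def by blast
    have "(\<Sum>i\<in>UNIV. norm (T n $ i)) \<le> K" for n
      using K(2)[of n] by simp
    then show ?thesis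
      using that K(1) by blast
  qed
  \<comment> \<open>Under \<open>low\<close> the derivative has at least the order of
    \<open>exp (- weight (Q n) (lower j \<mu>0))\<close>. The failing bound makes it of smaller
    order than \<open>exp (- (\<alpha> * Q n $ i))\<close>, because \<open>Z n\<close> has norm at
    most \<open>K * exp (- (Q n $ i))\<close>.\<close>
  have key: "\<forall>\<^sub>F n in sequentially. low j \<mu>0 \<longrightarrow> (\<forall>i. (\<forall>l. Q n $ i \<le> Q n $ l) \<longrightarrow> \<alpha> * Q n $ i < weight (Q n) \<mu>0 - Q n $ j)" for j \<mu>0
  proof (cases "low j \<mu>0")
    case True
    let ?N = "{\<mu>\<in>M. 1 \<le> \<mu> $ j}"
    have w_eq: "weight (Q n) (lower j \<mu>) = weight (Q n) (lower j \<mu>0) \<longleftrightarrow> weight (Q n) \<mu> = weight (Q n) \<mu>0"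
      "weight (Q n) (lower j \<mu>) - weight (Q n) (lower j \<mu>0) = weight (Q n) \<mu> - weight (Q n) \<mu>0"
      if "\<mu> \<in> ?N" for n \<mu>
      using that True weight_lower[of \<mu> j "Q n"] weight_lower[of \<mu>0 j "Q n"] by (simp_all add: low_def)
    have lim: "(\<lambda>n. gradient f (Z n) $ j * of_real (exp (weight (Q n) (lower j \<mu>0)))) \<longlonglongrightarrow>
      (\<Sum>\<mu>\<in>{\<mu>\<in>?N. \<forall>n. weight (Q n) (lower j \<mu>) = weight (Q n) (lower j \<mu>0)}. of_nat (\<mu> $ j) * a \<mu> * monomial \<tau> (lower j \<mu>))"
    proof (rule initial_form_limit[OF _ T Z])
      show "finite ?N"
        using M(1) by simp
      show "(\<forall>n. weight (Q n) (lower j \<mu>) = weight (Q n) (lower j \<mu>0)) \<or>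
        filterlim (\<lambda>n. weight (Q n) (lower j \<mu>) - weight (Q n) (lower j \<mu>0)) at_top sequentially" if "\<mu> \<in> ?N" for \<mu>
        unfolding w_eq[OF that] using that True by (auto simp: low_def rel_def gt_def)
      fix \<epsilon> :: real assume "0 < \<epsilon>"
      then obtain \<delta> where \<delta>: "0 < \<delta>" "\<forall>z. (\<forall>i. norm (z $ i) \<le> \<delta>) \<longrightarrow>
        norm (gradient f z $ j - (\<Sum>\<mu>\<in>?N. of_nat (\<mu> $ j) * a \<mu> * monomial z (lower j \<mu>)))
        \<le> \<epsilon> * (\<Sum>\<mu>\<in>?N. norm (monomial z (lower j \<mu>)))"
        using approx by blast
      have "(\<lambda>n. norm (Z n)) \<longlonglongrightarrow> 0"
        using LIMSEQ_subseq_LIMSEQ[OF norm0 k] by (simp add: comp_def Z_def)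
      then have "\<forall>\<^sub>F n in sequentially. norm (Z n) < \<delta>"
        using \<delta>(1) by (rule order_tendstoD(2))
      then show "\<forall>\<^sub>F n in sequentially. norm (gradient f (Z n) $ j - (\<Sum>\<mu>\<in>?N. of_nat (\<mu> $ j) * a \<mu> * monomial (Z n) (lower j \<mu>)))
        \<le> \<epsilon> * (\<Sum>\<mu>\<in>?N. norm (monomial (Z n) (lower j \<mu>)))"
      proof eventually_elim
        case (elim n)
        have "norm (Z n $ i) \<le> \<delta>" for i
          using Finite_Cartesian_Product.norm_nth_le[of "Z n" i] elim by linarith
        then show ?case
          using \<delta>(2) by blast
      qed
    qed
    have set_eq: "{\<mu>\<in>?N. \<forall>n. weight (Q n) (lower j \<mu>) = weight (Q n) (lower j \<mu>0)} = {\<mu>\<in>M. 1 \<le> \<mu> $ j \<and> rel \<mu> \<mu>0}"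
      using w_eq(1) by (auto simp: rel_def)
    define L where "L = (\<Sum>\<mu>\<in>{\<mu>\<in>M. 1 \<le> \<mu> $ j \<and> rel \<mu> \<mu>0}. of_nat (\<mu> $ j) * a \<mu> * monomial \<tau> (lower j \<mu>))"
    have L: "L \<noteq> 0"
      "(\<lambda>n. gradient f (Z n) $ j * of_real (exp (weight (Q n) (lower j \<mu>0)))) \<longlonglongrightarrow> L"
      using True lim unfolding low_def L_def set_eq by blast+
    have "\<forall>\<^sub>F n in sequentially. norm L / 2 < norm (gradient f (Z n) $ j * of_real (exp (weight (Q n) (lower j \<mu>0))))"
      by (rule order_tendstoD(1)[OF tendsto_norm[OF L(2)]]) (use L(1) in simp)
    moreover have "(\<lambda>n. inverse (real (Suc (k n))) * K powr \<alpha>) \<longlonglongrightarrow> 0 * K powr \<alpha>"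
      using LIMSEQ_subseq_LIMSEQ[OF inv0 k] by (intro tendsto_intros) (simp add: comp_def)
    then have "\<forall>\<^sub>F n in sequentially. inverse (real (Suc (k n))) * K powr \<alpha> < norm L / 2"
      by (rule order_tendstoD(2)) (use L(1) in simp)
    ultimately show ?thesis
    proof eventually_elim
      case (elim n)
      show ?case
      proof (intro impI allI, rule ccontr)
        fix i assume min: "\<forall>l. Q n $ i \<le> Q n $ l" and "\<not> \<alpha> * Q n $ i < weight (Q n) \<mu>0 - Q n $ j"
        then have le: "weight (Q n) (lower j \<mu>0) \<le> \<alpha> * Q n $ i"
          using True weight_lower[of \<mu>0 j "Q n"] by (simp add: low_def)
        have "norm (Z n) \<le> (\<Sum>l\<in>UNIV. norm (Z n $ l))"
          by (simp add: norm_vec_def L2_set_le_sum)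
        also have "\<dots> \<le> (\<Sum>l\<in>UNIV. norm (T n $ l) * exp (- (Q n $ i)))"
          using min by (intro sum_mono) (simp add: Z norm_mult mult_left_mono)
        also have "\<dots> = (\<Sum>l\<in>UNIV. norm (T n $ l)) * exp (- (Q n $ i))"
          by (simp add: sum_distrib_right)
        also have "\<dots> \<le> K * exp (- (Q n $ i))"
          using K(2) by (intro mult_right_mono) auto
        finally have "norm (Z n) powr \<alpha> \<le> (K * exp (- (Q n $ i))) powr \<alpha>"
          using \<alpha> by (intro powr_mono2) auto
        also have "\<dots> = K powr \<alpha> * exp (- (\<alpha> * Q n $ i))"
          using K(1) by (simp add: powr_mult exp_powr_real mult.commute)
        finally have Zn: "norm (Z n) powr \<alpha> \<le> K powr \<alpha> * exp (- (\<alpha> * Q n $ i))" .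
        have "norm (gradient f (Z n) $ j) \<le> norm (gradient f (Z n))"
          by (rule Finite_Cartesian_Product.norm_nth_le)
        also have "\<dots> \<le> inverse (real (Suc (k n))) * norm (Z n) powr \<alpha>"
          using z(3)[of "k n"] by (simp add: Z_def)
        also have "\<dots> \<le> inverse (real (Suc (k n))) * (K powr \<alpha> * exp (- (\<alpha> * Q n $ i)))"
          using Zn by (intro mult_left_mono) auto
        finally have "norm (gradient f (Z n) $ j) * exp (weight (Q n) (lower j \<mu>0)) \<le>
            inverse (real (Suc (k n))) * (K powr \<alpha> * exp (- (\<alpha> * Q n $ i))) * exp (weight (Q n) (lower j \<mu>0))"
          by (intro mult_right_mono) auto
        also have "\<dots> = inverse (real (Suc (k n))) * K powr \<alpha> * exp (weight (Q n) (lower j \<mu>0) - \<alpha> * Q n $ i)"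
          by (simp add: exp_diff exp_minus divide_inverse mult_ac)
        also have "\<dots> \<le> inverse (real (Suc (k n))) * K powr \<alpha> * 1"
          using le by (intro mult_left_mono) auto
        finally show False
          using elim by (simp add: norm_mult)
      qed
    qed
  qed simp
  have "\<forall>\<^sub>F n in sequentially. \<forall>j\<in>UNIV. \<forall>\<mu>0\<in>M. low j \<mu>0 \<longrightarrow> (\<forall>i. (\<forall>l. Q n $ i \<le> Q n $ l) \<longrightarrow> \<alpha> * Q n $ i < weight (Q n) \<mu>0 - Q n $ j)"
    by (intro eventually_ball_finite M(1) ballI key) simp
  ultimately have "\<forall>\<^sub>F n in sequentially. (\<forall>\<mu>\<in>M. \<forall>\<nu>\<in>M. rel \<mu> \<nu> \<or> gt \<mu> \<nu> \<and> weight (Q n) \<nu> < weight (Q n) \<mu> \<or>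
      gt \<nu> \<mu> \<and> weight (Q n) \<mu> < weight (Q n) \<nu>) \<and> (\<forall>i\<in>UNIV. 0 < Q n $ i) \<and>
      (\<forall>j\<in>UNIV. \<forall>\<mu>0\<in>M. low j \<mu>0 \<longrightarrow> (\<forall>i. (\<forall>l. Q n $ i \<le> Q n $ l) \<longrightarrow> \<alpha> * Q n $ i < weight (Q n) \<mu>0 - Q n $ j))"
    by (intro eventually_conj)
  then obtain n where n: "\<forall>\<mu>\<in>M. \<forall>\<nu>\<in>M. rel \<mu> \<nu> \<or> gt \<mu> \<nu> \<and> weight (Q n) \<nu> < weight (Q n) \<mu> \<or>
      gt \<nu> \<mu> \<and> weight (Q n) \<mu> < weight (Q n) \<nu>" "\<forall>i\<in>UNIV. 0 < Q n $ i"
      "\<forall>j\<in>UNIV. \<forall>\<mu>0\<in>M. low j \<mu>0 \<longrightarrow> (\<forall>i. (\<forall>l. Q n $ i \<le> Q n $ l) \<longrightarrow> \<alpha> * Q n $ i < weight (Q n) \<mu>0 - Q n $ j)"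
    using eventually_happens'[OF sequentially_bot] by blast
  define u where "u = Q n"
  have pos: "0 < u $ i" for i
    using n(2) by (simp add: u_def)
  have sgn: "rel \<mu> \<nu> \<or> gt \<mu> \<nu> \<and> weight u \<nu> < weight u \<mu> \<or> gt \<nu> \<mu> \<and> weight u \<mu> < weight u \<nu>"
    if "\<mu> \<in> M" "\<nu> \<in> M" for \<mu> \<nu>
    using n(1) that by (simp add: u_def)
  have relD: "rel \<mu> \<nu> \<Longrightarrow> weight u \<mu> = weight u \<nu>" for \<mu> \<nu>
    by (simp add: rel_def u_def)
  obtain i where i: "\<And>l. u $ i \<le> u $ l"
    by (rule exists_min_coordinate) blast
  have order: "\<alpha> * u $ i < weight u \<mu>0 - u $ j" if "\<mu>0 \<in> M" "low j \<mu>0" for j \<mu>0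
    using n(3) that i by (simp add: u_def)
  let ?D = "argmins (supp a) u"
  let ?S = "convex hull (exponent_point ` ?D)"
  have "u \<in> nonneg_orthant"
    using pos by (simp add: nonneg_orthant_def less_imp_le)
  then have Dne: "?D \<noteq> {}"
    by (rule argmins_nonempty[OF ne])
  have "?S \<in> compact_faces a"
    unfolding compact_face_iff[OF ne] using pos by blast
  then have "nondegenerate_on a ?S"
    using kou by (simp add: kouchnirenko_nondegenerate_def)
  \<comment> \<open>Nondegeneracy is applied on the face with normal \<open>u\<close> at the limit
    point \<open>\<tau>\<close>, which lies in the torus.\<close>
  then have "gradient (face_part a ?S) \<tau> \<noteq> 0"
    using \<tau> by (auto simp: nondegenerate_on_def)
  then obtain j where "gradient (face_part a ?S) \<tau> $ j \<noteq> 0"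
    by (auto simp: vec_eq_iff)
  then have nz: "(\<Sum>\<nu>\<in>{\<nu>. exponent_point \<nu> \<in> ?S}. of_nat (\<nu> $ j) * a \<nu> * monomial \<tau> (lower j \<nu>)) \<noteq> 0"
    by (simp add: gradient_face_part)
  have "(\<Sum>\<nu>\<in>{\<nu>. exponent_point \<nu> \<in> ?S}. of_nat (\<nu> $ j) * a \<nu> * monomial \<tau> (lower j \<nu>)) =
      (\<Sum>\<nu>\<in>{\<nu>\<in>?D. 1 \<le> \<nu> $ j}. of_nat (\<nu> $ j) * a \<nu> * monomial \<tau> (lower j \<nu>))"
  proof (rule sum.mono_neutral_right)
    \<comment> \<open>A sum over an infinite index set is 0 by convention, so nonvanishing yields
      finiteness.\<close>
    show "finite {\<nu>. exponent_point \<nu> \<in> ?S}"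
      using nz by (rule contrapos_np) simp
    show "{\<nu>\<in>?D. 1 \<le> \<nu> $ j} \<subseteq> {\<nu>. exponent_point \<nu> \<in> ?S}"
      by (auto intro: hull_inc)
    show "\<forall>\<nu>\<in>{\<nu>. exponent_point \<nu> \<in> ?S} - {\<nu>\<in>?D. 1 \<le> \<nu> $ j}. of_nat (\<nu> $ j) * a \<nu> * monomial \<tau> (lower j \<nu>) = 0"
      using argmins_face_iff[OF _ Dne] by (auto simp: supp_def)
  qed
  with nz have nzD: "(\<Sum>\<nu>\<in>{\<nu>\<in>?D. 1 \<le> \<nu> $ j}. of_nat (\<nu> $ j) * a \<nu> * monomial \<tau> (lower j \<nu>)) \<noteq> 0"
    by simp
  then obtain \<mu>1 where \<mu>1: "\<mu>1 \<in> ?D" "1 \<le> \<mu>1 $ j"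
    using sum.empty by (metis (mono_tags, lifting) empty_Collect_eq)
  have DM: "\<nu> \<in> M" if \<nu>: "\<nu> \<in> ?D" "1 \<le> \<nu> $ l" for \<nu> l
  proof -
    have "\<nu> \<in> supp a"
      using \<nu>(1) by (simp add: argmins_def)
    from M(3)[OF this \<nu>(2)] obtain \<mu> where \<mu>: "\<mu> \<in> M" "\<mu> \<le> \<nu>"
      by blast
    have "\<mu> = \<nu>"
    proof (rule ccontr)
      assume "\<mu> \<noteq> \<nu>"
      then have "weight u \<mu> < weight u \<nu>"
        using weight_strict_mono[OF \<mu>(2) _ pos] by blast
      then show False
        using \<nu>(1) \<mu>(1) M(2) by (force simp: argmins_def)
    qed
    then show ?thesis
      using \<mu> by simp
  qed
  have \<mu>1M: "\<mu>1 \<in> M"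
    using DM \<mu>1 by blast
  have "{\<mu>\<in>M. 1 \<le> \<mu> $ j \<and> rel \<mu> \<mu>1} = {\<nu>\<in>?D. 1 \<le> \<nu> $ j}"
  proof (intro set_eqI iffI)
    fix \<mu> assume "\<mu> \<in> {\<mu>\<in>M. 1 \<le> \<mu> $ j \<and> rel \<mu> \<mu>1}"
    then show "\<mu> \<in> {\<nu>\<in>?D. 1 \<le> \<nu> $ j}"
      using relD[of \<mu> \<mu>1] \<mu>1 M(2) by (auto simp: argmins_def)
  next
    fix \<mu> assume "\<mu> \<in> {\<nu>\<in>?D. 1 \<le> \<nu> $ j}"
    then have "\<mu> \<in> ?D" "1 \<le> \<mu> $ j"
      by auto
    then show "\<mu> \<in> {\<mu>\<in>M. 1 \<le> \<mu> $ j \<and> rel \<mu> \<mu>1}"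
      using DM[of \<mu> j] sgn[OF _ \<mu>1M, of \<mu>] argmins_eq[OF _ \<mu>1(1), of \<mu>] by auto
  qed
  moreover have "rel \<mu> \<mu>1 \<or> gt \<mu> \<mu>1" if "\<mu> \<in> M" for \<mu>
  proof -
    have "weight u \<mu>1 \<le> weight u \<mu>"
      using \<mu>1(1) that M(2) by (auto simp: argmins_def)
    then show ?thesis
      using sgn[OF that \<mu>1M] by auto
  qed
  ultimately have "low j \<mu>1"
    using \<mu>1(2) nzD by (simp add: low_def)
  from order[OF \<mu>1M this] have \<mu>1_gt: "\<alpha> * u $ i + u $ j < weight u \<mu>1"
    by simp
  show ?thesis
  proof (rule that[OF pos i])
    fix \<nu> assume "\<nu> \<in> supp a"
    then have "weight u \<mu>1 \<le> weight u \<nu>"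
      using \<mu>1(1) by (simp add: argmins_def)
    \<comment> \<open>The unknown index \<open>j\<close> of the surviving derivative is eliminated
      by \<open>u $ i \<le> u $ j\<close>.\<close>
    then show "(\<alpha> + 1) * u $ i < weight u \<nu>"
      using \<mu>1_gt i[of j] by (simp add: algebra_simps)
  next
    fix l \<nu> assume dom: "dominates (supp a) u l \<nu>"
    then have \<nu>: "\<nu> \<in> supp a" "1 \<le> \<nu> $ l"
      by (auto simp: dominates_def)
    obtain \<mu> where \<mu>: "\<mu> \<in> M" "1 \<le> \<mu> $ l" "\<mu> \<le> \<nu>"
      using M(3)[OF \<nu>] by blast
    have "\<mu> = \<nu>"
    proof (rule ccontr)
      assume "\<mu> \<noteq> \<nu>"
      then have "weight u \<mu> < weight u \<nu>" "weight u \<nu> < weight u \<mu>"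
        using weight_strict_mono[OF \<mu>(3) _ pos] dom \<mu> M(2) by (auto simp: dominates_def)
      then show False
        by simp
    qed
    then have \<nu>M: "\<nu> \<in> M"
      using \<mu> by simp
    have strict: "\<mu> = \<nu> \<or> \<not> rel \<mu> \<nu> \<and> gt \<mu> \<nu>" if "\<mu> \<in> M" "1 \<le> \<mu> $ l" for \<mu>
    proof (cases "\<mu> = \<nu>")
      case False
      then have "weight u \<nu> < weight u \<mu>"
        using dom that M(2) by (auto simp: dominates_def)
      then show ?thesis
        using sgn[OF that(1) \<nu>M] relD[of \<mu> \<nu>] by auto
    qed simp
    have rel_refl: "rel \<nu> \<nu>"
      by (simp add: rel_def)
    have "{\<mu>\<in>M. 1 \<le> \<mu> $ l \<and> rel \<mu> \<nu>} = {\<nu>}"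
      using strict rel_refl \<nu>M \<nu>(2) by auto
    moreover have "monomial \<tau> (lower l \<nu>) \<noteq> 0"
      using \<tau> by (simp add: monomial_def)
    moreover have "\<forall>\<mu>\<in>M. 1 \<le> \<mu> $ l \<longrightarrow> rel \<mu> \<nu> \<or> gt \<mu> \<nu>"
      using strict rel_refl by blast
    ultimately have "low l \<nu>"
      using \<nu> by (simp add: low_def supp_def)
    then show "\<alpha> * u $ i < weight u \<nu> - u $ l"
      by (rule order[OF \<nu>M])
  qed
qed

section \<open>The exponent in the presence of an edge $I_j^k$\<close>

lemma norm_monomial_weight:
  assumes t: "0 < t" and z: "\<And>l. norm (z $ l) \<le> t powr (u $ l)"
  shows "norm (monomial z \<nu>) \<le> t powr weight u \<nu>"
proof -
  have "norm (monomial z \<nu>) \<le> (\<Prod>l\<in>UNIV. (t powr (u $ l)) ^ (\<nu> $ l))"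
    unfolding norm_monomial by (intro prod_mono conjI power_mono z) auto
  also have "\<dots> = (\<Prod>l\<in>UNIV. t powr (u $ l * real (\<nu> $ l)))"
    using t by (intro prod.cong) (simp_all add: powr_powr flip: powr_realpow)
  also have "\<dots> = t powr weight u \<nu>"
    using t by (simp add: weight_sum powr_sum)
  finally show ?thesis .
qed

lemma powr_less_at_right_0:
  fixes w \<eta> :: real
  assumes "0 < w" "0 < \<eta>"
  shows "\<forall>\<^sub>F t in at_right 0. t powr w < \<eta>"
proof -
  have "((\<lambda>t::real. t powr w) \<longlongrightarrow> 0) (at_right 0)"
    using assms by (intro tendsto_zero_powrI[of _ _ "\<lambda>_. w"] eventually_at_rightI[of 0 1] tendsto_intros) (auto intro: tendsto_ident_at)
  then show ?thesis
    using assms order_tendstoD(2) by blast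
qed

text \<open>On the polydisc \<open>norm (z $ l) \<le> t powr (u $ l)\<close> every other term is of
  higher order in \<open>t\<close> than the bound for the dominating monomial. The polydisc may
  touch coordinate planes, hence the error is measured by a power of \<open>t\<close>.\<close>

lemma gradient_dominant:
  fixes f :: "complex ^ 'n::finite \<Rightarrow> complex"
  assumes f: "has_taylor_expansion f a" and pos: "\<And>l. 0 < u $ l" and dom: "dominates (supp a) u j p" and \<eta>: "0 < \<eta>"
  shows "\<forall>\<^sub>F t in at_right 0. \<forall>z. (\<forall>l. norm (z $ l) \<le> t powr (u $ l)) \<longrightarrow>
    norm (gradient f z $ j - of_nat (p $ j) * a p * monomial z (lower j p)) \<le> \<eta> * t powr (weight u p - u $ j)"
proof -
  obtain M where M: "finite M" "M \<subseteq> supp a"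
    "\<And>j \<nu>. \<nu> \<in> supp a \<Longrightarrow> 1 \<le> \<nu> $ j \<Longrightarrow> \<exists>\<mu>\<in>M. 1 \<le> \<mu> $ j \<and> \<mu> \<le> \<nu>"
    "\<And>\<epsilon> j. 0 < \<epsilon> \<Longrightarrow> \<exists>\<delta>>0. \<forall>z. (\<forall>i. norm (z $ i) \<le> \<delta>) \<longrightarrow>
      norm (gradient f z $ j - (\<Sum>\<mu>\<in>{\<mu>\<in>M. 1 \<le> \<mu> $ j}. of_nat (\<mu> $ j) * a \<mu> * monomial z (lower j \<mu>)))
        \<le> \<epsilon> * (\<Sum>\<mu>\<in>{\<mu>\<in>M. 1 \<le> \<mu> $ j}. norm (monomial z (lower j \<mu>)))"
    by (rule gradient_approx[OF f]) blast
  have p: "p \<in> supp a" "1 \<le> p $ j"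
    and less: "\<And>\<mu>. \<mu> \<in> supp a \<Longrightarrow> 1 \<le> \<mu> $ j \<Longrightarrow> \<mu> \<noteq> p \<Longrightarrow> weight u p < weight u \<mu>"
    using dom by (auto simp: dominates_def)
  define N where "N = {\<mu>\<in>M. 1 \<le> \<mu> $ j}"
  have N: "finite N" "\<And>\<mu>. \<mu> \<in> N \<Longrightarrow> \<mu> \<in> supp a \<and> 1 \<le> \<mu> $ j"
    using M(1,2) by (auto simp: N_def)
  have pN: "p \<in> N"
  proof -
    obtain \<mu> where \<mu>: "\<mu> \<in> M" "1 \<le> \<mu> $ j" "\<mu> \<le> p"
      using M(3)[OF p] by blast
    have "\<mu> = p"
    proof (rule ccontr)
      assume ne: "\<mu> \<noteq> p"
      then have "weight u p < weight u \<mu>"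
        using less[of \<mu>] \<mu> M(2) by blast
      moreover have "weight u \<mu> < weight u p"
        by (rule weight_strict_mono[OF \<mu>(3) ne pos])
      ultimately show False
        by simp
    qed
    then show ?thesis
      using \<mu> by (simp add: N_def)
  qed
  define K where "K = (\<Sum>\<mu>\<in>N. norm (of_nat (\<mu> $ j) * a \<mu>))"
  have K: "0 \<le> K"
    by (simp add: K_def sum_nonneg)
  \<comment> \<open>One half of \<open>\<eta>\<close> is reserved for the approximation error, the
    other for the finitely many nondominating terms.\<close>
  define \<epsilon> where "\<epsilon> = \<eta> / (2 * (real (card N) + 1))"
  define \<eta>' where "\<eta>' = \<eta> / (2 * (K + 1))"
  have \<epsilon>: "0 < \<epsilon>" "\<epsilon> * real (card N) \<le> \<eta> / 2" and \<eta>': "0 < \<eta>'" "\<eta>' * K \<le> \<eta> / 2"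
    using \<eta> K by (simp_all add: \<epsilon>_def \<eta>'_def field_simps)
  obtain \<delta> where \<delta>: "0 < \<delta>" "\<And>z. (\<And>i. norm (z $ i) \<le> \<delta>) \<Longrightarrow>
      norm (gradient f z $ j - (\<Sum>\<mu>\<in>N. of_nat (\<mu> $ j) * a \<mu> * monomial z (lower j \<mu>)))
        \<le> \<epsilon> * (\<Sum>\<mu>\<in>N. norm (monomial z (lower j \<mu>)))"
    using M(4)[OF \<epsilon>(1), of j] unfolding N_def by blast
  have "\<forall>\<^sub>F t::real in at_right 0. \<forall>l\<in>UNIV. t powr (u $ l) < \<delta>"
    by (intro eventually_ball_finite ballI powr_less_at_right_0 pos \<delta>(1)) simp
  moreover have "\<forall>\<^sub>F t::real in at_right 0. \<forall>\<mu>\<in>N - {p}. t powr (weight u \<mu> - weight u p) < \<eta>'"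
  proof (intro eventually_ball_finite ballI powr_less_at_right_0 \<eta>'(1))
    fix \<mu> assume "\<mu> \<in> N - {p}"
    then show "0 < weight u \<mu> - weight u p"
      using less N(2) by auto
  qed (use N(1) in simp)
  moreover have "\<forall>\<^sub>F t::real in at_right 0. 0 < t \<and> t \<le> 1"
    by (rule eventually_at_rightI[of 0 1]) auto
  ultimately show ?thesis
  proof eventually_elim
    case (elim t)
    show ?case
    proof (intro allI impI)
      fix z :: "complex ^ 'n" assume z: "\<forall>l. norm (z $ l) \<le> t powr (u $ l)"
      define T where "T = t powr (weight u p - u $ j)"
      have mono: "norm (monomial z (lower j \<mu>)) \<le> t powr (weight u \<mu> - u $ j)" if "\<mu> \<in> N" for \<mu>
        using norm_monomial_weight[of t z u "lower j \<mu>"] z elim N(2)[OF that] by (simp add: weight_lower)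
      have "norm (gradient f z $ j - (\<Sum>\<mu>\<in>N. of_nat (\<mu> $ j) * a \<mu> * monomial z (lower j \<mu>)))
          \<le> \<epsilon> * (\<Sum>\<mu>\<in>N. norm (monomial z (lower j \<mu>)))"
      proof (rule \<delta>(2))
        fix i
        have "norm (z $ i) \<le> t powr (u $ i)" "t powr (u $ i) < \<delta>"
          using z elim by auto
        then show "norm (z $ i) \<le> \<delta>"
          by simp
      qed
      also have "(\<Sum>\<mu>\<in>N. norm (monomial z (lower j \<mu>))) \<le> (\<Sum>\<mu>\<in>N. T)"
      proof (rule sum_mono)
        fix \<mu> assume \<mu>: "\<mu> \<in> N"
        have "weight u p \<le> weight u \<mu>"
          using less[of \<mu>] N(2)[OF \<mu>] by (cases "\<mu> = p") auto
        then have "t powr (weight u \<mu> - u $ j) \<le> T"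
          unfolding T_def using elim by (intro powr_mono') auto
        then show "norm (monomial z (lower j \<mu>)) \<le> T"
          using mono[OF \<mu>] by linarith
      qed
      also have "\<epsilon> * (\<Sum>\<mu>\<in>N. T) = (\<epsilon> * real (card N)) * T"
        by simp
      also have "\<dots> \<le> \<eta> / 2 * T"
        by (rule mult_right_mono[OF \<epsilon>(2)]) (simp add: T_def)
      finally have 1: "norm (gradient f z $ j - (\<Sum>\<mu>\<in>N. of_nat (\<mu> $ j) * a \<mu> * monomial z (lower j \<mu>))) \<le> \<eta> / 2 * T"
        using \<epsilon>(1) by simp
      have "norm (\<Sum>\<mu>\<in>N - {p}. of_nat (\<mu> $ j) * a \<mu> * monomial z (lower j \<mu>))
          \<le> (\<Sum>\<mu>\<in>N - {p}. norm (of_nat (\<mu> $ j) * a \<mu>) * (\<eta>' * T))"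
      proof (rule sum_norm_le)
        fix \<mu> assume \<mu>: "\<mu> \<in> N - {p}"
        have "norm (monomial z (lower j \<mu>)) \<le> t powr (weight u \<mu> - u $ j)"
          using mono \<mu> by simp
        also have "\<dots> = t powr (weight u \<mu> - weight u p) * T"
          by (simp add: T_def flip: powr_add)
        also have "\<dots> \<le> \<eta>' * T"
          using elim \<mu> by (intro mult_right_mono less_imp_le) (auto simp: T_def)
        finally show "norm (of_nat (\<mu> $ j) * a \<mu> * monomial z (lower j \<mu>)) \<le> norm (of_nat (\<mu> $ j) * a \<mu>) * (\<eta>' * T)"
          unfolding norm_mult[of "of_nat (\<mu> $ j) * a \<mu>"] by (rule mult_left_mono) simp
      qed
      also have "\<dots> \<le> (\<Sum>\<mu>\<in>N. norm (of_nat (\<mu> $ j) * a \<mu>) * (\<eta>' * T))"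
        using \<eta>'(1) by (intro sum_mono2 N) (auto simp: T_def)
      also have "\<dots> = (\<eta>' * K) * T"
        by (simp add: K_def sum_distrib_right sum_distrib_left mult_ac)
      also have "\<dots> \<le> \<eta> / 2 * T"
        by (rule mult_right_mono[OF \<eta>'(2)]) (simp add: T_def)
      finally have 2: "norm (\<Sum>\<mu>\<in>N - {p}. of_nat (\<mu> $ j) * a \<mu> * monomial z (lower j \<mu>)) \<le> \<eta> / 2 * T" .
      have "(\<Sum>\<mu>\<in>N. of_nat (\<mu> $ j) * a \<mu> * monomial z (lower j \<mu>)) =
          of_nat (p $ j) * a p * monomial z (lower j p) + (\<Sum>\<mu>\<in>N - {p}. of_nat (\<mu> $ j) * a \<mu> * monomial z (lower j \<mu>))"
        by (rule sum.remove[OF N(1) pN])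
      then have "gradient f z $ j - of_nat (p $ j) * a p * monomial z (lower j p) =
          (gradient f z $ j - (\<Sum>\<mu>\<in>N. of_nat (\<mu> $ j) * a \<mu> * monomial z (lower j \<mu>))) +
          (\<Sum>\<mu>\<in>N - {p}. of_nat (\<mu> $ j) * a \<mu> * monomial z (lower j \<mu>))"
        by (simp add: algebra_simps)
      then have "norm (gradient f z $ j - of_nat (p $ j) * a p * monomial z (lower j p)) \<le> \<eta> / 2 * T + \<eta> / 2 * T"
        by (simp only: norm_triangle_mono[OF 1 2])
      then show "norm (gradient f z $ j - of_nat (p $ j) * a p * monomial z (lower j p)) \<le> \<eta> * t powr (weight u p - u $ j)"
        by (simp add: T_def)
    qed
  qed
qed

text \<open>Near 0 the derivatives by \<open>z_j\<close> and \<open>z_l\<close> are close to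
  \<open>a p * z_l\<close> and \<open>a p * z_j\<close>, so for given \<open>z_i = t\<close> they
  have a common zero. There only the \<open>i\<close>-th derivative is left, of order at most
  \<open>t powr (k - 1)\<close>, while the norm of the point is at least \<open>t\<close>.\<close>

lemma special_pair_exponent_ge:
  fixes f :: "complex ^ 3 \<Rightarrow> complex"
  assumes f: "has_taylor_expansion f a" and v: "\<And>l. 0 < v $ l"
    and arg: "argmins (supp a) v = special_pair i k" and k: "2 \<le> k" and C: "0 < C" and r: "0 < r"
    and bound: "\<And>z. norm z < r \<Longrightarrow> C * norm z powr \<alpha> \<le> norm (gradient f z)" and \<alpha>: "0 \<le> \<alpha>"
  shows "real k - 1 \<le> \<alpha>"
proof -
  obtain j where ij: "i \<noteq> j"
    using exists_other by blast
  obtain l where il: "i \<noteq> l" and jl: "j \<noteq> l"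
    using exists_third[OF ij] by blast
  note UN = UNIV_three[OF ij il jl]
  define u where "u = (1 / v $ i) *\<^sub>R v"
  have "v $ i \<noteq> 0"
    using v[of i] by simp
  then have u: "\<And>m. 0 < u $ m" "u $ i = 1"
    using v by (simp_all add: u_def)
  have wu: "weight u \<nu> = weight v \<nu> / v $ i" for \<nu>
    by (simp add: weight_def u_def)
  define p :: "nat ^ 3" where "p = (\<chi> m. if m = i then 0 else 1)"
  define q :: "nat ^ 3" where "q = (\<chi> m. if m = i then k else 0)"
  have D: "argmins (supp a) v = {q, p}"
    by (simp add: arg special_pair_def p_def q_def)
  have comp: "p $ i = 0" "p $ j = 1" "p $ l = 1" "q $ i = k" "q $ j = 0" "q $ l = 0"
    using ij il by (auto simp: p_def q_def)
  have ps: "p \<in> supp a" "q \<in> supp a" "weight v p = weight v q"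
    using D argmins_eq[of p "supp a" v q] by (auto simp: argmins_def)
  have wq: "weight u q = real k" and wp: "weight u p = u $ j + u $ l"
    by (simp_all add: weight_three[OF ij il jl] comp u)
  have wpq: "weight u p = weight u q"
    by (simp add: wu ps)
  have strict: "weight u q < weight u \<mu>" if \<mu>: "\<mu> \<in> supp a" "\<mu> \<noteq> p" "\<mu> \<noteq> q" for \<mu>
  proof -
    have "\<mu> \<notin> argmins (supp a) v"
      using \<mu> D by simp
    then obtain \<nu> where "\<nu> \<in> supp a" "weight v \<nu> < weight v \<mu>"
      using \<mu>(1) by (auto simp: argmins_def not_le)
    moreover have "q \<in> argmins (supp a) v"
      using D by simp
    ultimately have "weight v q < weight v \<mu>"
      by (fastforce simp: argmins_def)
    then show ?thesis
      using v[of i] by (simp add: wu divide_strict_right_mono)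
  qed
  have dom: "dominates (supp a) u j p" "dominates (supp a) u l p" "dominates (supp a) u i q"
    unfolding dominates_def using ps strict wpq comp k by force+
  have ap: "a p \<noteq> 0"
    using ps(1) by (simp add: supp_def)
  obtain r0 where r0: "0 < r0" "continuous_on (ball 0 r0) (gradient f)"
    using gradient_continuous[OF f] by blast
  \<comment> \<open>Three coordinates, each of modulus below \<open>R\<close>, keep the point inside
    both balls.\<close>
  define R where "R = min r r0 / 3"
  have R: "0 < R"
    using r r0 by (simp add: R_def)
  define B where "B = 1 + real k * norm (a q)"
  have "\<forall>\<^sub>F t::real in at_right 0. 0 < t"
    by (rule eventually_at_right_less)
  moreover have "\<forall>\<^sub>F t::real in at_right 0. \<forall>m\<in>UNIV. t powr (u $ m) < R"
    by (intro eventually_ball_finite ballI powr_less_at_right_0 u R) simp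
  moreover have "\<forall>\<^sub>F t in at_right 0. \<forall>z. (\<forall>m. norm (z $ m) \<le> t powr (u $ m)) \<longrightarrow>
      norm (gradient f z $ j - of_nat (p $ j) * a p * monomial z (lower j p)) \<le> norm (a p) * t powr (weight u p - u $ j)"
    using gradient_dominant[OF f u(1) dom(1), of "norm (a p)"] ap by simp
  moreover have "\<forall>\<^sub>F t in at_right 0. \<forall>z. (\<forall>m. norm (z $ m) \<le> t powr (u $ m)) \<longrightarrow>
      norm (gradient f z $ l - of_nat (p $ l) * a p * monomial z (lower l p)) \<le> norm (a p) * t powr (weight u p - u $ l)"
    using gradient_dominant[OF f u(1) dom(2), of "norm (a p)"] ap by simp
  moreover have "\<forall>\<^sub>F t in at_right 0. \<forall>z. (\<forall>m. norm (z $ m) \<le> t powr (u $ m)) \<longrightarrow>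
      norm (gradient f z $ i - of_nat (q $ i) * a q * monomial z (lower i q)) \<le> 1 * t powr (weight u q - u $ i)"
    by (rule gradient_dominant[OF f u(1) dom(3)]) simp
  ultimately have key: "\<forall>\<^sub>F t in at_right 0. 0 < t \<and> C * t powr \<alpha> \<le> B * t powr (real k - 1)"
  proof eventually_elim
    case (elim t)
    have t: "0 < t"
      by fact
    define z :: "complex \<times> complex \<Rightarrow> complex ^ 3" where
      "z = (\<lambda>y. \<chi> m. if m = i then of_real t else if m = j then of_real (t powr (u $ j)) * fst y
        else of_real (t powr (u $ l)) * snd y)"
    have zc: "z y $ i = of_real t" "z y $ j = of_real (t powr (u $ j)) * fst y" "z y $ l = of_real (t powr (u $ l)) * snd y" for y
      using ij il jl by (auto simp: z_def)
    define S :: "(complex \<times> complex) set" where "S = cball 0 1 \<times> cball 0 1"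
    have zle: "\<forall>m. norm (z y $ m) \<le> t powr (u $ m)" if "y \<in> S" for y
    proof -
      have "norm (fst y) \<le> 1" "norm (snd y) \<le> 1"
        using that by (auto simp: S_def)
      then have "norm (z y $ m) \<le> t powr (u $ m)" if "m \<in> {i, j, l}" for m
        using that t u(2) by (auto simp: zc norm_mult mult_left_le)
      then show ?thesis
        using UN by blast
    qed
    have znorm: "norm (z y) < min r r0" if "y \<in> S" for y
    proof -
      have "norm (z y) \<le> (\<Sum>m\<in>UNIV. norm (z y $ m))"
        unfolding norm_vec_def by (rule L2_set_le_sum) simp
      also have "\<dots> < (\<Sum>m\<in>(UNIV :: 3 set). R)"
        by (rule sum_strict_mono) (use elim zle[OF that] in \<open>auto intro: le_less_trans\<close>)
      finally show ?thesis
        by (simp add: R_def)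
    qed
    \<comment> \<open>The factors \<open>t powr\<close> rescale the polydisc to a product of unit
      discs and normalise the linear parts to the identity. The derivatives appear crosswise because
      the derivative of \<open>z_j z_l\<close> by \<open>z_l\<close> is \<open>z_j\<close>. Fixed
      points are common zeros.\<close>
    define G where "G = (\<lambda>y. (fst y - gradient f (z y) $ l / (a p * of_real (t powr (u $ j))),
      snd y - gradient f (z y) $ j / (a p * of_real (t powr (u $ l)))))"
    have low: "monomial (z y) (lower j p) = z y $ l" "monomial (z y) (lower l p) = z y $ j" for y
      using ij il jl by (auto simp: monomial_def UN lower_def comp)
    have nz: "a p * of_real (t powr (u $ j)) \<noteq> 0" "a p * of_real (t powr (u $ l)) \<noteq> 0"
      using ap t by auto
    have "\<exists>y\<in>S. G y = y"
    proof (rule brouwer)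
      show "compact S" "convex S" "S \<noteq> {}"
        unfolding S_def by (auto intro: compact_Times convex_Times)
      have "continuous_on S z"
        unfolding z_def
      proof (rule continuous_on_vec_lambda)
        fix m
        show "continuous_on S (\<lambda>y. if m = i then complex_of_real t else if m = j then of_real (t powr (u $ j)) * fst y
            else of_real (t powr (u $ l)) * snd y)"
          by (cases "m = i"; cases "m = j") (auto intro!: continuous_intros)
      qed
      moreover have "z ` S \<subseteq> ball 0 r0"
        using znorm by auto
      ultimately have "continuous_on S (\<lambda>y. gradient f (z y))"
        using continuous_on_compose2[OF r0(2)] by blast
      then show "continuous_on S G"
        unfolding G_def using nz by (intro continuous_intros) auto
      show "G \<in> S \<rightarrow> S"
      proof
        fix y assume y: "y \<in> S"
        have 1: "norm (gradient f (z y) $ l - a p * z y $ j) \<le> norm (a p) * t powr (u $ j)"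
          using mp[OF spec[OF elim(4)] zle[OF y]] by (simp add: comp low wp)
        have 2: "norm (gradient f (z y) $ j - a p * z y $ l) \<le> norm (a p) * t powr (u $ l)"
          using mp[OF spec[OF elim(3)] zle[OF y]] by (simp add: comp low wp)
        have "fst (G y) = (a p * z y $ j - gradient f (z y) $ l) / (a p * of_real (t powr (u $ j)))"
          using nz by (simp add: G_def zc diff_divide_distrib)
        then have "norm (fst (G y)) \<le> 1"
          using 1 nz by (simp add: norm_divide norm_mult norm_minus_commute divide_le_eq)
        moreover have "snd (G y) = (a p * z y $ l - gradient f (z y) $ j) / (a p * of_real (t powr (u $ l)))"
          using nz by (simp add: G_def zc diff_divide_distrib)
        then have "norm (snd (G y)) \<le> 1"
          using 2 nz by (simp add: norm_divide norm_mult norm_minus_commute divide_le_eq)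
        ultimately show "G y \<in> S"
          by (simp add: S_def mem_Times_iff)
      qed
    qed blast
    then obtain y where y: "y \<in> S" "G y = y"
      by blast
    from y(2) have "fst (G y) = fst y" "snd (G y) = snd y"
      by simp_all
    then have g0: "gradient f (z y) $ l = 0" "gradient f (z y) $ j = 0"
      using nz by (simp_all add: G_def)
    have "norm (gradient f (z y)) \<le> (\<Sum>m\<in>UNIV. norm (gradient f (z y) $ m))"
      unfolding norm_vec_def by (rule L2_set_le_sum) simp
    also have "\<dots> = norm (gradient f (z y) $ i)"
      using ij il jl by (simp add: UN g0)
    also have "\<dots> \<le> 1 * t powr (weight u q - u $ i) + norm (of_nat (q $ i) * a q * monomial (z y) (lower i q))"
      using mp[OF spec[OF elim(5)] zle[OF y(1)]]
        norm_triangle_sub[of "gradient f (z y) $ i" "of_nat (q $ i) * a q * monomial (z y) (lower i q)"] by linarith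
    also have "norm (of_nat (q $ i) * a q * monomial (z y) (lower i q)) \<le> real k * norm (a q) * t powr (weight u q - u $ i)"
      using norm_monomial_weight[OF t, of "z y" u "lower i q"] zle[OF y(1)] k
      by (simp add: norm_mult comp weight_lower mult_left_mono)
    finally have "norm (gradient f (z y)) \<le> B * t powr (real k - 1)"
      by (simp add: B_def wq u(2) algebra_simps)
    moreover have "C * norm (z y) powr \<alpha> \<le> norm (gradient f (z y))"
      using znorm[OF y(1)] by (intro bound) simp
    moreover have "t \<le> norm (z y)"
      using Finite_Cartesian_Product.norm_nth_le[of "z y" i] t by (simp add: zc)
    then have "C * t powr \<alpha> \<le> C * norm (z y) powr \<alpha>"
      using C t \<alpha> by (intro mult_left_mono powr_mono2) auto
    ultimately show ?case
      using t by simp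
  qed
  show ?thesis
  proof (rule ccontr)
    assume "\<not> ?thesis"
    then have d: "0 < real k - 1 - \<alpha>"
      by simp
    have B: "0 < B"
      by (simp add: B_def add_pos_nonneg)
    have "\<forall>\<^sub>F t::real in at_right 0. t powr (real k - 1 - \<alpha>) < C / B"
      using C B by (intro powr_less_at_right_0 d) simp
    with key have "\<forall>\<^sub>F t::real in at_right 0. False"
    proof eventually_elim
      case (elim t)
      have "B * t powr (real k - 1) = B * t powr (real k - 1 - \<alpha>) * t powr \<alpha>"
        by (simp flip: powr_add)
      also have "\<dots> < C * t powr \<alpha>"
        using elim B by (intro mult_strict_right_mono) (auto simp: field_simps)
      finally show ?case
        using elim by simp
    qed
    then show False
      by simp
  qed
qed

text \<open>The coordinate sums of the ends are 2 and \<open>k\<close>, so the unordered pair of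
  ends determines \<open>k\<close>.\<close>

lemma special_segment_height_unique:
  assumes "special_segment j k = special_segment j' k'"
  shows "k = k'"
proof -
  let ?\<phi> = "\<lambda>x :: real ^ 3. \<Sum>i\<in>UNIV. x $ i"
  have "{(\<chi> i. if i = j then 0 else 1), real k *\<^sub>R axis j 1} =
      {(\<chi> i. if i = j' then 0 else 1) :: real ^ 3, real k' *\<^sub>R axis j' 1}"
    using assms by (simp only: special_segment_def closed_segment_eq)
  then have "?\<phi> ` {(\<chi> i. if i = j then 0 else 1), real k *\<^sub>R axis j 1} =
      ?\<phi> ` {(\<chi> i. if i = j' then 0 else 1), real k' *\<^sub>R axis j' 1}"
    by (rule arg_cong)
  moreover have "?\<phi> (\<chi> i. if i = j then 0 else 1) = 2" for j
    by (simp add: sum.If_cases Compl_eq_Diff_UNIV card_Diff_singleton)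
  moreover have "?\<phi> (real k *\<^sub>R axis j 1) = real k" for j k
    by (simp add: axis_def if_distrib cong: if_cong)
  ultimately have "{2, real k} = {2, real k'}"
    by (simp only: image_insert image_empty)
  then show ?thesis
    by (auto simp: doubleton_eq_iff)
qed

lemma segment_height_special_segment: "2 \<le> k \<Longrightarrow> segment_height (special_segment j k) = k"
  unfolding segment_height_def using special_segment_height_unique by (intro the_equality) blast+

section \<open>Estimates of the exponent and conclusion\<close>

lemma gradient_bound:
  assumes "has_taylor_expansion f a" "kouchnirenko_nondegenerate a" "supp a \<noteq> {}" "0 \<le> \<alpha>"
    and dom: "\<And>u i. (\<And>l. 0 < u $ l) \<Longrightarrow> (\<And>l. u $ i \<le> u $ l) \<Longrightarrow>
      (\<And>\<nu>. \<nu> \<in> supp a \<Longrightarrow> (\<alpha> + 1) * u $ i < weight u \<nu>) \<Longrightarrow>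
      \<exists>j \<nu>. dominates (supp a) u j \<nu> \<and> weight u \<nu> - u $ j \<le> \<alpha> * u $ i"
  shows "\<exists>C>0. \<exists>r>0. \<forall>z. norm z < r \<longrightarrow> C * norm z powr \<alpha> \<le> norm (gradient f z)"
proof (rule ccontr)
  assume "\<not> ?thesis"
  from gradient_bound_failure[OF assms(1-4) this] obtain u i where u: "\<And>l. 0 < u $ l" "\<And>l. u $ i \<le> u $ l"
    "\<And>\<nu>. \<nu> \<in> supp a \<Longrightarrow> (\<alpha> + 1) * u $ i < weight u \<nu>"
    "\<And>j \<nu>. dominates (supp a) u j \<nu> \<Longrightarrow> \<alpha> * u $ i < weight u \<nu> - u $ j"
    by blast
  obtain j \<nu> where "dominates (supp a) u j \<nu>" "weight u \<nu> - u $ j \<le> \<alpha> * u $ i"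
    using dom[OF u(1-3)] by blast
  with u(4)[of j \<nu>] show False
    by simp
qed

lemma lojasiewicz_exponent_le:
  assumes "0 \<le> \<alpha>" "\<exists>C>0. \<exists>r>0. \<forall>z. norm z < r \<longrightarrow> C * norm z powr \<alpha> \<le> norm (gradient f z)"
  shows "lojasiewicz_exponent f \<le> \<alpha>"
  unfolding lojasiewicz_exponent_def using assms by (intro cInf_lower bdd_belowI[of _ 0]) auto

lemma lojasiewicz_exponent_special_pair:
  fixes f :: "complex ^ 3 \<Rightarrow> complex"
  assumes f: "has_taylor_expansion f a" and kou: "kouchnirenko_nondegenerate a" and iso: "isolated_support (supp a)"
    and u: "\<And>l. 0 < u $ l" "argmins (supp a) u = special_pair i k" and k: "2 \<le> k"
  shows "lojasiewicz_exponent f = real k - 1"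
proof (rule antisym)
  have k1: "0 \<le> real k - 1"
    using k by simp
  have ex: "\<exists>C>0. \<exists>r>0. \<forall>z. norm z < r \<longrightarrow> C * norm z powr (real k - 1) \<le> norm (gradient f z)"
  proof (rule gradient_bound[OF f kou isolated_support.nonempty[OF iso] k1])
    fix v :: "real ^ 3" and i0
    assume "\<And>l. 0 < v $ l" "\<And>l. v $ i0 \<le> v $ l" "\<And>\<nu>. \<nu> \<in> supp a \<Longrightarrow> (real k - 1 + 1) * v $ i0 < weight v \<nu>"
    then show "\<exists>j \<nu>. dominates (supp a) v j \<nu> \<and> weight v \<nu> - v $ j \<le> (real k - 1) * v $ i0"
      using dominates_of_special_pair[OF iso u(2) k, of v i0] by simp
  qed
  then show "lojasiewicz_exponent f \<le> real k - 1"
    by (rule lojasiewicz_exponent_le[OF k1])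
  show "real k - 1 \<le> lojasiewicz_exponent f"
    unfolding lojasiewicz_exponent_def
  proof (rule cInf_greatest)
    show "{\<alpha>. 0 \<le> \<alpha> \<and> (\<exists>C>0. \<exists>r>0. \<forall>z. norm z < r \<longrightarrow> norm (gradient f z) \<ge> C * norm z powr \<alpha>)} \<noteq> {}"
      using ex k1 by blast
  next
    fix \<alpha> assume "\<alpha> \<in> {\<alpha>. 0 \<le> \<alpha> \<and> (\<exists>C>0. \<exists>r>0. \<forall>z. norm z < r \<longrightarrow> norm (gradient f z) \<ge> C * norm z powr \<alpha>)}"
    then obtain C r where "0 \<le> \<alpha>" "0 < C" "0 < r" "\<And>z. norm z < r \<Longrightarrow> C * norm z powr \<alpha> \<le> norm (gradient f z)"
      by blast
    then show "real k - 1 \<le> \<alpha>"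
      using special_pair_exponent_ge[OF f u k, of C r \<alpha>] by blast
  qed
qed

text \<open>Since all exponents have degree at least 2, the weight of a face is at least twice the
  least entry of its normal. It provides the hypothesis \<open>2 \<le> m\<close> of
  \<open>dominating_monomial\<close>.\<close>

lemma two_le_max_intercept:
  assumes iso: "isolated_support (supp a)" and F: "F \<in> compact_faces_dim 2 a"
  shows "2 \<le> max_intercept F"
proof -
  obtain u where u: "\<And>l. 0 < u $ l" and FD: "F = convex hull (exponent_point ` argmins (supp a) u)"
    and nc: "\<not> collinear F"
    using F compact_face_dim2_iff[OF isolated_support.nonempty[OF iso]] by blast
  obtain \<nu> where \<nu>: "\<nu> \<in> argmins (supp a) u"
    using argmins_nonempty[OF isolated_support.nonempty[OF iso], of u] u by (auto simp: nonneg_orthant_def less_imp_le)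
  obtain i where i: "\<And>l. u $ i \<le> u $ l"
    by (rule exists_min_coordinate) blast
  have "2 \<le> (\<Sum>l\<in>UNIV. \<nu> $ l)"
    using isolated_support.degree_ge_2[OF iso, of \<nu>] \<nu> by (simp add: argmins_def)
  then have "2 \<le> (\<Sum>l\<in>UNIV. real (\<nu> $ l))"
    by (simp flip: of_nat_sum)
  then have "u $ i * 2 \<le> u $ i * (\<Sum>l\<in>UNIV. real (\<nu> $ l))"
    using u[of i] by (intro mult_left_mono) auto
  also have "\<dots> \<le> weight u \<nu>"
    unfolding weight_sum sum_distrib_left by (intro sum_mono mult_right_mono i) simp
  finally have "2 \<le> weight u \<nu> / u $ i"
    using u[of i] by (simp add: field_simps)
  also have "\<dots> \<le> max_intercept F"
    unfolding FD max_intercept_eq[OF u \<nu> nc[unfolded FD]] by (rule Max_ge) auto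
  finally show ?thesis .
qed

theorem theorem1p8:
  fixes f :: "complex ^ 3 \<Rightarrow> complex"
    and a :: "nat ^ 3 \<Rightarrow> complex"
  assumes "has_taylor_expansion f a"
    and "isolated_singularity f"
    and "kouchnirenko_nondegenerate a"
  shows "(compact_faces_dim 2 a = {} \<or> compact_faces_dim 2 a = exceptional_faces a \<longrightarrow>
            (\<exists>!I. I \<in> special_segments \<inter> compact_faces_dim 1 a) \<and>
            (\<forall>I \<in> special_segments \<inter> compact_faces_dim 1 a.
               lojasiewicz_exponent f = real (segment_height I) - 1)) \<and>
         (compact_faces_dim 2 a - exceptional_faces a \<noteq> {} \<longrightarrow>
            lojasiewicz_exponent f \<le>
              Max (max_intercept ` (compact_faces_dim 2 a - exceptional_faces a)) - 1)"
proof -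
  have iso: "isolated_support (supp a)"
    by (rule isolated_support_supp[OF assms(1,2)])
  note ne = isolated_support.nonempty[OF iso]
  have special: "\<exists>j k u. I = special_segment j k \<and> 2 \<le> k \<and> (\<forall>l. 0 < u $ l) \<and> argmins (supp a) u = special_pair j k"
    if I: "I \<in> special_segments \<inter> compact_faces_dim 1 a" for I
  proof -
    obtain j k where jk: "I = special_segment j k" "2 \<le> k"
      using I by (auto simp: special_segments_def)
    moreover have "special_segment j k \<in> compact_faces_dim 1 a"
      using I jk by simp
    then obtain u where "\<forall>l. 0 < u $ l" "argmins (supp a) u = special_pair j k"
      unfolding special_segment_face_iff[OF ne] by blast
    ultimately show ?thesis
      by (intro exI[of _ j] exI[of _ k] exI[of _ u] conjI)
  qed
  \<comment> \<open>Both alternatives in part (1) are used only through the absence of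
    nonexceptional faces.\<close>
  have unique: "\<exists>!I. I \<in> special_segments \<inter> compact_faces_dim 1 a"
    if all: "compact_faces_dim 2 a - exceptional_faces a = {}"
  proof -
    obtain l n u where u: "\<And>i. 0 < u $ i" "argmins (supp a) u = special_pair l n"
      using exists_special_pair[OF iso all] by blast
    have "(\<chi> i. if i = l then n else 0) \<in> argmins (supp a) u"
      by (simp add: u special_pair_def)
    then have "2 \<le> (\<Sum>i\<in>UNIV. (\<chi> i. if i = l then n else 0) $ i)"
      by (intro isolated_support.degree_ge_2[OF iso]) (simp add: argmins_def)
    then have n: "2 \<le> n"
      by simp
    have face: "special_segment l n \<in> compact_faces_dim 1 a"
      unfolding special_segment_face_iff[OF ne] using u by blast
    show ?thesis
    proof (rule ex1I)
      show "special_segment l n \<in> special_segments \<inter> compact_faces_dim 1 a"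
        using face n by (auto simp: special_segments_def)
    next
      fix I assume "I \<in> special_segments \<inter> compact_faces_dim 1 a"
      from special[OF this] obtain j k v where v: "I = special_segment j k" "\<And>l. 0 < v $ l" "argmins (supp a) v = special_pair j k"
        by blast
      then show "I = special_segment l n"
        using special_pair_unique[OF u v(2,3)] by simp
    qed
  qed
  have exponent: "lojasiewicz_exponent f = real (segment_height I) - 1"
    if "I \<in> special_segments \<inter> compact_faces_dim 1 a" for I
  proof -
    from special[OF that] obtain j k u where u: "I = special_segment j k" "2 \<le> k" "\<And>l. 0 < u $ l" "argmins (supp a) u = special_pair j k"
      by blast
    show ?thesis
      using lojasiewicz_exponent_special_pair[OF assms(1,3) iso u(3,4,2)] by (simp add: u(1) segment_height_special_segment[OF u(2)])
  qed
  have bound: "lojasiewicz_exponent f \<le> Max (max_intercept ` (compact_faces_dim 2 a - exceptional_faces a)) - 1"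
    if nonex: "compact_faces_dim 2 a - exceptional_faces a \<noteq> {}"
  proof -
    define m where "m = Max (max_intercept ` (compact_faces_dim 2 a - exceptional_faces a))"
    have fin: "finite (compact_faces_dim 2 a - exceptional_faces a)"
      using finite_compact_faces[OF ne] by (auto simp: compact_faces_dim_def)
    have max: "max_intercept F \<le> m" if "F \<in> compact_faces_dim 2 a - exceptional_faces a" for F
      unfolding m_def using fin that by (intro Max_ge) auto
    obtain F where F: "F \<in> compact_faces_dim 2 a - exceptional_faces a"
      using nonex by blast
    have m: "2 \<le> m"
      using two_le_max_intercept[OF iso, of F] max[OF F] F by auto
    \<comment> \<open>An edge \<open>I_l^n\<close> would make the given face \<open>F\<close>
      exceptional.\<close>
    have no: "argmins (supp a) u \<noteq> special_pair l n" if "\<And>i. 0 < u $ i" for l n u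
      using exceptional_of_special_pair[OF ne that, of l n F] F by blast
    have "\<exists>C>0. \<exists>r>0. \<forall>z. norm z < r \<longrightarrow> C * norm z powr (m - 1) \<le> norm (gradient f z)"
    proof (rule gradient_bound[OF assms(1,3) ne])
      show "0 \<le> m - 1"
        using m by simp
    next
      fix u :: "real ^ 3" and i
      assume "\<And>l. 0 < u $ l" "\<And>l. u $ i \<le> u $ l" "\<And>\<nu>. \<nu> \<in> supp a \<Longrightarrow> (m - 1 + 1) * u $ i < weight u \<nu>"
      then show "\<exists>j \<nu>. dominates (supp a) u j \<nu> \<and> weight u \<nu> - u $ j \<le> (m - 1) * u $ i"
        using dominates_of_nonexceptional[OF iso m max no, of u i] by simp
    qed
    then show ?thesis
      unfolding m_def[symmetric] using m by (intro lojasiewicz_exponent_le) auto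
  qed
  show ?thesis
    using unique exponent bound by auto
qed

end
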